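(* Consider graphs obtained from a complete graph or a complete partite graph by deleting exactly one edge. Write $K_{n_1,\ldots,n_k}-e$ for the graph obtained by deleting an arbitrary edge (the statement then holds for every choice of the deleted edge), and $K_{n_1,\ldots,n_k}-(x,y)$ for the graph obtained by deleting an edge joining a vertex of part $X$ to a vertex of part $Y$, where the parts are named $A,B,C,D,E,\ldots$ in the order in which their sizes are listed. Let $n$ denote an arbitrary positive integer. (1) The following graphs are intrinsically linked: $K_7-e$; $K_{4,4}-e$; $K_{4,3,1}-e$; $K_{3,3,2}-e$; $K_{4,2,2}-e$; $K_{2,2,2,2}-e$; $K_{3,2,1,1}-(b,c)$; $K_{4,2,1,1}-e$; $K_{3,3,1,1}-e$; $K_{3,2,2,1}-e$; $K_{2,2,1,1,1}-(b,c)$; $K_{3,1,1,1,1}-(b,c)$; $K_{4,1,1,1,1}-e$; $K_{3,2,1,1,1}-e$; $K_{2,2,2,1,1}-e$; $K_{2,1,1,1,1,1}-e$; and every graph obtained from a complete $k$-partite graph with $k\geq 7$ by deleting one edge. (2) The following graphs are not intrinsically linked: $K_6-e$; $K_{n,3}-e$; $K_{3,2,2}-e$; $K_{n,2,1}-e$; $K_{3,3,1}-e$; $K_{2,2,2,1}-e$; $K_{n,1,1,1}-e$; $K_{3,2,1,1}-(a,b)$; $K_{3,2,1,1}-(a,c)$; $K_{3,2,1,1}-(c,d)$; $K_{2,2,1,1,1}-(a,b)$; $K_{2,2,1,1,1}-(c,d)$; $K_{3,1,1,1,1}-(a,b)$; $K_{2,1,1,1,1}-e$; $K_{1,1,1,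1,1,1}-e$.
   Context: $K_m$ is the complete graph on $m$ vertices; $K_{n_1,\ldots,n_k}$ is the complete $k$-partite graph with parts of sizes $n_1,\ldots,n_k\ge1$. For example, in $K_{3,2,1,1}$, part $A$ has 3 vertices, $B$ has 2, $C$ and $D$ have 1 each, and $(b,c)$ denotes an edge between a vertex of $B$ and the vertex of $C$. A graph is intrinsically linked if every tame embedding of it in $\mathbb{R}^3$ contains a pair of disjoint cycles forming a non-trivial (non-split) link. *)

theory Defs
  imports "HOL-Analysis.Analysis"
begin

text \<open>Finite simple graphs: a vertex set and a set of 2-element edges.\<close>
type_synonym 'a graph = "'a set \<times> 'a set set"

definition verts :: "'a graph \<Rightarrow> 'a set" where "verts G = fst G"
definition edges :: "'a graph \<Rightarrow> 'a set set" where "edges G = snd G"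

definition complete_graph :: "nat \<Rightarrow> nat graph" where
  "complete_graph m = ({..<m}, {{u, v} | u v. u < m \<and> v < m \<and> u \<noteq> v})"

text \<open>Complete multipartite graph K_{n_1,...,n_k}, ns = [n_1,...,n_k];
  vertex (i,j) is the j-th vertex of part i (part 0 = A, 1 = B, 2 = C, ...).\<close>
definition complete_partite :: "nat list \<Rightarrow> (nat \<times> nat) graph" where
  "complete_partite ns =
     ({(i, j). i < length ns \<and> j < ns ! i},
      {{(i, j), (i', j')} | i j i' j'.
         i < length ns \<and> j < ns ! i \<and> i' < length ns \<and> j' < ns ! i' \<and> i \<noteq> i'})"

definition delete_edge :: "'a graph \<Rightarrow> 'a set \<Rightarrow> 'a graph" where
  "delete_edge G e = (verts G, edges G - {e})"

definition edge_between :: "nat list \<Rightarrow> nat \<Rightarrow> nat \<Rightarrow> (nat \<times> nat) set \<Rightarrow> bool" where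
  "edge_between ns x y e \<longleftrightarrow> (\<exists>j j'. e = {(x, j), (y, j')} \<and> j < ns ! x \<and> j' < ns ! y)"

definition tame_embedding ::
    "'a graph \<Rightarrow> ('a \<Rightarrow> real^3) \<Rightarrow> ('a set \<Rightarrow> real \<Rightarrow> real^3) \<Rightarrow> bool" where
  "tame_embedding G p \<gamma> \<longleftrightarrow>
     inj_on p (verts G) \<and>
     (\<forall>e\<in>edges G. arc (\<gamma> e) \<and> {pathstart (\<gamma> e), pathfinish (\<gamma> e)} = p ` e \<and>
        (\<exists>F :: ((real^3) \<times> (real^3)) set. finite F \<and>
            path_image (\<gamma> e) = (\<Union>(a, b)\<in>F. closed_segment a b))) \<and>
     (\<forall>e\<in>edges G. \<forall>v\<in>verts G. p v \<in> path_image (\<gamma> e) \<longrightarrow> v \<in> e) \<and>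
     (\<forall>e\<in>edges G. \<forall>e'\<in>edges G. e \<noteq> e' \<longrightarrow>
        path_image (\<gamma> e) \<inter> path_image (\<gamma> e') \<subseteq> p ` (e \<inter> e'))"

definition is_cycle :: "'a graph \<Rightarrow> 'a list \<Rightarrow> bool" where
  "is_cycle G vs \<longleftrightarrow> distinct vs \<and> length vs \<ge> 3 \<and> set vs \<subseteq> verts G \<and>
     (\<forall>i < length vs. {vs ! i, vs ! (Suc i mod length vs)} \<in> edges G)"

definition cycle_edges :: "'a list \<Rightarrow> 'a set set" where
  "cycle_edges vs = {{vs ! i, vs ! (Suc i mod length vs)} | i. i < length vs}"

definition cycle_image :: "('a set \<Rightarrow> real \<Rightarrow> real^3) \<Rightarrow> 'a list \<Rightarrow> (real^3) set" where
  "cycle_image \<gamma> vs = (\<Union>e\<in>cycle_edges vs. path_image (\<gamma> e))"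

definition split_link :: "(real^3) set \<Rightarrow> (real^3) set \<Rightarrow> bool" where
  "split_link K1 K2 \<longleftrightarrow>
     (\<exists>S :: (real^3) set. S homeomorphic sphere (0 :: real^3) 1 \<and> S \<inter> (K1 \<union> K2) = {} \<and>
        (\<forall>x\<in>K1. \<forall>y\<in>K2. \<not> connected_component (- S) x y))"

definition intrinsically_linked :: "'a graph \<Rightarrow> bool" where
  "intrinsically_linked G \<longleftrightarrow>
     (\<forall>p \<gamma>. tame_embedding G p \<gamma> \<longrightarrow>
        (\<exists>c1 c2. is_cycle G c1 \<and> is_cycle G c2 \<and> set c1 \<inter> set c2 = {} \<and>
           \<not> split_link (cycle_image \<gamma> c1) (cycle_image \<gamma> c2)))"

end

theory Submission
  imports Defs "HOL-Library.Z2" "HOL-Computational_Algebra.Polynomial"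
begin

text \<open>
  Linkedness. A tame embedding can be replaced by a polygonal one in general position whose disjoint cycles are
  still separated by the same spheres. Two closed polygons separated by a sphere have even linking number: the
  half solid angle phase of one of them is a nonvanishing function off that polygon and has a logarithm on the
  sphere, hence by Tietze extension on the other polygon, and the increments of this logarithm count modulo 2 how
  often an edge of one polygon passes behind an edge of the other. Summed over the ten pairs of disjoint triangles of \<open>K\<^sub>6\<close>, these counts
  give the number of crossings of disjoint edges of a projected \<open>K\<^sub>5\<close>, which is odd by van Kampen. So \<open>K\<^sub>6\<close>
  and its Delta-Wye transforms are linked, and each graph in (1) contains one of them whichever edge is deleted.

  Unlinkedness. Outside the part of size \<open>n\<close>, the graphs with that parameter have three vertices only, and every cycle
  uses two of them, so there are no disjoint cycles. The other graphs in (2) embed in \<open>K\<^sub>7\<close> minus a path with three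
  edges or minus three disjoint edges. Both have straight embeddings in which no edge meets the flat disc spanned
  by a disjoint triangle; of two disjoint cycles one is a triangle, and a small neighbourhood of its disc separates
  it from the other.
\<close>

section \<open>Spinors and solid angles\<close>

text \<open>The sphere in \<open>split_link\<close> is merely topological and may be wild, so
  isotopies, spanning surfaces and transversality are out of reach. What survives is that a
  continuous nonvanishing complex function on it has a logarithm, so the linking number has to be
  read off from such a function. The solid angle of a polygon is defined only up to 4 pi; half of it
  is therefore an honest argument of a complex number, and a product of spinor overlaps realizes it
  without cuts. Coning the polygon from the origin splits this function into one factor per edge,
  and the argument of a factor makes an extra turn exactly when the moving point passes through the
  triangle spanned by the origin and that edge. This count is not symmetric in the two polygons, but
  at a crossing in projection exactly one strand is in front, so the two counts for a pair of edges
  add up to its crossings. That is how linking in K6 meets the van Kampen number. Signs are dropped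
  as soon as possible: everything combinatorial happens in the type \<open>bit\<close>, where
  directions of edges do not matter.\<close>

declare add_bit_eq_xor [simp del] mult_bit_eq_and [simp del]

definition det3 :: "real^3 \<Rightarrow> real^3 \<Rightarrow> real^3 \<Rightarrow> real" where
  "det3 u v w = u$1 * (v$2 * w$3 - v$3 * w$2) - u$2 * (v$1 * w$3 - v$3 * w$1)
     + u$3 * (v$1 * w$2 - v$2 * w$1)"

text \<open>The spinor \<open>(spin1 a, spin2 a)\<close> is a square root of the vector \<open>a\<close>; the phase of a product of overlaps around a
  triangle is half the solid angle of the triangle seen from the origin.\<close>
definition spin1 :: "real^3 \<Rightarrow> complex" where
  "spin1 a = (if norm a + a$3 > 0 then complex_of_real (sqrt (norm a + a$3)) else 0)"

definition spin2 :: "real^3 \<Rightarrow> complex" where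
  "spin2 a = (if norm a + a$3 > 0 then Complex (a$1) (a$2) / complex_of_real (sqrt (norm a + a$3))
     else complex_of_real (sqrt (2 * norm a)))"

definition overlap :: "real^3 \<Rightarrow> real^3 \<Rightarrow> complex" where
  "overlap a b = cnj (spin1 a) * spin1 b + cnj (spin2 a) * spin2 b"

lemma norm_sq_3: "(norm (a::real^3))\<^sup>2 = (a$1)\<^sup>2 + (a$2)\<^sup>2 + (a$3)\<^sup>2"
  unfolding power2_norm_eq_inner by (simp add: inner_vec_def sum_3 power2_eq_square)

lemma norm_plus_third:
  fixes a :: "real^3"
  shows "0 \<le> norm a + a$3"
    and "norm a + a$3 = 0 \<Longrightarrow> a$1 = 0 \<and> a$2 = 0 \<and> a$3 = - norm a"
proof -
  show "0 \<le> norm a + a$3"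
    using component_le_norm_cart[of a 3] by linarith
  assume *: "norm a + a$3 = 0"
  then have "(norm a)\<^sup>2 = (a$3)\<^sup>2" by (simp add: power2_eq_iff)
  then have "(a$1)\<^sup>2 + (a$2)\<^sup>2 = 0" using norm_sq_3[of a] by simp
  then show "a$1 = 0 \<and> a$2 = 0 \<and> a$3 = - norm a" using * by (simp add: sum_power2_eq_zero_iff)
qed

text \<open>These are the entries of \<open>norm a\<close> times the identity plus the Pauli matrix
  of \<open>a\<close>, the rank one matrix that the spinor squares to. They depend continuously on
  \<open>a\<close>, unlike the spinor, which jumps at the negative third axis. In a closed product
  of overlaps each spinor meets its own conjugate, so only these entries survive.\<close>

lemma spin_products:
  fixes a :: "real^3"
  shows "spin1 a * cnj (spin1 a) = complex_of_real (norm a + a$3)"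
    and "spin2 a * cnj (spin2 a) = complex_of_real (norm a - a$3)"
    and "spin2 a * cnj (spin1 a) = Complex (a$1) (a$2)"
    and "spin1 a * cnj (spin2 a) = Complex (a$1) (- a$2)"
proof -
  consider "norm a + a$3 > 0" | "norm a + a$3 = 0"
    using norm_plus_third(1)[of a] by linarith
  then have "spin1 a * cnj (spin1 a) = complex_of_real (norm a + a$3) \<and>
     spin2 a * cnj (spin2 a) = complex_of_real (norm a - a$3) \<and>
     spin2 a * cnj (spin1 a) = Complex (a$1) (a$2) \<and>
     spin1 a * cnj (spin2 a) = Complex (a$1) (- a$2)"
  proof cases
    case 1
    let ?s = "sqrt (norm a + a$3)"
    have s: "?s > 0" "?s * ?s = norm a + a$3" using 1 by auto
    have "Complex (a$1) (a$2) * cnj (Complex (a$1) (a$2)) = complex_of_real ((a$1)\<^sup>2 + (a$2)\<^sup>2)"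
      by (simp add: complex_eq_iff power2_eq_square)
    also have "(a$1)\<^sup>2 + (a$2)\<^sup>2 = (norm a + a$3) * (norm a - a$3)"
      using norm_sq_3[of a] by (simp add: algebra_simps power2_eq_square)
    finally have e: "Complex (a$1) (a$2) * cnj (Complex (a$1) (a$2))
        = complex_of_real ((norm a + a$3) * (norm a - a$3))" .
    have d: "complex_of_real ?s * complex_of_real ?s = complex_of_real (norm a + a$3)"
      using s(2) by (metis of_real_mult)
    have "spin2 a * cnj (spin2 a)
       = Complex (a$1) (a$2) * cnj (Complex (a$1) (a$2)) / (complex_of_real ?s * complex_of_real ?s)"
      using 1 by (simp add: spin2_def)
    also have "\<dots> = complex_of_real (norm a - a$3)"
      unfolding e d using 1 by (simp del: of_real_add of_real_diff)
    finally have "spin2 a * cnj (spin2 a) = complex_of_real (norm a - a$3)" .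
    moreover have "cnj (Complex (a$1) (a$2)) = Complex (a$1) (- a$2)" by (simp add: complex_eq_iff)
    ultimately show ?thesis
      using 1 s d by (auto simp: spin1_def spin2_def simp del: of_real_add)
  next
    \<comment> \<open>The negative third axis, origin included, where the default values of
      \<open>spin1\<close> and \<open>spin2\<close> apply.\<close>
    case 2
    have "complex_of_real (sqrt (2 * norm a)) * complex_of_real (sqrt (2 * norm a))
      = complex_of_real (2 * norm a)"
      unfolding of_real_mult[symmetric] by simp
    then show ?thesis using 2 norm_plus_third(2)[OF 2]
      by (auto simp: spin1_def spin2_def complex_eq_iff)
  qed
  then show "spin1 a * cnj (spin1 a) = complex_of_real (norm a + a$3)"
    "spin2 a * cnj (spin2 a) = complex_of_real (norm a - a$3)"
    "spin2 a * cnj (spin1 a) = Complex (a$1) (a$2)"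
    "spin1 a * cnj (spin2 a) = Complex (a$1) (- a$2)" by auto
qed

lemma overlap_cnj: "overlap b a = cnj (overlap a b)"
  by (simp add: overlap_def mult.commute)

lemma overlap_pair:
  fixes a b :: "real^3"
  shows "overlap a b * overlap b a = complex_of_real (2 * (norm a * norm b + a \<bullet> b))"
proof -
  have "overlap a b * overlap b a =
     (spin1 a * cnj (spin1 a)) * (spin1 b * cnj (spin1 b)) +
     (spin2 a * cnj (spin1 a)) * (spin1 b * cnj (spin2 b)) +
     (spin1 a * cnj (spin2 a)) * (spin2 b * cnj (spin1 b)) +
     (spin2 a * cnj (spin2 a)) * (spin2 b * cnj (spin2 b))"
    by (simp add: overlap_def algebra_simps)
  also have "\<dots> = complex_of_real (2 * (norm a * norm b + a \<bullet> b))"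
    unfolding spin_products by (simp add: complex_eq_iff inner_vec_def sum_3 algebra_simps)
  finally show ?thesis .
qed

text \<open>The denominator in the formula of Van Oosterom and Strackee: half the solid angle of the
  triangle \<open>a\<close>, \<open>b\<close>, \<open>c\<close> seen from the origin has tangent
  \<open>det3 a b c / solid a b c\<close>.\<close>

definition solid :: "real^3 \<Rightarrow> real^3 \<Rightarrow> real^3 \<Rightarrow> real" where
  "solid a b c = norm a * norm b * norm c + (a \<bullet> b) * norm c + (b \<bullet> c) * norm a + (c \<bullet> a) * norm b"

lemma overlap_triple:
  fixes a b c :: "real^3"
  shows "overlap a b * overlap b c * overlap c a = 2 * Complex (solid a b c) (det3 a b c)"
proof -
  have "overlap a b * overlap b c * overlap c a =
     (spin1 a * cnj (spin1 a)) * (spin1 b * cnj (spin1 b)) * (spin1 c * cnj (spin1 c)) +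
     (spin1 a * cnj (spin1 a)) * (spin1 b * cnj (spin2 b)) * (spin2 c * cnj (spin1 c)) +
     (spin1 a * cnj (spin1 a)) * (spin2 b * cnj (spin1 b)) * (spin1 c * cnj (spin2 c)) * 0 +
     (spin1 a * cnj (spin2 a)) * (spin2 b * cnj (spin1 b)) * (spin1 c * cnj (spin1 c)) +
     (spin1 a * cnj (spin2 a)) * (spin2 b * cnj (spin2 b)) * (spin2 c * cnj (spin1 c)) +
     (spin2 a * cnj (spin1 a)) * (spin1 b * cnj (spin1 b)) * (spin1 c * cnj (spin2 c)) +
     (spin2 a * cnj (spin1 a)) * (spin1 b * cnj (spin2 b)) * (spin2 c * cnj (spin2 c)) +
     (spin2 a * cnj (spin2 a)) * (spin2 b * cnj (spin1 b)) * (spin1 c * cnj (spin2 c)) +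
     (spin2 a * cnj (spin2 a)) * (spin2 b * cnj (spin2 b)) * (spin2 c * cnj (spin2 c))"
    by (simp add: overlap_def algebra_simps)
  also have "\<dots> = 2 * Complex (solid a b c) (det3 a b c)"
    unfolding spin_products
    by (simp add: complex_eq_iff inner_vec_def sum_3 algebra_simps solid_def det3_def)
  finally show ?thesis .
qed

lemma overlap_eq_0_iff: "overlap a b = 0 \<longleftrightarrow> norm a * norm b + a \<bullet> b = 0"
proof -
  have "complex_of_real ((cmod (overlap a b))\<^sup>2) = complex_of_real (2 * (norm a * norm b + a \<bullet> b))"
    using overlap_pair[of a b] by (simp only: overlap_cnj[of b a] complex_norm_square)
  then have "(cmod (overlap a b))\<^sup>2 = 2 * (norm a * norm b + a \<bullet> b)"
    using of_real_eq_iff by blast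
  then have "(cmod (overlap a b))\<^sup>2 = 0 \<longleftrightarrow> norm a * norm b + a \<bullet> b = 0"
    by (simp only: mult_eq_0_iff) simp
  then show ?thesis by simp
qed

lemma norm_add_inner_nonneg: "0 \<le> norm a * norm b + (a::real^3) \<bullet> b"
  using Cauchy_Schwarz_ineq2[of a b] by (simp add: abs_le_iff)

text \<open>A zero overlap means that \<open>a - x\<close> and \<open>b - x\<close> point in
  opposite directions (or one is 0), which turns the triangle inequality through \<open>x\<close>
  into an equality.\<close>

lemma overlap_zero_segment:
  fixes a b x :: "real^3"
  assumes "overlap (a - x) (b - x) = 0"
  shows "x \<in> closed_segment a b"
proof -
  let ?A = "a - x" and ?B = "b - x"
  have z: "norm ?A * norm ?B + ?A \<bullet> ?B = 0" using assms overlap_eq_0_iff by blast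
  have "(norm (?A - ?B))\<^sup>2 = (norm ?A + norm ?B)\<^sup>2"
    using z by (simp add: power2_norm_eq_inner inner_diff_left inner_diff_right inner_commute
        power2_sum algebra_simps)
  then have "norm (a - b) = norm ?A + norm ?B" by (simp add: power2_eq_iff_nonneg)
  then have "dist a b = dist a x + dist x b" by (simp add: dist_norm norm_minus_commute)
  then show ?thesis using between between_mem_segment by blast
qed

section \<open>Closed polygonal chains and their solid angle phase\<close>

definition closed_chain :: "('v \<times> 'v) list \<Rightarrow> bool" where
  "closed_chain ss \<longleftrightarrow> mset (map fst ss) = mset (map snd ss)"

definition chain_image :: "((real^3) \<times> (real^3)) list \<Rightarrow> (real^3) set" where
  "chain_image ss = (\<Union>(a, b)\<in>set ss. closed_segment a b)"

text \<open>The argument of this product is half the solid angle of the chain \<open>tt\<close> seen from \<open>x\<close>, so its winding along a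
  loop avoiding \<open>tt\<close> is the linking number.\<close>
definition solid_phase :: "((real^3) \<times> (real^3)) list \<Rightarrow> real^3 \<Rightarrow> complex" where
  "solid_phase tt x = (\<Prod>(a, b)\<leftarrow>tt. overlap (a - x) (b - x))"

text \<open>By \<open>overlap_triple\<close>, the product of overlaps around the triangle
  \<open>w\<close>, \<open>a\<close>, \<open>b\<close> seen from \<open>x\<close>, in a form whose
  continuity in \<open>x\<close> is evident; \<open>spoke\<close> does the same for an overlap times
  its conjugate.\<close>

definition tri_phase :: "real^3 \<Rightarrow> real^3 \<Rightarrow> real^3 \<Rightarrow> real^3 \<Rightarrow> complex" where
  "tri_phase w a b x = 2 * Complex (solid (w - x) (a - x) (b - x)) (det3 (w - x) (a - x) (b - x))"

definition spoke :: "real^3 \<Rightarrow> real^3 \<Rightarrow> real^3 \<Rightarrow> real" where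
  "spoke w a x = 2 * (norm (w - x) * norm (a - x) + (w - x) \<bullet> (a - x))"

lemma prod_list_mult_map:
  "(\<Prod>x\<leftarrow>xs. f x * g x) = (\<Prod>x\<leftarrow>xs. f x) * (\<Prod>x\<leftarrow>xs. g x :: 'b::comm_monoid_mult)"
  by (induction xs) (auto simp: mult_ac)

lemma closed_chain_prod_list:
  fixes f :: "'v \<Rightarrow> 'b::comm_monoid_mult"
  assumes "closed_chain ss"
  shows "(\<Prod>(a, b)\<leftarrow>ss. f b) = (\<Prod>(a, b)\<leftarrow>ss. f a)"
proof -
  have "prod_list (map f (map snd ss)) = prod_list (map f (map fst ss))"
    using assms unfolding closed_chain_def by (metis mset_map prod_mset_prod_list)
  then show ?thesis by (simp add: case_prod_unfold comp_def)
qed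

lemma closed_chain_sum_list:
  fixes f :: "'v \<Rightarrow> 'b::comm_monoid_add"
  assumes "closed_chain ss"
  shows "(\<Sum>(a, b)\<leftarrow>ss. f b) = (\<Sum>(a, b)\<leftarrow>ss. f a)"
proof -
  have "sum_list (map f (map snd ss)) = sum_list (map f (map fst ss))"
    using assms unfolding closed_chain_def by (metis mset_map sum_mset_sum_list)
  then show ?thesis by (simp add: case_prod_unfold comp_def)
qed

text \<open>Coning the chain from \<open>w\<close>: each triangle contributes its outer edge and two
  spokes. Every vertex is as often a start as an end, so the spokes pair up with their conjugates
  and leave a nonnegative real factor, which does not affect the argument where it is
  nonzero.\<close>

lemma solid_phase_cone:
  assumes "closed_chain tt"
  shows "(\<Prod>(a, b)\<leftarrow>tt. tri_phase w a b x)
    = solid_phase tt x * complex_of_real (\<Prod>(a, b)\<leftarrow>tt. spoke w a x)"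
proof -
  have "(\<Prod>(a, b)\<leftarrow>tt. tri_phase w a b x) =
    (\<Prod>s\<leftarrow>tt. (case s of (a, b) \<Rightarrow> overlap (a - x) (b - x)) *
       ((case s of (a, b) \<Rightarrow> overlap (w - x) (a - x)) * (case s of (a, b) \<Rightarrow> overlap (b - x) (w - x))))"
    by (intro arg_cong[where f = prod_list] map_cong refl)
       (auto simp: tri_phase_def overlap_triple[symmetric] mult_ac)
  also have "\<dots> = solid_phase tt x * ((\<Prod>(a, b)\<leftarrow>tt. overlap (w - x) (a - x)) *
      (\<Prod>(a, b)\<leftarrow>tt. overlap (b - x) (w - x)))"
    by (simp add: prod_list_mult_map solid_phase_def)
  also have "(\<Prod>(a, b)\<leftarrow>tt. overlap (b - x) (w - x)) = (\<Prod>(a, b)\<leftarrow>tt. overlap (a - x) (w - x))"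
    using closed_chain_prod_list[OF assms, of "\<lambda>a. overlap (a - x) (w - x)"] .
  also have "(\<Prod>(a, b)\<leftarrow>tt. overlap (w - x) (a - x)) * (\<Prod>(a, b)\<leftarrow>tt. overlap (a - x) (w - x))
     = (\<Prod>s\<leftarrow>tt. (case s of (a, b) \<Rightarrow> overlap (w - x) (a - x)) * (case s of (a, b) \<Rightarrow> overlap (a - x) (w - x)))"
    by (simp add: prod_list_mult_map)
  also have "\<dots> = (\<Prod>(a, b)\<leftarrow>tt. complex_of_real (spoke w a x))"
    by (intro arg_cong[where f = prod_list] map_cong refl) (auto simp: overlap_pair spoke_def)
  also have "\<dots> = complex_of_real (\<Prod>(a, b)\<leftarrow>tt. spoke w a x)"
    by (induction tt) auto
  finally show ?thesis .
qed

lemma spoke_nonneg: "0 \<le> spoke w a x"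
  unfolding spoke_def using norm_add_inner_nonneg[of "w - x" "a - x"] by simp

lemma spoke_zero_segment: "spoke w a x = 0 \<Longrightarrow> x \<in> closed_segment w a"
  unfolding spoke_def using overlap_eq_0_iff overlap_zero_segment by auto

lemma solid_phase_nonzero:
  assumes "x \<notin> chain_image tt"
  shows "solid_phase tt x \<noteq> 0"
  using assms overlap_zero_segment
  by (fastforce simp: solid_phase_def chain_image_def prod_list_zero_iff)

lemma continuous_on_prod_list:
  fixes f :: "'i \<Rightarrow> 'a::topological_space \<Rightarrow> 'b::real_normed_field"
  assumes "\<And>i. i \<in> set xs \<Longrightarrow> continuous_on S (f i)"
  shows "continuous_on S (\<lambda>x. \<Prod>i\<leftarrow>xs. f i x)"
  using assms by (induction xs) (auto intro!: continuous_intros)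

lemma continuous_on_det3 [continuous_intros]:
  assumes "continuous_on S f" "continuous_on S g" "continuous_on S h"
  shows "continuous_on S (\<lambda>x. det3 (f x) (g x) (h x))"
  unfolding det3_def by (intro continuous_intros assms)

lemma continuous_on_tri_phase [continuous_intros]:
  assumes "continuous_on S f"
  shows "continuous_on S (\<lambda>x. tri_phase w a b (f x))"
  unfolding tri_phase_def solid_def Complex_eq by (intro continuous_intros assms)

lemma continuous_on_spoke [continuous_intros]:
  assumes "continuous_on S f"
  shows "continuous_on S (\<lambda>x. spoke w a (f x))"
  unfolding spoke_def by (intro continuous_intros assms)

text \<open>For an apex at unit distance from \<open>x\<close>, a spoke vanishes only in the
  direction opposite to \<open>a\<close>. This excludes finitely many directions, and the unit
  sphere is infinite.\<close>

lemma exists_apex: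
  fixes x :: "real^3"
  assumes "finite A" "x \<notin> A"
  shows "\<exists>w. \<forall>a\<in>A. spoke w a x \<noteq> 0"
proof -
  let ?B = "(\<lambda>a. - ((1 / norm (a - x)) *\<^sub>R (a - x))) ` A"
  have "infinite (sphere (0::real^3) 1)"
  proof
    assume "finite (sphere (0::real^3) 1)"
    then have "sphere (0::real^3) 1 = {} \<or> (\<exists>a. sphere (0::real^3) 1 = {a})"
      using connected_finite_iff_sing[of "sphere (0::real^3) 1"] connected_sphere[of "0::real^3" 1] by auto
    moreover have "axis 1 1 \<in> sphere (0::real^3) 1" "- axis 1 1 \<in> sphere (0::real^3) 1"
      by (auto simp: norm_axis_1)
    moreover have "axis 1 1 \<noteq> (- axis 1 1 :: real^3)" by (simp add: vec_eq_iff axis_def)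
    ultimately show False by (metis empty_iff singletonD)
  qed
  then obtain u where u: "u \<in> sphere 0 1" "u \<notin> ?B"
    using assms(1) by (meson finite_imageI finite_subset subsetI)
  have "spoke (x + u) a x \<noteq> 0" if "a \<in> A" for a
  proof
    assume "spoke (x + u) a x = 0"
    then have *: "norm (a - x) + u \<bullet> (a - x) = 0" using u(1) by (simp add: spoke_def)
    have ax: "norm (a - x) > 0" using assms(2) that by auto
    define v where "v = (1 / norm (a - x)) *\<^sub>R (a - x)"
    have "u \<bullet> (a - x) = - norm (a - x)" using * by linarith
    then have "u \<bullet> v = -1" unfolding v_def inner_scaleR_right using ax by simp
    moreover have "norm v = 1" unfolding v_def using ax by simp
    ultimately have "(norm (u + v))\<^sup>2 = 0"
      using u(1) by (simp add: power2_norm_eq_inner inner_add_left inner_add_right inner_commute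
         norm_eq_1)
    then have "u = - v" by (simp add: eq_neg_iff_add_eq_0)
    then show False using u(2) that unfolding v_def by blast
  qed
  then show ?thesis by blast
qed

text \<open>The single overlaps inherit the jump of the spinor. Near \<open>x\<close>, however, the
  product equals the cone over an apex suited to \<open>x\<close>, divided by its nonzero spokes,
  and both are continuous.\<close>

lemma continuous_solid_phase:
  assumes "closed_chain tt"
  shows "continuous_on (- chain_image tt) (solid_phase tt)"
proof -
  have "isCont (solid_phase tt) x" if x: "x \<notin> chain_image tt" for x
  proof -
    have "x \<notin> fst ` set tt" using x by (force simp: chain_image_def)
    then obtain w where wa: "\<forall>a\<in>fst ` set tt. spoke w a x \<noteq> 0"
      using exists_apex[of "fst ` set tt" x] by auto
    define r where "r y = (\<Prod>(a, b)\<leftarrow>tt. spoke w a y)" for y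
    have rx: "r x \<noteq> 0" using wa by (force simp: r_def prod_list_zero_iff)
    have cr: "continuous_on UNIV r"
      unfolding r_def case_prod_unfold by (intro continuous_on_prod_list continuous_intros)
    define g where "g y = (\<Prod>(a, b)\<leftarrow>tt. tri_phase w a b y) / complex_of_real (r y)" for y
    let ?U = "{y. r y \<noteq> 0}"
    have "open ?U" using cr by (simp add: open_Collect_neq)
    moreover have "continuous_on ?U g"
      unfolding g_def case_prod_unfold
      by (intro continuous_intros continuous_on_prod_list continuous_on_subset[OF cr]) auto
    ultimately have "isCont g x" using rx by (simp add: continuous_on_eq_continuous_at)
    moreover have "solid_phase tt y = g y" if "y \<in> ?U" for y
      using that solid_phase_cone[OF assms, of w y] by (simp add: g_def r_def)
    ultimately show ?thesis
      using isCont_cong[of "solid_phase tt" g x] \<open>open ?U\<close> rx eventually_nhds by blast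
  qed
  then show ?thesis by (simp add: continuous_at_imp_continuous_on)
qed

text \<open>On the side of \<open>K1\<close> the function \<open>f\<close> is kept; on the other
  side, where \<open>K2\<close> spoils it, it is replaced by the exponential of an extension of its
  logarithm on the sphere. The result is continuous and nonvanishing on the whole space, hence has a
  global logarithm.\<close>

lemma split_link_log:
  fixes K1 K2 :: "(real^3) set" and f :: "real^3 \<Rightarrow> complex"
  assumes "split_link K1 K2" and contf: "continuous_on (- K2) f" and "\<And>x. x \<notin> K2 \<Longrightarrow> f x \<noteq> 0"
  obtains g where "continuous_on K1 g" "\<And>x. x \<in> K1 \<Longrightarrow> f x = exp (g x)"
proof -
  obtain S :: "(real^3) set" where hom: "S homeomorphic sphere (0::real^3) 1"
    and disj: "S \<inter> (K1 \<union> K2) = {}"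
    and sep: "\<And>x y. x \<in> K1 \<Longrightarrow> y \<in> K2 \<Longrightarrow> \<not> connected_component (- S) x y"
    using assms(1) unfolding split_link_def by blast
  have "compact S" using hom homeomorphic_compactness compact_sphere by blast
  then have cS: "closed S" by (rule compact_imp_closed)
  have scS: "simply_connected S"
    using hom homeomorphic_simply_connected_eq simply_connected_sphere[of "0::real^3" 1] by auto
  have lpS: "locally path_connected S"
    using homeomorphic_locally[OF hom, of path_connected path_connected] homeomorphic_path_connectedness
      locally_path_connected_sphere by blast
  \<comment> \<open>The side of \<open>K1\<close> is the union of the components that it meets, so
    nothing has to be known about the number of components.\<close>
  define U where "U = (\<Union>x\<in>K1. connected_component_set (- S) x)"
  have oU: "open U" unfolding U_def using cS by (intro open_UN ballI open_connected_component) auto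
  have K1U: "K1 \<subseteq> U" unfolding U_def using disj connected_component_refl_eq by fastforce
  have US: "U \<subseteq> - S" unfolding U_def using connected_component_subset by blast
  \<comment> \<open>The rest is a union of components of \<open>- S\<close> as well, hence open. So
    \<open>U \<union> S\<close> and \<open>- U\<close> are closed, and the two pieces of
    \<open>F\<close> can be glued along \<open>S\<close>.\<close>
  have "- (U \<union> S) = (\<Union>y\<in>- (U \<union> S). connected_component_set (- S) y)"
  proof
    show "- (U \<union> S) \<subseteq> (\<Union>y\<in>- (U \<union> S). connected_component_set (- S) y)"
      using connected_component_refl_eq by fastforce
    show "(\<Union>y\<in>- (U \<union> S). connected_component_set (- S) y) \<subseteq> - (U \<union> S)"
    proof (intro subsetI ComplI)
      fix z assume "z \<in> (\<Union>y\<in>- (U \<union> S). connected_component_set (- S) y)" "z \<in> U \<union> S"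
      then obtain y where y: "y \<notin> U \<union> S" and z: "connected_component (- S) y z"
        and "z \<in> U \<union> S" by auto
      then have "z \<in> U" using connected_component_in by fastforce
      then obtain x where "x \<in> K1" "connected_component (- S) x z" unfolding U_def by auto
      then have "connected_component (- S) x y"
        using z connected_component_sym connected_component_trans by metis
      then have "y \<in> U" using \<open>x \<in> K1\<close> unfolding U_def by auto
      then show False using y by simp
    qed
  qed
  moreover have "open (\<Union>y\<in>- (U \<union> S). connected_component_set (- S) y)"
    using cS by (intro open_UN ballI open_connected_component) auto
  ultimately have cUS: "closed (U \<union> S)" by (simp add: closed_def)
  have disj2: "(U \<union> S) \<inter> K2 = {}"
    using sep disj unfolding U_def by auto
  have "continuous_on S f" using contf disj by (auto intro: continuous_on_subset)
  moreover have "\<And>x. x \<in> S \<Longrightarrow> f x \<noteq> 0" using assms(3) disj by auto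
  ultimately obtain g0 where g0: "continuous_on S g0" "\<And>x. x \<in> S \<Longrightarrow> f x = exp (g0 x)"
    using continuous_logarithm_on_simply_connected[OF _ scS lpS] by metis
  obtain g1 where g1: "continuous_on UNIV g1" "\<And>x. x \<in> S \<Longrightarrow> g1 x = g0 x"
    using Tietze_unbounded[OF g0(1), of UNIV] cS by auto
  define F where "F x = (if x \<in> U \<union> S then f x else exp (g1 x))" for x
  have "continuous_on ((U \<union> S) \<union> (- U)) (\<lambda>x. if x \<in> U \<union> S then f x else exp (g1 x))"
  proof (rule continuous_on_cases)
    show "closed (U \<union> S)" by (rule cUS)
    show "closed (- U)" using oU by auto
    show "continuous_on (U \<union> S) f" using contf disj2 by (auto intro: continuous_on_subset)
    show "continuous_on (- U) (\<lambda>x. exp (g1 x))"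
      by (intro continuous_intros continuous_on_subset[OF g1(1)]) auto
    show "\<forall>x. x \<in> U \<union> S \<and> x \<notin> U \<union> S \<or> x \<in> - U \<and> x \<in> U \<union> S \<longrightarrow> f x = exp (g1 x)"
      using g0(2) g1(2) by auto
  qed
  then have cF: "continuous_on UNIV F"
    unfolding F_def by (rule continuous_on_subset) auto
  have "F x \<noteq> 0" for x unfolding F_def using assms(3) disj2 by auto
  then obtain g where g: "continuous_on UNIV g" "\<And>x. F x = exp (g x)"
    using continuous_logarithm_on_contractible[OF cF contractible_UNIV] by auto
  show thesis
  proof
    show "continuous_on K1 g" using g(1) continuous_on_subset by blast
    show "f x = exp (g x)" if "x \<in> K1" for x using g(2)[of x] K1U that by (auto simp: F_def)
  qed
qed

section \<open>Crossings of segments seen from the origin\<close>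

definition ray_cross :: "real^3 \<Rightarrow> real^3 \<Rightarrow> real^3 \<Rightarrow> real^3 \<Rightarrow> bool" where
  "ray_cross p q a b \<longleftrightarrow> det3 p q a * det3 p q b < 0 \<and> det3 a b p * det3 a b q < 0"

text \<open>For points in the upper half space, \<open>ray_cross\<close> means that the segments
  cross in radial projection. The further inequality puts the crossing point of \<open>pq\<close> in
  front: it makes the barycentric coordinate of the origin, \<open>m0\<close> in
  \<open>solid_sign_crossing\<close>, positive, so that \<open>pq\<close> goes through the triangle
  \<open>0\<close>, \<open>a\<close>, \<open>b\<close>.\<close>

definition pierces :: "real^3 \<Rightarrow> real^3 \<Rightarrow> real^3 \<Rightarrow> real^3 \<Rightarrow> bool" where
  "pierces p q a b \<longleftrightarrow> ray_cross p q a b \<and>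
     ((det3 a b q - det3 a b p) + (det3 p q b - det3 p q a)) * (det3 a b q - det3 a b p) > 0"

text \<open>For coplanar vectors the phase is real, and its sign tells whether the origin lies
  inside the triangle, the case of two negative coefficients. After factoring out
  \<open>norm A * norm B + A \<bullet> B > 0\<close>, it remains to compare \<open>norm C\<close>
  with \<open>- e\<close>, and the sign of \<open>m * n\<close> decides that.\<close>

lemma solid_sign:
  fixes A B :: "real^3"
  assumes "\<bar>A \<bullet> B\<bar> < norm A * norm B" "m \<noteq> 0" "n \<noteq> 0"
  defines "C \<equiv> m *\<^sub>R A + n *\<^sub>R B"
  shows "(if m < 0 \<and> n < 0 then solid A B C < 0 else solid A B C > 0)"
proof -
  let ?P = "norm A" and ?Q = "norm B" and ?S = "norm C" and ?c = "A \<bullet> B"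
  have P: "?P > 0" "?Q > 0" using assms(1) by auto
  have AA: "A \<bullet> A = ?P * ?P" "B \<bullet> B = ?Q * ?Q"
    by (simp_all add: dot_square_norm power2_eq_square)
  define e where "e = m * ?P + n * ?Q"
  have "solid A B C = (?P * ?Q + ?c) * (?S + e)"
    unfolding solid_def C_def e_def
    by (simp add: inner_add_left inner_add_right AA inner_commute algebra_simps)
  moreover have H: "?P * ?Q + ?c > 0" using assms(1) by linarith
  have S2: "?S\<^sup>2 = e\<^sup>2 + 2 * (m * n) * (?c - ?P * ?Q)"
    unfolding C_def power2_norm_eq_inner e_def
    by (simp add: inner_add_left inner_add_right AA inner_commute algebra_simps power2_eq_square)
  have d: "?c - ?P * ?Q < 0" using assms(1) by linarith
  moreover have "if m < 0 \<and> n < 0 then ?S + e < 0 else ?S + e > 0"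
  proof -
    consider "m < 0" "n < 0" | "m > 0" "n > 0" | "m * n < 0"
      using assms(2,3) by (metis linorder_neqE_linordered_idom mult_less_0_iff)
    then show ?thesis
    proof cases
      case 1
      have "m * n * (?c - ?P * ?Q) < 0" using 1 d by (simp add: mult_pos_neg mult_neg_neg)
      then have "?S\<^sup>2 < (- e)\<^sup>2" using S2 by simp
      moreover have "0 \<le> - e" using mult_neg_pos[OF 1(1) P(1)] mult_neg_pos[OF 1(2) P(2)]
        unfolding e_def by linarith
      ultimately have "?S < - e" using power_less_imp_less_base by blast
      then show ?thesis using 1 by simp
    next
      case 2
      have "?S + e > 0" using 2 P unfolding e_def by (intro add_nonneg_pos add_pos_pos mult_pos_pos) auto
      then show ?thesis using 2 by simp
    next
      case 3
      have "m * n * (?c - ?P * ?Q) > 0" using 3 d by (simp add: mult_neg_neg)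
      then have "(- e)\<^sup>2 < ?S\<^sup>2" using S2 by simp
      then have "?S > - e" using power_less_imp_less_base norm_ge_zero by blast
      then show ?thesis using 3 by (auto simp: mult_less_0_iff)
    qed
  qed
  ultimately show ?thesis using mult_pos_neg[OF H] mult_pos_pos[OF H] by (auto split: if_splits)
qed

text \<open>Up to sign, both sides are the iterated cross product of \<open>p x q\<close> and
  \<open>a x b\<close>, a vector along the line in which the planes of the two segments
  meet.\<close>

lemma det3_combination:
  fixes p q a b :: "real^3"
  shows "det3 a b q *\<^sub>R p - det3 a b p *\<^sub>R q = det3 p q a *\<^sub>R b - det3 p q b *\<^sub>R a"
  by (simp add: vec_eq_iff forall_3 det3_def algebra_simps)

lemma det3_linear_third:
  "det3 a b (x + y) = det3 a b x + det3 a b y" "det3 a b (c *\<^sub>R x) = c * det3 a b x"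
  "det3 a b (x - y) = det3 a b x - det3 a b y"
  by (simp_all add: det3_def algebra_simps)

lemma det3_tri: "det3 (0 - x) (a - x) (b - x) = - det3 a b x"
  by (simp add: det3_def algebra_simps)

lemma det3_repeat [simp]: "det3 a a b = 0" "det3 a b a = 0" "det3 b a a = 0"
  by (simp_all add: det3_def algebra_simps)

text \<open>When the moving point \<open>x\<close> reaches the plane of the triangle
  \<open>0\<close>, \<open>a\<close>, \<open>b\<close>, the phase is real, and negative exactly
  inside the triangle. The numbers \<open>m0\<close>, \<open>m1\<close>, \<open>m2\<close> are the
  barycentric coordinates of \<open>x\<close>; rewriting \<open>b - x\<close> by means of them
  brings the triangle into the form of \<open>solid_sign\<close>.\<close>

lemma solid_sign_crossing:
  fixes p q a b :: "real^3"
  assumes opp: "det3 a b p * det3 a b q < 0"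
    and nz: "det3 p q a \<noteq> 0" "det3 p q b \<noteq> 0"
      "(det3 a b q - det3 a b p) + (det3 p q b - det3 p q a) \<noteq> 0"
    and pos: "p$3 > 0" "q$3 > 0" "a$3 > 0" "b$3 > 0"
    and t: "0 \<le> t" "t \<le> 1" and x: "x = (1 - t) *\<^sub>R p + t *\<^sub>R q" and z: "det3 a b x = 0"
  shows "if pierces p q a b then solid (0 - x) (a - x) (b - x) < 0
         else solid (0 - x) (a - x) (b - x) > 0"
proof -
  define \<alpha> where "\<alpha> = det3 a b q - det3 a b p"
  define \<beta> where "\<beta> = det3 p q b - det3 p q a"
  have \<alpha>: "\<alpha> \<noteq> 0" using opp unfolding \<alpha>_def by (auto simp: mult_less_0_iff)
  have "(1 - t) * det3 a b p + t * det3 a b q = 0"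
    using z unfolding x by (simp add: det3_linear_third)
  then have t\<alpha>: "t * \<alpha> = - det3 a b p" unfolding \<alpha>_def by (simp add: algebra_simps)
  have "\<alpha> *\<^sub>R x = \<alpha> *\<^sub>R p + (t * \<alpha>) *\<^sub>R (q - p)" unfolding x by (simp add: algebra_simps)
  also have "\<dots> = det3 a b q *\<^sub>R p - det3 a b p *\<^sub>R q"
    unfolding t\<alpha> unfolding \<alpha>_def by (simp add: algebra_simps)
  also have "\<dots> = det3 p q a *\<^sub>R b - det3 p q b *\<^sub>R a" by (rule det3_combination)
  finally have \<alpha>x: "\<alpha> *\<^sub>R x = det3 p q a *\<^sub>R b - det3 p q b *\<^sub>R a" .
  define m1 where "m1 = - det3 p q b / \<alpha>"
  define m2 where "m2 = det3 p q a / \<alpha>"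
  define m0 where "m0 = (\<alpha> + \<beta>) / \<alpha>"
  have "x = (1 / \<alpha>) *\<^sub>R (\<alpha> *\<^sub>R x)" using \<alpha> by simp
  then have xm: "x = m1 *\<^sub>R a + m2 *\<^sub>R b"
    unfolding \<alpha>x m1_def m2_def using \<alpha> by (simp add: algebra_simps)
  have m0: "m0 = 1 - m1 - m2" unfolding m0_def m1_def m2_def \<beta>_def using \<alpha> by (simp add: field_simps)
  have mnz: "m0 \<noteq> 0" "m1 \<noteq> 0" "m2 \<noteq> 0"
    using nz \<alpha> unfolding m0_def m1_def m2_def \<alpha>_def \<beta>_def by auto
  have x3: "x$3 > 0"
  proof (cases "t = 0")
    case False
    then show ?thesis unfolding x using t pos by (auto intro!: add_nonneg_pos)
  qed (use x pos in auto)
  have "\<not> collinear {0, 0 - x, a - x}"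
  proof
    assume "collinear {0, 0 - x, a - x}"
    then consider "x = 0" | "a = x" | c where "a - x = c *\<^sub>R (- x)" unfolding collinear_lemma by auto
    then have "\<exists>c. a = c *\<^sub>R x"
    proof cases
      case 1 then show ?thesis using x3 by simp
    next
      case 2 then show ?thesis by (intro exI[of _ 1]) simp
    next
      case 3 then show ?thesis by (intro exI[of _ "1 - c"]) (simp add: algebra_simps)
    qed
    moreover have "det3 p q x = 0" unfolding x by (simp add: det3_linear_third)
    ultimately show False using nz(1) by (auto simp: det3_linear_third)
  qed
  then have cs: "\<bar>(0 - x) \<bullet> (a - x)\<bar> < norm (0 - x) * norm (a - x)"
    using norm_cauchy_schwarz_equal[of "0 - x" "a - x"] Cauchy_Schwarz_ineq2[of "0 - x" "a - x"] by linarith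
  have "m2 *\<^sub>R (b - x) = m2 *\<^sub>R ((- m0 / m2) *\<^sub>R (0 - x) + (- m1 / m2) *\<^sub>R (a - x))"
  proof -
    have "m0 *\<^sub>R (0 - x) + m1 *\<^sub>R (a - x) + m2 *\<^sub>R (b - x) = (m1 *\<^sub>R a + m2 *\<^sub>R b) - x"
      unfolding m0 by (simp add: algebra_simps)
    then have "m0 *\<^sub>R (0 - x) + m1 *\<^sub>R (a - x) + m2 *\<^sub>R (b - x) = 0" using xm by simp
    then have "m2 *\<^sub>R (b - x) = - (m0 *\<^sub>R (0 - x) + m1 *\<^sub>R (a - x))"
      by (simp only: add_eq_0_iff)
    also have "\<dots> = m2 *\<^sub>R ((- m0 / m2) *\<^sub>R (0 - x) + (- m1 / m2) *\<^sub>R (a - x))"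
      unfolding scaleR_add_right scaleR_scaleR using mnz(3) by simp
    finally show ?thesis .
  qed
  then have bx: "b - x = (- m0 / m2) *\<^sub>R (0 - x) + (- m1 / m2) *\<^sub>R (a - x)"
    using mnz(3) by (metis scaleR_left_imp_eq)
  have sgn: "if - m0 / m2 < 0 \<and> - m1 / m2 < 0 then solid (0 - x) (a - x) (b - x) < 0
        else solid (0 - x) (a - x) (b - x) > 0"
    unfolding bx by (rule solid_sign[OF cs]) (use mnz in auto)
  \<comment> \<open>Here the upper half space enters: the sign products in \<open>ray_cross\<close>
    alone would also admit an antipodal crossing.\<close>
  have "\<not> (m1 < 0 \<and> m2 < 0)"
  proof
    assume "m1 < 0 \<and> m2 < 0"
    then have "m1 * a$3 + m2 * b$3 < 0" using pos by (intro add_neg_neg mult_neg_pos) auto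
    then show False using x3 unfolding xm by simp
  qed
  then have 1: "(- m0 / m2 < 0 \<and> - m1 / m2 < 0) \<longleftrightarrow> m0 > 0 \<and> m1 * m2 > 0"
    using mnz by (auto simp: divide_less_0_iff zero_less_mult_iff zero_less_divide_iff)
  have "m1 * m2 = - (det3 p q a * det3 p q b) / (\<alpha> * \<alpha>)" unfolding m1_def m2_def by simp
  then have "m1 * m2 > 0 \<longleftrightarrow> det3 p q a * det3 p q b < 0"
    using \<alpha> not_real_square_gt_zero[of \<alpha>] by (simp only: zero_less_divide_iff) (auto simp: not_less)
  moreover have "m0 > 0 \<longleftrightarrow> (\<alpha> + \<beta>) * \<alpha> > 0"
    unfolding m0_def by (simp add: zero_less_divide_iff zero_less_mult_iff)
  ultimately have "m0 > 0 \<and> m1 * m2 > 0 \<longleftrightarrow> pierces p q a b"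
    unfolding pierces_def ray_cross_def using opp by (auto simp: \<alpha>_def \<beta>_def)
  then show ?thesis using sgn 1 by simp
qed

text \<open>Along the segment the imaginary part of the phase is affine and nonzero at the ends, so
  the path meets the real axis at most once, and its negative half exactly if the segment pierces. A
  continuous logarithm then differs from the principal one by one full turn or not at all.\<close>

lemma segment_log:
  fixes p q a b :: "real^3"
  assumes nzp: "det3 a b p \<noteq> 0" "det3 a b q \<noteq> 0"
    and nz: "det3 p q a \<noteq> 0" "det3 p q b \<noteq> 0"
      "(det3 a b q - det3 a b p) + (det3 p q b - det3 p q a) \<noteq> 0"
    and pos: "p$3 > 0" "q$3 > 0" "a$3 > 0" "b$3 > 0"
  defines "f \<equiv> tri_phase 0 a b"
  shows "\<exists>L (k::int). continuous_on {0..1} L \<and> (\<forall>t\<in>{0..1::real}. exp (L t) = f (linepath p q t)) \<and>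
     L 1 - L 0 = Ln (f q) - Ln (f p) + 2 * of_real pi * \<i> * of_int k \<and> (odd k \<longleftrightarrow> pierces p q a b)"
proof -
  have Imf: "Im (f x) = - 2 * det3 a b x" for x unfolding f_def tri_phase_def det3_tri by simp
  have Ref: "Re (f x) = 2 * solid (0 - x) (a - x) (b - x)" for x unfolding f_def tri_phase_def by simp
  have cf: "continuous_on {0..1} (\<lambda>t. f (linepath p q t))"
    unfolding f_def by (intro continuous_intros)
  have lin: "det3 a b (linepath p q t) = (1 - t) * det3 a b p + t * det3 a b q" for t
    by (simp add: linepath_def det3_linear_third)
  have cross: "if pierces p q a b then Re (f (linepath p q t)) < 0 else Re (f (linepath p q t)) > 0"
    if "t \<in> {0..1}" "Im (f (linepath p q t)) = 0" "det3 a b p * det3 a b q < 0" for t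
  proof -
    have "det3 a b (linepath p q t) = 0" using that(2) by (simp add: Imf)
    then show ?thesis
      using solid_sign_crossing[OF that(3) nz pos _ _ linepath_def[THEN fun_cong], of t] that(1)
      by (auto simp: Ref split: if_splits)
  qed
  have same: "Im (f (linepath p q t)) \<noteq> 0" if "t \<in> {0..1}" "\<not> det3 a b p * det3 a b q < 0" for t
  proof -
    have "0 < det3 a b p * det3 a b q" using that(2) nzp by (metis linorder_neqE_linordered_idom mult_eq_0_iff)
    then have signs: "(det3 a b p > 0 \<and> det3 a b q > 0) \<or> (- det3 a b p > 0 \<and> - det3 a b q > 0)"
      by (auto simp: zero_less_mult_iff)
    have pc: "(1 - t) * u + t * v > 0" if "u > 0" "v > 0" for u v :: real
      using that \<open>t \<in> {0..1}\<close> by (cases "t = 0") (auto intro!: add_nonneg_pos)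
    have "(1 - t) * det3 a b p + t * det3 a b q \<noteq> 0"
      using signs
    proof
      assume *: "det3 a b p > 0 \<and> det3 a b q > 0"
      show ?thesis using pc[of "det3 a b p" "det3 a b q"] * by linarith
    next
      assume *: "- det3 a b p > 0 \<and> - det3 a b q > 0"
      have "(1 - t) * (- det3 a b p) + t * (- det3 a b q) > 0"
        by (rule pc) (use * in auto)
      then show ?thesis unfolding mult_minus_right by linarith
    qed
    then show ?thesis by (simp add: Imf lin)
  qed
  show ?thesis
  proof (cases "pierces p q a b")
    case False
    have "f (linepath p q t) \<notin> \<real>\<^sub>\<le>\<^sub>0" if "t \<in> {0..1}" for t
      using cross[OF that] same[OF that] False by (force simp: complex_nonpos_Reals_iff)
    moreover from this have "f (linepath p q t) \<noteq> 0" if "t \<in> {0..1}" for t using that by fastforce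
    ultimately show ?thesis using False
      by (intro exI[of _ "\<lambda>t. Ln (f (linepath p q t))"] exI[of _ "0::int"])
         (auto intro!: continuous_on_Ln' cf simp: linepath_0' linepath_1')
  next
    case True
    then have opp: "det3 a b p * det3 a b q < 0" by (simp add: pierces_def ray_cross_def)
    have nonpos: "- f (linepath p q t) \<notin> \<real>\<^sub>\<le>\<^sub>0" if "t \<in> {0..1}" for t
      using cross[OF that _ opp] True by (force simp: complex_nonpos_Reals_iff)
    have nz0: "f (linepath p q t) \<noteq> 0" if "t \<in> {0..1}" for t using nonpos[OF that] by fastforce
    \<comment> \<open>The path now avoids the positive real axis instead, so the branch of the
      logarithm that is cut there is continuous along it.\<close>
    define L where "L t = Ln (- f (linepath p q t)) + \<i> * of_real pi" for t
    have Lm: "Ln (- z) = (if Im z < 0 then Ln z + \<i> * of_real pi else Ln z - \<i> * of_real pi)"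
      if "Im z \<noteq> 0" for z using that Ln_minus[of z] by (cases "z = 0") auto
    have Imn: "Im (f p) \<noteq> 0" "Im (f q) \<noteq> 0" using nzp by (auto simp: Imf)
    have L0: "L 0 = Ln (- f p) + \<i> * of_real pi" "L 1 = Ln (- f q) + \<i> * of_real pi"
      by (auto simp: L_def linepath_0' linepath_1')
    \<comment> \<open>The turn is counted with the direction in which the negative axis is passed;
      only its oddness is used later.\<close>
    define k :: int where "k = (if Im (f q) < 0 then 1 else -1)"
    have "Im (f p) < 0 \<longleftrightarrow> \<not> Im (f q) < 0" using opp by (auto simp: Imf mult_less_0_iff)
    then have "L 1 - L 0 = Ln (f q) - Ln (f p) + 2 * of_real pi * \<i> * of_int k"
      unfolding L0 Lm[OF Imn(1)] Lm[OF Imn(2)] k_def by auto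
    moreover have "continuous_on {0..1} L"
      unfolding L_def using nonpos by (intro continuous_intros continuous_on_Ln' cf) auto
    moreover have "exp (L t) = f (linepath p q t)" if "t \<in> {0..1}" for t
      unfolding L_def exp_add using nz0[OF that] by (simp add: exp_Ln)
    moreover have "odd k" by (simp add: k_def)
    ultimately show ?thesis using True by blast
  qed
qed

section \<open>Linking modulo 2\<close>

lemma sum_list_of_int_mult:
  "(\<Sum>x\<leftarrow>xs. c * of_int (f x)) = (c::'a::comm_ring_1) * of_int (\<Sum>x\<leftarrow>xs. f x)"
  by (induction xs) (auto simp: algebra_simps)

lemma even_sum_list_iff:
  "even (\<Sum>x\<leftarrow>xs. f x :: int) \<longleftrightarrow> (\<Sum>x\<leftarrow>xs. of_bool (odd (f x)) :: bit) = 0"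
  by (induction xs) (auto simp: add_bit_eq_xor)

lemma exp_sum_list: "exp (\<Sum>x\<leftarrow>xs. f x) = (\<Prod>x\<leftarrow>xs. exp (f x :: complex))"
  by (induction xs) (auto simp: exp_add)

lemma continuous_on_sum_list:
  fixes f :: "'i \<Rightarrow> 'a::topological_space \<Rightarrow> 'b::real_normed_vector"
  assumes "\<And>i. i \<in> set xs \<Longrightarrow> continuous_on S (f i)"
  shows "continuous_on S (\<lambda>x. \<Sum>i\<leftarrow>xs. f i x)"
  using assms by (induction xs) (auto intro!: continuous_intros)

lemma continuous_logs_differ:
  fixes f g :: "real \<Rightarrow> complex"
  assumes "continuous_on {0..1} f" "continuous_on {0..1} g" "\<And>t. t \<in> {0..1} \<Longrightarrow> exp (f t) = exp (g t)"
  shows "f 1 - f 0 = g 1 - g 0"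
proof -
  have "(\<lambda>t. f t - g t) constant_on {0..1}"
  proof (rule continuous_discrete_range_constant)
    show "continuous_on {0..1} (\<lambda>t. f t - g t)" by (intro continuous_intros assms)
    show "\<exists>e>0. \<forall>y. y \<in> {0..1} \<and> f y - g y \<noteq> f x - g x \<longrightarrow> e \<le> norm ((f y - g y) - (f x - g x))"
      if "x \<in> {0..1}" for x
    proof (intro exI[of _ "2 * pi"] conjI allI impI)
      fix y assume y: "y \<in> {0..1} \<and> f y - g y \<noteq> f x - g x"
      have "exp (f y - g y) = 1" "exp (f x - g x) = 1"
        using assms(3) y that by (auto simp: exp_diff)
      then have "exp ((f y - g y) - (f x - g x)) = 1" by (subst exp_diff) simp
      then obtain n :: int where n: "Re ((f y - g y) - (f x - g x)) = 0"
         "Im ((f y - g y) - (f x - g x)) = of_int (2 * n) * pi"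
        using exp_eq_1 by blast
      then have "(f y - g y) - (f x - g x) = Complex 0 (of_int (2 * n) * pi)" by (simp add: complex_eq_iff)
      then have e: "norm ((f y - g y) - (f x - g x)) = 2 * pi * \<bar>of_int n\<bar>"
        by (simp add: complex_norm abs_mult)
      have "n \<noteq> 0" using n y by (auto simp: complex_eq_iff)
      then have "\<bar>of_int n\<bar> \<ge> (1::real)" by linarith
      then show "2 * pi \<le> norm ((f y - g y) - (f x - g x))" unfolding e by simp
    qed simp
  qed auto
  then obtain c where "\<And>t. t \<in> {0..1} \<Longrightarrow> f t - g t = c" unfolding constant_on_def by blast
  from this[of 0] this[of 1] show ?thesis by (simp add: algebra_simps)
qed

definition chain_points :: "('v \<times> 'v) list \<Rightarrow> 'v set" where
  "chain_points ss = fst ` set ss \<union> snd ` set ss"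

text \<open>The first clause makes the view from the origin faithful, without antipodal
  coincidences; the second makes that view generic; the third ensures that at a crossing one segment
  is strictly in front of the other.\<close>

definition general_position :: "(real^3) set \<Rightarrow> bool" where
  "general_position V \<longleftrightarrow> (\<forall>a\<in>V. a$3 > 0) \<and>
     (\<forall>a\<in>V. \<forall>b\<in>V. \<forall>c\<in>V. distinct [a, b, c] \<longrightarrow> det3 a b c \<noteq> 0) \<and>
     (\<forall>a\<in>V. \<forall>b\<in>V. \<forall>c\<in>V. \<forall>d\<in>V. distinct [a, b, c, d] \<longrightarrow> det3 (b - a) (c - a) (d - a) \<noteq> 0)"

text \<open>Along each segment of \<open>ss\<close> one function has two logarithms: the sum of
  those from \<open>segment_log\<close>, and the one that the splitting sphere provides. Comparing
  increments expresses the number of turns, times \<open>2 * pi * \<i>\<close>, as a difference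
  \<open>\<phi> q - \<phi> p\<close>, which telescopes to 0 around the closed chain.\<close>

lemma split_link_even:
  assumes "split_link (chain_image ss) (chain_image tt)"
    and cl: "closed_chain ss" "closed_chain tt"
    and gp: "general_position (chain_points ss \<union> chain_points tt)"
    and dis: "chain_points ss \<inter> chain_points tt = {}"
    and proper: "\<And>a b. (a, b) \<in> set ss \<Longrightarrow> a \<noteq> b" "\<And>a b. (a, b) \<in> set tt \<Longrightarrow> a \<noteq> b"
  shows "(\<Sum>(p, q)\<leftarrow>ss. \<Sum>(a, b)\<leftarrow>tt. of_bool (pierces p q a b) :: bit) = 0"
proof -
  obtain g where cg: "continuous_on (chain_image ss) g"
    and g: "\<And>x. x \<in> chain_image ss \<Longrightarrow> solid_phase tt x = exp (g x)"
    by (rule split_link_log[OF assms(1) continuous_solid_phase[OF cl(2)]])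
      (use solid_phase_nonzero in blast)+
  \<comment> \<open>The spokes of the cone from the origin. They are positive along
    \<open>ss\<close> by \<open>rpos\<close>, so their principal logarithm can simply be added to
    \<open>g\<close>.\<close>
  define r where "r x = (\<Prod>(a, b)\<leftarrow>tt. spoke 0 a x)" for x
  let ?f = "\<lambda>(a, b). tri_phase 0 a b"
  define P where "P s t L k \<longleftrightarrow> (case s of (p, q) \<Rightarrow> continuous_on {0..1::real} L \<and>
     (\<forall>u\<in>{0..1}. exp (L u) = ?f t (linepath p q u)) \<and>
     L 1 - L 0 = Ln (?f t q) - Ln (?f t p) + 2 * of_real pi * \<i> * of_int k \<and>
     (odd k \<longleftrightarrow> pierces p q (fst t) (snd t)))" for s t L and k :: int
  have ex: "\<exists>L k. P s t L k" if s: "s \<in> set ss" and t: "t \<in> set tt" for s t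
  proof -
    obtain p q where spq: "s = (p, q)" by fastforce
    obtain a b where tab: "t = (a, b)" by fastforce
    let ?V = "chain_points ss \<union> chain_points tt"
    have mem: "p \<in> ?V" "q \<in> ?V" "a \<in> ?V" "b \<in> ?V"
      using s t unfolding spq tab chain_points_def by force+
    have d: "p \<noteq> q" "a \<noteq> b" using s t proper unfolding spq tab by auto
    have pt: "p \<in> chain_points ss" "q \<in> chain_points ss" "a \<in> chain_points tt" "b \<in> chain_points tt"
      using s t unfolding spq tab chain_points_def by force+
    then have d2: "p \<noteq> a" "p \<noteq> b" "q \<noteq> a" "q \<noteq> b" using dis by auto
    have nz: "det3 a b p \<noteq> 0" "det3 a b q \<noteq> 0" "det3 p q a \<noteq> 0" "det3 p q b \<noteq> 0"
      "det3 (q - p) (a - p) (b - p) \<noteq> 0"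
      using gp mem d d2 unfolding general_position_def by auto
    have "det3 (q - p) (a - p) (b - p) = (det3 a b q - det3 a b p) + (det3 p q b - det3 p q a)"
      by (simp add: det3_def algebra_simps)
    then have nz5: "(det3 a b q - det3 a b p) + (det3 p q b - det3 p q a) \<noteq> 0" using nz(5) by simp
    have pos: "p$3 > 0" "q$3 > 0" "a$3 > 0" "b$3 > 0"
      using gp mem unfolding general_position_def by auto
    show ?thesis
      using segment_log[OF nz(1-4) nz5 pos] unfolding P_def spq tab by simp
  qed
  then have "\<forall>z\<in>set ss \<times> set tt. \<exists>y. P (fst z) (snd z) (fst y) (snd y)" by fastforce
  then obtain h where h: "\<And>z. z \<in> set ss \<times> set tt \<Longrightarrow> P (fst z) (snd z) (fst (h z)) (snd (h z))"
    using bchoice[of "set ss \<times> set tt" "\<lambda>z y. P (fst z) (snd z) (fst y) (snd y)"] by blast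
  define L where "L s t = fst (h (s, t))" for s t
  define k where "k s t = snd (h (s, t))" for s t
  have Lk: "P s t (L s t) (k s t)" if "s \<in> set ss" "t \<in> set tt" for s t
    using h[of "(s, t)"] that by (simp add: L_def k_def)
  have rpos: "r x > 0" if "(p, q) \<in> set ss" "x \<in> closed_segment p q" for p q x
  proof -
    have "spoke 0 a x \<noteq> 0" if "(a, b) \<in> set tt" for a b
    proof
      assume "spoke 0 a x = 0"
      then have "x \<in> closed_segment 0 a" by (rule spoke_zero_segment)
      then obtain u where u: "x = u *\<^sub>R a" by (auto simp: closed_segment_def)
      have pt: "p \<in> chain_points ss" "q \<in> chain_points ss" "a \<in> chain_points tt"
        using that \<open>(p, q) \<in> set ss\<close> unfolding chain_points_def by force+
      have "p \<noteq> q" "p \<noteq> a" "q \<noteq> a" using pt dis proper \<open>(p, q) \<in> set ss\<close> by auto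
      then have nz: "det3 p q a \<noteq> 0" using gp pt unfolding general_position_def by auto
      obtain v where v: "0 \<le> v" "v \<le> 1" "x = (1 - v) *\<^sub>R p + v *\<^sub>R q"
        using \<open>x \<in> closed_segment p q\<close> by (auto simp: closed_segment_def)
      have "det3 p q x = 0" unfolding v(3) by (simp add: det3_linear_third)
      then have "u = 0" using nz unfolding u by (simp add: det3_linear_third)
      then have "x$3 = 0" using u by simp
      moreover have "p$3 > 0" "q$3 > 0" using gp pt unfolding general_position_def by auto
      then have "x$3 > 0" unfolding v(3) using v(1,2) by (cases "v = 0") (auto intro!: add_nonneg_pos)
      ultimately show False by simp
    qed
    then have "spoke 0 a x > 0" if "(a, b) \<in> set tt" for a b
      using that spoke_nonneg[of 0 a x] by (metis less_eq_real_def)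
    moreover have "(\<Prod>(a, b)\<leftarrow>ts. spoke 0 a x) > 0"
      if "\<And>a b. (a, b) \<in> set ts \<Longrightarrow> spoke 0 a x > 0" for ts :: "((real^3) \<times> (real^3)) list"
      using that by (induction ts) (auto intro!: mult_pos_pos)
    ultimately show ?thesis unfolding r_def by blast
  qed
  have inc: "(\<Sum>t\<leftarrow>tt. L (p, q) t 1 - L (p, q) t 0)
      = (g q + Ln (of_real (r q))) - (g p + Ln (of_real (r p)))" if pq: "(p, q) \<in> set ss" for p q
  proof -
    have sub: "closed_segment p q \<subseteq> chain_image ss" unfolding chain_image_def using pq by auto
    have lin: "linepath p q u \<in> closed_segment p q" if "u \<in> {0..1}" for u
      using that linepath_in_path by blast
    have c1: "continuous_on {0..1} (\<lambda>u. \<Sum>t\<leftarrow>tt. L (p, q) t u)"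
      using Lk[OF pq] by (intro continuous_on_sum_list) (auto simp: P_def)
    have "continuous_on {0..1} (\<lambda>u. g (linepath p q u))"
      by (rule continuous_on_compose2[OF cg continuous_on_linepath]) (use lin sub in auto)
    moreover have "continuous_on {0..1} (\<lambda>u. complex_of_real (r (linepath p q u)))"
      unfolding r_def case_prod_unfold by (intro continuous_intros continuous_on_prod_list)
    then have "continuous_on {0..1} (\<lambda>u. Ln (of_real (r (linepath p q u))))"
      using rpos[OF pq lin] by (intro continuous_on_Ln') (force simp: complex_nonpos_Reals_iff)+
    ultimately have c2: "continuous_on {0..1} (\<lambda>u. g (linepath p q u) + Ln (of_real (r (linepath p q u))))"
      by (rule continuous_on_add)
    have "(\<Sum>t\<leftarrow>tt. L (p, q) t 1) - (\<Sum>t\<leftarrow>tt. L (p, q) t 0) =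
      (g (linepath p q 1) + Ln (of_real (r (linepath p q 1)))) - (g (linepath p q 0) + Ln (of_real (r (linepath p q 0))))"
    proof (rule continuous_logs_differ[OF c1 c2])
      fix u :: real assume u: "u \<in> {0..1}"
      let ?x = "linepath p q u"
      have "exp (\<Sum>t\<leftarrow>tt. L (p, q) t u) = (\<Prod>t\<leftarrow>tt. ?f t ?x)"
        unfolding exp_sum_list
        by (intro arg_cong[where f = prod_list] map_cong refl) (use Lk[OF pq] u in \<open>auto simp: P_def\<close>)
      also have "\<dots> = solid_phase tt ?x * of_real (r ?x)"
        using solid_phase_cone[OF cl(2), of 0 ?x] by (simp add: r_def case_prod_unfold)
      also have "\<dots> = exp (g ?x + Ln (of_real (r ?x)))"
        using g[of ?x] lin[OF u] sub rpos[OF pq lin[OF u]] by (simp add: exp_add subset_iff)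
      finally show "exp (\<Sum>t\<leftarrow>tt. L (p, q) t u) = exp (g ?x + Ln (of_real (r ?x)))" .
    qed
    then show ?thesis by (simp add: linepath_0' linepath_1' sum_list_subtractf)
  qed
  \<comment> \<open>Subtracting the principal logarithms leaves a quantity attached to single
    points, which is what telescoping needs.\<close>
  define \<phi> where "\<phi> x = g x + Ln (of_real (r x)) - (\<Sum>t\<leftarrow>tt. Ln (?f t x))" for x
  have key: "2 * of_real pi * \<i> * of_int (\<Sum>t\<leftarrow>tt. k (p, q) t) = \<phi> q - \<phi> p" if pq: "(p, q) \<in> set ss" for p q
  proof -
    have "(\<Sum>t\<leftarrow>tt. L (p, q) t 1 - L (p, q) t 0) =
       (\<Sum>t\<leftarrow>tt. (Ln (?f t q) - Ln (?f t p)) + 2 * of_real pi * \<i> * of_int (k (p, q) t))"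
      by (intro arg_cong[where f = sum_list] map_cong refl) (use Lk[OF pq] in \<open>auto simp: P_def\<close>)
    also have "\<dots> = ((\<Sum>t\<leftarrow>tt. Ln (?f t q)) - (\<Sum>t\<leftarrow>tt. Ln (?f t p))) +
        2 * of_real pi * \<i> * of_int (\<Sum>t\<leftarrow>tt. k (p, q) t)"
      by (simp only: sum_list_addf sum_list_subtractf sum_list_of_int_mult)
    finally show ?thesis using inc[OF pq] by (simp add: \<phi>_def algebra_simps)
  qed
  have "2 * of_real pi * \<i> * of_int (\<Sum>s\<leftarrow>ss. \<Sum>t\<leftarrow>tt. k s t)
      = (\<Sum>s\<leftarrow>ss. 2 * of_real pi * \<i> * of_int (\<Sum>t\<leftarrow>tt. k s t))"
    by (simp only: sum_list_of_int_mult)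
  also have "\<dots> = (\<Sum>s\<leftarrow>ss. \<phi> (snd s) - \<phi> (fst s))"
    by (intro arg_cong[where f = sum_list] map_cong refl, rule key[of "fst s" "snd s" for s, unfolded prod.collapse])
  also have "\<dots> = (\<Sum>s\<leftarrow>ss. \<phi> (snd s)) - (\<Sum>s\<leftarrow>ss. \<phi> (fst s))"
    by (rule sum_list_subtractf)
  also have "\<dots> = 0"
    using closed_chain_sum_list[OF cl(1), of \<phi>] by (simp only: case_prod_unfold diff_self)
  finally have "(\<Sum>s\<leftarrow>ss. \<Sum>t\<leftarrow>tt. k s t) = 0" by simp
  then have "even (\<Sum>s\<leftarrow>ss. \<Sum>t\<leftarrow>tt. k s t)" by simp
  then have z: "(\<Sum>s\<leftarrow>ss. of_bool (odd (\<Sum>t\<leftarrow>tt. k s t)) :: bit) = 0" by (simp only: even_sum_list_iff)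
  have ob: "(of_bool (odd (\<Sum>t\<leftarrow>tt. k s t)) :: bit) = (\<Sum>t\<leftarrow>tt. of_bool (odd (k s t)))" for s
    using even_sum_list_iff[of "k s" tt] by (cases "(\<Sum>t\<leftarrow>tt. of_bool (odd (k s t)) :: bit)") auto
  have "(\<Sum>s\<leftarrow>ss. \<Sum>t\<leftarrow>tt. of_bool (odd (k s t)) :: bit) = 0" using z unfolding ob .
  moreover have "odd (k s t) \<longleftrightarrow> pierces (fst s) (snd s) (fst t) (snd t)" if "s \<in> set ss" "t \<in> set tt" for s t
    using Lk[OF that] unfolding P_def by (cases s) simp
  then have "(\<Sum>s\<leftarrow>ss. \<Sum>t\<leftarrow>tt. of_bool (odd (k s t)) :: bit) =
     (\<Sum>s\<leftarrow>ss. \<Sum>t\<leftarrow>tt. of_bool (pierces (fst s) (snd s) (fst t) (snd t)))"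
    by (intro arg_cong[where f = sum_list] map_cong refl) simp
  ultimately show ?thesis by (simp add: case_prod_unfold)
qed

section \<open>The van Kampen parity of the complete graph on five vertices\<close>

lemma bit_double [simp]: "x + x = (0::bit)" "x + (x + y) = (y::bit)"
  by (cases x; cases y; simp)+

lemma det3_swap: "det3 b a c = - det3 a b c" "det3 a c b = - det3 a b c"
  by (simp_all add: det3_def algebra_simps)

lemma det3_pluecker:
  "det3 a b c * det3 a d e - det3 a b d * det3 a c e + det3 a b e * det3 a c d = 0"
  by (simp add: det3_def algebra_simps)

text \<open>The three terms cannot all have one sign. Because of the minus, this excludes exactly
  that the second product differs in sign from both others. Applied to \<open>det3_pluecker\<close>,
  it is the chirotope axiom of oriented matroids.\<close>

lemma sum_zero_signs:
  fixes x1 :: real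
  assumes "x1 * y1 - x2 * y2 + x3 * y3 = 0" "x1 \<noteq> 0" "x2 \<noteq> 0" "x3 \<noteq> 0" "y1 \<noteq> 0" "y2 \<noteq> 0" "y3 \<noteq> 0"
  shows "((x1 > 0) = (y1 > 0)) = ((x2 > 0) = (y2 > 0)) \<or> ((x2 > 0) = (y2 > 0)) = ((x3 > 0) = (y3 > 0))"
proof -
  have s: "(x > 0) = (y > 0) \<longleftrightarrow> x * y > 0" "x * y \<noteq> 0" if "x \<noteq> 0" "y \<noteq> 0" for x y :: real
    using that by (auto simp: zero_less_mult_iff)
  show ?thesis
    unfolding s(1)[OF assms(2) assms(5)] s(1)[OF assms(3) assms(6)] s(1)[OF assms(4) assms(7)]
    using assms(1) s(2)[OF assms(2) assms(5)] s(2)[OF assms(3) assms(6)] s(2)[OF assms(4) assms(7)]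
    by linarith
qed

text \<open>\<open>oijk\<close> is the orientation of the points numbered \<open>i\<close>,
  \<open>j\<close>, \<open>k\<close> among \<open>p\<close>, \<open>q\<close>, \<open>w\<close>,
  \<open>a\<close>, \<open>b\<close>. The assumptions are the sign conditions from the Pluecker
  relations, one for each choice of the common point; the conclusion is the parity in
  \<open>ray_cross_triangle\<close> written in the ten signs, a propositional fact.\<close>

lemma five_point_signs:
  fixes o012 :: bool
  assumes "((o012 = o034) = (o013 = o024)) \<or> ((o013 = o024) = (o014 = o023))"
    "((o012 = o134) = (o013 = o124)) \<or> ((o013 = o124) = (o014 = o123))"
    "((o012 = o234) = (o023 = o124)) \<or> ((o023 = o124) = (o024 = o123))"
    "((o013 = o234) = (o023 = o134)) \<or> ((o023 = o134) = (o034 = o123))"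
    "((o014 = o234) = (o024 = o134)) \<or> ((o024 = o134) = (o034 = o124))"
  shows "(((o012 \<noteq> o013) \<and> (o023 \<noteq> o123)) \<noteq>
     (((o013 \<noteq> o014) \<and> (o034 \<noteq> o134)) \<noteq> ((o014 \<noteq> o012) \<and> ((\<not> o024) \<noteq> (\<not> o124)))))
     \<longleftrightarrow> ((o023 = o034 \<and> o034 = (\<not> o024)) \<noteq> (o123 = o134 \<and> o134 = (\<not> o124)))"
  using assms by argo

section \<open>Crossing parity of closed chains in radial projection\<close>

definition radially_generic :: "(real^3) set \<Rightarrow> bool" where
  "radially_generic V \<longleftrightarrow> (\<forall>a\<in>V. \<forall>b\<in>V. \<forall>c\<in>V. distinct [a, b, c] \<longrightarrow> det3 a b c \<noteq> 0)"

abbreviation rc :: "real^3 \<Rightarrow> real^3 \<Rightarrow> real^3 \<Rightarrow> real^3 \<Rightarrow> bit" where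
  "rc p q a b \<equiv> of_bool (ray_cross p q a b)"

lemma ray_cross_sym: "ray_cross a b p q = ray_cross p q a b"
  "ray_cross q p a b = ray_cross p q a b" "ray_cross p q b a = ray_cross p q a b"
  by (auto simp: ray_cross_def det3_swap(1)[of q p] det3_swap(1)[of b a] mult.commute)

lemma ray_cross_degenerate: "\<not> ray_cross p q a a"
  by (auto simp: ray_cross_def mult_less_0_iff)

lemma ray_cross_signs:
  assumes "det3 p q a \<noteq> 0" "det3 p q b \<noteq> 0" "det3 a b p \<noteq> 0" "det3 a b q \<noteq> 0"
  shows "ray_cross p q a b \<longleftrightarrow>
    (det3 p q a > 0) \<noteq> (det3 p q b > 0) \<and> (det3 a b p > 0) \<noteq> (det3 a b q > 0)"
  using assms unfolding ray_cross_def by (auto simp: mult_less_0_iff)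

lemma det3_cyclic: "det3 b c a = det3 a b c" "det3 c a b = det3 a b c"
  by (simp_all add: det3_def algebra_simps)

text \<open>For generic vectors: \<open>p\<close> or \<open>- p\<close> lies in the cone over
  \<open>w\<close>, \<open>a\<close>, \<open>b\<close>. Requiring equal signs instead of positive
  ones makes the notion independent of the orientation of the triangle.\<close>

definition in_cone :: "real^3 \<Rightarrow> real^3 \<Rightarrow> real^3 \<Rightarrow> real^3 \<Rightarrow> bool" where
  "in_cone p w a b \<longleftrightarrow> (det3 w a p > 0 \<longleftrightarrow> det3 a b p > 0) \<and> (det3 a b p > 0 \<longleftrightarrow> det3 b w p > 0)"

lemma bit_of_bool_xor: "(of_bool P + of_bool Q :: bit) = of_bool (P \<noteq> Q)"
  by (cases P; cases Q) auto

text \<open>An arc meets the boundary of a spherical triangle an odd number of times exactly if it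
  joins inside and outside, both read up to antipodes. Degenerate triangles are included because
  \<open>crossings_closed\<close> cones a chain from one of its own vertices.\<close>

lemma ray_cross_triangle:
  assumes g: "radially_generic V" and V: "p \<in> V" "q \<in> V" "w \<in> V" "a \<in> V" "b \<in> V"
    and d: "p \<noteq> q" "p \<notin> {w, a, b}" "q \<notin> {w, a, b}"
  shows "rc p q w a + rc p q a b + rc p q b w = of_bool (in_cone p w a b) + of_bool (in_cone q w a b)"
proof (cases "distinct [w, a, b]")
  case True
  have nz: "det3 x y z \<noteq> 0" if "x \<in> V" "y \<in> V" "z \<in> V" "distinct [x, y, z]" for x y z
    using g that unfolding radially_generic_def by blast
  have n: "det3 p q w \<noteq> 0" "det3 p q a \<noteq> 0" "det3 p q b \<noteq> 0" "det3 p w a \<noteq> 0" "det3 p w b \<noteq> 0"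
     "det3 p a b \<noteq> 0" "det3 q w a \<noteq> 0" "det3 q w b \<noteq> 0" "det3 q a b \<noteq> 0" "det3 w a b \<noteq> 0"
    by (rule nz; use V d True in auto)+
  have r1: "ray_cross p q w a \<longleftrightarrow> (det3 p q w > 0) \<noteq> (det3 p q a > 0) \<and> (det3 p w a > 0) \<noteq> (det3 q w a > 0)"
    using ray_cross_signs[of p q w a] n by (simp add: det3_cyclic)
  have r2: "ray_cross p q a b \<longleftrightarrow> (det3 p q a > 0) \<noteq> (det3 p q b > 0) \<and> (det3 p a b > 0) \<noteq> (det3 q a b > 0)"
    using ray_cross_signs[of p q a b] n by (simp add: det3_cyclic)
  have r3: "ray_cross p q b w \<longleftrightarrow> (det3 p q b > 0) \<noteq> (det3 p q w > 0) \<and>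
     (\<not> det3 p w b > 0) \<noteq> (\<not> det3 q w b > 0)"
  proof -
    have "det3 b w p = - det3 p w b" "det3 b w q = - det3 q w b" by (simp_all add: det3_def algebra_simps)
    then show ?thesis using ray_cross_signs[of p q b w] n by auto
  qed
  have i: "in_cone x w a b \<longleftrightarrow> (det3 x w a > 0) = (det3 x a b > 0) \<and> (det3 x a b > 0) = (\<not> det3 x w b > 0)"
    if "det3 x w b \<noteq> 0" for x
  proof -
    have "det3 b w x = - det3 x w b" by (simp add: det3_def algebra_simps)
    then show ?thesis using that unfolding in_cone_def by (auto simp: det3_cyclic)
  qed
  have e: "det3 q p w = - det3 p q w"
    "det3 q p a = - det3 p q a"
    "det3 q p b = - det3 p q b"
    "det3 w p q = det3 p q w"
    "det3 w p a = - det3 p w a"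
    "det3 w p b = - det3 p w b"
    "det3 w q a = - det3 q w a"
    "det3 w q b = - det3 q w b"
    "det3 a p q = det3 p q a"
    "det3 a p w = det3 p w a"
    "det3 a p b = - det3 p a b"
    "det3 a q w = det3 q w a"
    "det3 a q b = - det3 q a b"
    "det3 a w b = - det3 w a b"
    "det3 b p q = det3 p q b"
    "det3 b p w = det3 p w b"
    "det3 b p a = det3 p a b"
    "det3 b q w = det3 q w b"
    "det3 b q a = det3 q a b"
    "det3 b w a = det3 w a b"
    by (simp_all add: det3_def algebra_simps)
  have lt: "x < 0 \<longleftrightarrow> \<not> 0 < x" if "x \<noteq> 0" for x :: real using that by linarith
  note sz = sum_zero_signs[OF det3_pluecker]
  have "(ray_cross p q w a \<noteq> (ray_cross p q a b \<noteq> ray_cross p q b w))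
     \<longleftrightarrow> (in_cone p w a b \<noteq> in_cone q w a b)"
    unfolding r1 r2 r3 i[OF n(5)] i[OF n(8)]
  proof (rule five_point_signs)
    show "((det3 p q w > 0) = (det3 p a b > 0)) = ((det3 p q a > 0) = (det3 p w b > 0)) \<or>
       ((det3 p q a > 0) = (det3 p w b > 0)) = ((det3 p q b > 0) = (det3 p w a > 0))"
      by (rule sz) (use n in auto)
    show "((det3 p q w > 0) = (det3 q a b > 0)) = ((det3 p q a > 0) = (det3 q w b > 0)) \<or>
       ((det3 p q a > 0) = (det3 q w b > 0)) = ((det3 p q b > 0) = (det3 q w a > 0))"
      using sz[of q p w a b] n unfolding e by (auto simp: lt)
    show "((det3 p q w > 0) = (det3 w a b > 0)) = ((det3 p w a > 0) = (det3 q w b > 0)) \<or>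
       ((det3 p w a > 0) = (det3 q w b > 0)) = ((det3 p w b > 0) = (det3 q w a > 0))"
      using sz[of w p q a b] n unfolding e by (auto simp: lt)
    show "((det3 p q a > 0) = (det3 w a b > 0)) = ((det3 p w a > 0) = (det3 q a b > 0)) \<or>
       ((det3 p w a > 0) = (det3 q a b > 0)) = ((det3 p a b > 0) = (det3 q w a > 0))"
      using sz[of a p q w b] n unfolding e by (auto simp: lt)
    show "((det3 p q b > 0) = (det3 w a b > 0)) = ((det3 p w b > 0) = (det3 q a b > 0)) \<or>
       ((det3 p w b > 0) = (det3 q a b > 0)) = ((det3 p a b > 0) = (det3 q w b > 0))"
      using sz[of b p q w a] n unfolding e by (auto simp: lt)
  qed
  then have "((ray_cross p q w a \<noteq> ray_cross p q a b) \<noteq> ray_cross p q b w)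
     \<longleftrightarrow> (in_cone p w a b \<noteq> in_cone q w a b)" by argo
  then show ?thesis by (simp only: bit_of_bool_xor)
next
  case False
  then have deg: "w = a \<or> a = b \<or> b = w" by auto
  have "in_cone x w a b \<longleftrightarrow> w = a \<and> a = b" if x: "x \<in> V" "x \<notin> {w, a, b}" for x
  proof (cases "w = a \<and> a = b")
    case True
    then show ?thesis by (simp add: in_cone_def)
  next
    case False
    have nz: "det3 y z x \<noteq> 0" if "y \<in> V" "z \<in> V" "y \<noteq> z" "x \<noteq> y" "x \<noteq> z" for y z
      using g that x(1) unfolding radially_generic_def by auto
    have opp: "det3 z y x > 0 \<longleftrightarrow> \<not> det3 y z x > 0" if "y \<in> V" "z \<in> V" "y \<noteq> z" "x \<noteq> y" "x \<noteq> z" for y z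
      using nz[OF that] det3_swap(1)[of z y x] by auto
    from deg show ?thesis
    proof (elim disjE)
      assume "w = a" then show ?thesis using opp[of a b] False x(2) V by (auto simp: in_cone_def)
    next
      assume "a = b" then show ?thesis using opp[of w b] False x(2) V by (auto simp: in_cone_def)
    next
      assume "b = w" then show ?thesis using opp[of w a] False x(2) V by (auto simp: in_cone_def)
    qed
  qed
  moreover have "rc p q w a + rc p q a b + rc p q b w = 0"
    using deg
  proof (elim disjE)
    assume "w = a" then show ?thesis by (simp add: ray_cross_degenerate ray_cross_sym(3)[of p q b a])
  next
    assume "a = b" then show ?thesis by (simp add: ray_cross_degenerate ray_cross_sym(3)[of p q b w])
  next
    assume "b = w" then show ?thesis by (simp add: ray_cross_degenerate ray_cross_sym(3)[of p q w a])
  qed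
  ultimately show ?thesis using V d by simp
qed

text \<open>The boundary is tested against a function on points instead of being a set of points.
  Vanishing for every \<open>\<phi>\<close> means that each point is an end of evenly many segments,
  whatever their order and direction.\<close>

definition mod2_boundary :: "('v \<times> 'v) list \<Rightarrow> ('v \<Rightarrow> bit) \<Rightarrow> bit" where
  "mod2_boundary ss \<phi> = (\<Sum>(a, b)\<leftarrow>ss. \<phi> a + \<phi> b)"

definition crossings :: "((real^3) \<times> (real^3)) list \<Rightarrow> ((real^3) \<times> (real^3)) list \<Rightarrow> bit" where
  "crossings ss tt = (\<Sum>(p, q)\<leftarrow>ss. \<Sum>(a, b)\<leftarrow>tt. rc p q a b)"

lemma sum_list_swap:
  "(\<Sum>x\<leftarrow>xs. \<Sum>y\<leftarrow>ys. f x y) = (\<Sum>y\<leftarrow>ys. \<Sum>x\<leftarrow>xs. f x y :: 'b::comm_monoid_add)"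
  by (induction xs) (auto simp: sum_list_addf)

lemma crossings_sym: "crossings tt ss = crossings ss tt"
  unfolding crossings_def case_prod_unfold
  by (subst sum_list_swap) (simp add: ray_cross_sym(1))

lemma crossings_append:
  "crossings (ss @ ss') tt = crossings ss tt + crossings ss' tt"
  "crossings ss (tt @ tt') = crossings ss tt + crossings ss tt'"
  by (simp_all add: crossings_def case_prod_unfold sum_list_addf)

text \<open>Coning \<open>tt\<close> from its vertex \<open>w\<close> splits the crossings of
  \<open>pq\<close> with \<open>tt\<close> into the boundary of \<open>tt\<close> evaluated at
  \<open>rc p q w\<close>, which is 0, and \<open>\<psi> p + \<psi> q\<close>, where
  \<open>\<psi>\<close> is the parity of the cones containing a point. Summed over the closed
  \<open>ss\<close>, the latter vanishes too.\<close>

lemma crossings_closed: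
  assumes g: "radially_generic V" and V: "chain_points ss \<subseteq> V" "chain_points tt \<subseteq> V"
    and dis: "chain_points ss \<inter> chain_points tt = {}"
    and cl: "\<And>\<phi>. mod2_boundary ss \<phi> = 0" "\<And>\<phi>. mod2_boundary tt \<phi> = 0"
    and proper: "\<And>p q. (p, q) \<in> set ss \<Longrightarrow> p \<noteq> q"
  shows "crossings ss tt = 0"
proof (cases tt)
  case Nil
  then show ?thesis by (simp add: crossings_def case_prod_unfold)
next
  case (Cons t0 tt')
  define w where "w = fst t0"
  have w: "w \<in> chain_points tt" unfolding w_def Cons chain_points_def by simp
  define \<psi> where "\<psi> p = (\<Sum>(a, b)\<leftarrow>tt. of_bool (in_cone p w a b) :: bit)" for p
  have "(\<Sum>(a, b)\<leftarrow>tt. rc p q a b) = \<psi> p + \<psi> q" if pq: "(p, q) \<in> set ss" for p q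
  proof -
    have pts: "p \<in> chain_points ss" "q \<in> chain_points ss" using pq unfolding chain_points_def by force+
    have "rc p q a b = (rc p q w a + rc p q w b) + (of_bool (in_cone p w a b) + of_bool (in_cone q w a b))"
      if ab: "(a, b) \<in> set tt" for a b
    proof -
      have "a \<in> chain_points tt" "b \<in> chain_points tt" using ab unfolding chain_points_def by force+
      then have tri: "rc p q w a + rc p q a b + rc p q b w = of_bool (in_cone p w a b) + of_bool (in_cone q w a b)"
        using pts V w dis proper[OF pq] by (intro ray_cross_triangle[OF g]) auto
      then show ?thesis by (simp add: ray_cross_sym(3)[of p q b w] ac_simps flip: tri)
    qed
    then have "(\<Sum>t\<leftarrow>tt. rc p q (fst t) (snd t)) = (\<Sum>t\<leftarrow>tt. (rc p q w (fst t) + rc p q w (snd t)) +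
       (of_bool (in_cone p w (fst t) (snd t)) + of_bool (in_cone q w (fst t) (snd t))))"
      by (intro arg_cong[where f = sum_list] map_cong refl) (metis prod.collapse)
    also have "\<dots> = mod2_boundary tt (rc p q w) + (\<psi> p + \<psi> q)"
      unfolding sum_list_addf \<psi>_def mod2_boundary_def case_prod_unfold by (simp add: ac_simps)
    finally show ?thesis using cl(2) by (simp add: case_prod_unfold)
  qed
  then have "crossings ss tt = (\<Sum>s\<leftarrow>ss. \<psi> (fst s) + \<psi> (snd s))"
    unfolding crossings_def
    by (intro arg_cong[where f = sum_list] map_cong refl) (auto simp: case_prod_unfold)
  also have "\<dots> = mod2_boundary ss \<psi>" by (simp add: mod2_boundary_def case_prod_unfold)
  finally show ?thesis using cl(1) by simp
qed

text \<open>The parity of crossings in a straight K4 is one plus its four orientations. Among the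
  five quadruples of five points every triple occurs twice, so the orientations cancel and five ones
  remain: this is why the van Kampen number is odd.\<close>

lemma ray_cross_quadruple:
  assumes g: "radially_generic V" and V: "a \<in> V" "b \<in> V" "c \<in> V" "d \<in> V" and dist: "distinct [a, b, c, d]"
  defines "s \<equiv> \<lambda>x y z. of_bool (det3 x y z > 0) :: bit"
  shows "rc a b c d + rc a c b d + rc a d b c = 1 + s a b c + s a b d + s a c d + s b c d"
proof -
  have nz: "det3 x y z \<noteq> 0" if "x \<in> V" "y \<in> V" "z \<in> V" "distinct [x, y, z]" for x y z
    using g that unfolding radially_generic_def by blast
  have n: "det3 a b c \<noteq> 0" "det3 a b d \<noteq> 0" "det3 a c d \<noteq> 0" "det3 b c d \<noteq> 0"
    by (rule nz; use V dist in auto)+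
  have e: "det3 c d a = det3 a c d" "det3 c d b = det3 b c d"
    "det3 a c b = - det3 a b c" "det3 b d a = det3 a b d" "det3 b d c = - det3 b c d"
    "det3 a d b = - det3 a b d" "det3 a d c = - det3 a c d" "det3 b c a = det3 a b c"
    by (simp_all add: det3_def algebra_simps)
  have lt: "x < 0 \<longleftrightarrow> \<not> 0 < x" if "x \<noteq> 0" for x :: real using that by linarith
  have "ray_cross a b c d \<longleftrightarrow> (det3 a b c > 0) \<noteq> (det3 a b d > 0) \<and> (det3 a c d > 0) \<noteq> (det3 b c d > 0)"
    "ray_cross a c b d \<longleftrightarrow> (det3 a b c > 0) = (det3 a c d > 0) \<and> (det3 a b d > 0) = (det3 b c d > 0)"
    "ray_cross a d b c \<longleftrightarrow> (det3 a b d > 0) \<noteq> (det3 a c d > 0) \<and> (det3 a b c > 0) \<noteq> (det3 b c d > 0)"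
    by (subst ray_cross_signs; use n e in \<open>auto simp: lt\<close>)+
  then show ?thesis unfolding s_def
    by (cases "det3 a b c > 0"; cases "det3 a b d > 0"; cases "det3 a c d > 0"; cases "det3 b c d > 0") simp_all
qed

text \<open>The fifteen unordered pairs of disjoint edges of K5, each edge with its smaller end
  first and the two edges in lexicographic order.\<close>

definition K5_sum :: "(nat \<Rightarrow> nat \<Rightarrow> nat \<Rightarrow> nat \<Rightarrow> bit) \<Rightarrow> bit" where
  "K5_sum K = K 0 1 2 3 + K 0 1 2 4 + K 0 1 3 4 + K 0 2 1 3 + K 0 2 1 4 + K 0 2 3 4 + K 0 3 1 2 + K 0 3 1 4 + K 0 3 2 4 + K 0 4 1 2 + K 0 4 1 3 + K 0 4 2 3 + K 1 2 3 4 + K 1 3 2 4 + K 1 4 2 3"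

text \<open>The letters count crossings of two curved edges (\<open>a\<close>), of a curved with a
  straight one (\<open>b\<close>) and of two straight ones (\<open>c\<close>). The last ten
  assumptions, one for each edge and its opposite triangle, show that all \<open>b\<close> together
  give each \<open>c\<close> twice, that is 0.\<close>

lemma K5_bookkeeping:
  fixes a0123 a0124 a0134 a0213 a0214 a0234 a0312 a0314 a0324 a0412 a0413 a0423 a1234 a1324 a1423 b0123 b0124 b0134 b0213 b0214 b0234 b0312 b0314 b0324 b0412 b0413 b0423 b1203 b1204 b1234 b1302 b1304 b1324 b1402 b1403 b1423 b2301 b2304 b2314 b2401 b2403 b2413 b3401 b3402 b3412 c0123 c0124 c0134 c0213 c0214 c0234 c0312 c0314 c0324 c0412 c0413 c0423 c1234 c1324 c1423 :: bit
  assumes "a0123 = b0123 + b2301 + c0123"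
    "a0124 = b0124 + b2401 + c0124"
    "a0134 = b0134 + b3401 + c0134"
    "a0213 = b0213 + b1302 + c0213"
    "a0214 = b0214 + b1402 + c0214"
    "a0234 = b0234 + b3402 + c0234"
    "a0312 = b0312 + b1203 + c0312"
    "a0314 = b0314 + b1403 + c0314"
    "a0324 = b0324 + b2403 + c0324"
    "a0412 = b0412 + b1204 + c0412"
    "a0413 = b0413 + b1304 + c0413"
    "a0423 = b0423 + b2304 + c0423"
    "a1234 = b1234 + b3412 + c1234"
    "a1324 = b1324 + b2413 + c1324"
    "a1423 = b1423 + b2314 + c1423"
    and "b0123 = b0124 + b0134 + c0123 + c0124 + c0134"
    "b0213 = b0214 + b0234 + c0213 + c0214 + c0234"
    "b0312 = b0314 + b0324 + c0312 + c0314 + c0324"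
    "b0412 = b0413 + b0423 + c0412 + c0413 + c0423"
    "b1203 = b1204 + b1234 + c0312 + c0412 + c1234"
    "b1302 = b1304 + b1324 + c0213 + c0413 + c1324"
    "b1402 = b1403 + b1423 + c0214 + c0314 + c1423"
    "b2301 = b2304 + b2314 + c0123 + c0423 + c1423"
    "b2401 = b2403 + b2413 + c0124 + c0324 + c1324"
    "b3401 = b3402 + b3412 + c0134 + c0234 + c1234"
  shows "a0123 + a0124 + a0134 + a0213 + a0214 + a0234 + a0312 + a0314 + a0324 + a0412 + a0413 + a0423 + a1234 + a1324 + a1423
    = c0123 + c0124 + c0134 + c0213 + c0214 + c0234 + c0312 + c0314 + c0324 + c0412 + c0413 + c0423 + c1234 + c1324 + c1423"
  unfolding assms by (simp add: ac_simps)

text \<open>Straightening the edges preserves the total: a chain together with the segment between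
  its ends, \<open>D i j\<close>, is closed, and so crosses disjoint chains of this kind and
  straight triangles evenly. For straight edges \<open>ray_cross_quadruple\<close> gives the
  value.\<close>

lemma van_kampen_K5:
  fixes v :: "nat \<Rightarrow> real^3" and Q :: "nat \<Rightarrow> nat \<Rightarrow> ((real^3) \<times> (real^3)) list"
  assumes g: "radially_generic V" and inj: "inj_on v {..<5}" and vV: "\<And>i. i < 5 \<Longrightarrow> v i \<in> V"
    and QV: "\<And>i j. i < j \<Longrightarrow> j < 5 \<Longrightarrow> chain_points (Q i j) \<subseteq> V"
    and bd: "\<And>i j \<phi>. i < j \<Longrightarrow> j < 5 \<Longrightarrow> mod2_boundary (Q i j) \<phi> = \<phi> (v i) + \<phi> (v j)"
    and dis: "\<And>i j k l. i < j \<Longrightarrow> j < 5 \<Longrightarrow> k < l \<Longrightarrow> l < 5 \<Longrightarrow> {i, j} \<inter> {k, l} = {} \<Longrightarrow>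
       chain_points (Q i j) \<inter> chain_points (Q k l) = {}"
    and av: "\<And>i j k. i < j \<Longrightarrow> j < 5 \<Longrightarrow> k < 5 \<Longrightarrow> k \<notin> {i, j} \<Longrightarrow> v k \<notin> chain_points (Q i j)"
    and proper: "\<And>i j p q. i < j \<Longrightarrow> j < 5 \<Longrightarrow> (p, q) \<in> set (Q i j) \<Longrightarrow> p \<noteq> q"
  shows "K5_sum (\<lambda>i j k l. crossings (Q i j) (Q k l)) = 1"
proof -
  define K where "K i j k l = crossings (Q i j) (Q k l)" for i j k l
  define S where "S i j = [(v i, v j)]" for i j
  define D where "D i j = Q i j @ S i j" for i j
  have vne: "v i = v j \<longleftrightarrow> i = j" if "i < 5" "j < 5" for i j
    using inj that by (auto simp: inj_on_def)
  have S: "chain_points (S i j) = {v i, v j}" "mod2_boundary (S i j) \<phi> = \<phi> (v i) + \<phi> (v j)" for i j \<phi>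
    by (auto simp: S_def chain_points_def mod2_boundary_def)
  have cpa: "chain_points (xs @ ys) = chain_points xs \<union> chain_points ys" for xs ys :: "((real^3) \<times> (real^3)) list"
    by (auto simp: chain_points_def)
  have mba: "mod2_boundary (xs @ ys) \<phi> = mod2_boundary xs \<phi> + mod2_boundary ys \<phi>"
    for xs ys :: "((real^3) \<times> (real^3)) list" and \<phi> by (simp add: mod2_boundary_def)
  have DV: "chain_points (D i j) \<subseteq> V" if "i < j" "j < 5" for i j
    using QV[OF that] vV that by (auto simp: D_def cpa S)
  have Dbd: "mod2_boundary (D i j) \<phi> = 0" if "i < j" "j < 5" for i j \<phi>
    using bd[OF that] by (simp add: D_def mba S)
  have Dp: "p \<noteq> q" if "i < j" "j < 5" "(p, q) \<in> set (D i j)" for i j p q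
    using that proper[OF that(1,2)] vne[of i j] by (auto simp: D_def S_def)
  have DD: "crossings (D i j) (D k l) = 0"
    if "i < j" "j < 5" "k < l" "l < 5" "{i, j} \<inter> {k, l} = {}" for i j k l
  proof (rule crossings_closed[OF g])
    show "chain_points (D i j) \<inter> chain_points (D k l) = {}"
      using dis[OF that] av[OF that(1,2), of k] av[OF that(1,2), of l] av[OF that(3,4), of i] av[OF that(3,4), of j]
        vne[of i k] vne[of i l] vne[of j k] vne[of j l] that
      by (auto simp: D_def cpa S)
  qed (use DV Dbd Dp that in auto)
  have DT: "crossings (D i j) (S k l) + crossings (D i j) (S k m) + crossings (D i j) (S l m) = 0"
    if "i < j" "j < 5" "k < l" "l < m" "m < 5" "{i, j} \<inter> {k, l, m} = {}" for i j k l m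
  proof -
    have "crossings (D i j) (S k l @ S k m @ S l m) = 0"
    proof (rule crossings_closed[OF g])
      show "chain_points (S k l @ S k m @ S l m) \<subseteq> V" using that vV by (auto simp: cpa S)
      show "chain_points (D i j) \<inter> chain_points (S k l @ S k m @ S l m) = {}"
        using av[OF that(1,2), of k] av[OF that(1,2), of l] av[OF that(1,2), of m]
          vne[of i k] vne[of i l] vne[of i m] vne[of j k] vne[of j l] vne[of j m] that
        by (auto simp: D_def cpa S)
      show "mod2_boundary (S k l @ S k m @ S l m) \<phi> = 0" for \<phi>
        by (simp add: mba S ac_simps)
    qed (use DV Dbd Dp that in auto)
    then show ?thesis by (simp add: crossings_append ac_simps)
  qed
  define B where "B i j k l = crossings (Q i j) (S k l)" for i j k l
  define C where "C i j k l = crossings (S i j) (S k l)" for i j k l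
  have zero_sum: "x + y = 0 \<Longrightarrow> x = y" for x y :: bit by (cases x; cases y) auto
  have A: "K i j k l = B i j k l + B k l i j + C i j k l"
    if "i < j" "j < 5" "k < l" "l < 5" "{i, j} \<inter> {k, l} = {}" for i j k l
  proof -
    have "crossings (D i j) (D k l) = crossings (Q i j) (Q k l) + (B i j k l + B k l i j + C i j k l)"
      by (simp add: D_def crossings_append B_def C_def crossings_sym[of "S i j" "Q k l"] ac_simps)
    then have "K i j k l + (B i j k l + B k l i j + C i j k l) = 0"
      unfolding DD[OF that] K_def by (rule sym)
    then show ?thesis by (rule zero_sum)
  qed
  have BT: "B i j k l + B i j k m + B i j l m = C i j k l + C i j k m + C i j l m"
    if "i < j" "j < 5" "k < l" "l < m" "m < 5" "{i, j} \<inter> {k, l, m} = {}" for i j k l m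
  proof -
    have "crossings (D i j) (S k l) + crossings (D i j) (S k m) + crossings (D i j) (S l m) =
      (B i j k l + B i j k m + B i j l m) + (C i j k l + C i j k m + C i j l m)"
      by (simp add: D_def crossings_append B_def C_def ac_simps)
    then have "(B i j k l + B i j k m + B i j l m) + (C i j k l + C i j k m + C i j l m) = 0"
      unfolding DT[OF that] by (rule sym)
    then show ?thesis by (rule zero_sum)
  qed
  have Cs: "C i j k l = C k l i j" for i j k l unfolding C_def by (rule crossings_sym)
  define s where "s i j k = (of_bool (det3 (v i) (v j) (v k) > 0) :: bit)" for i j k
  have quad: "C i j k l + C i k j l + C i l j k = 1 + s i j k + s i j l + s i k l + s j k l"
    if "i < j" "j < k" "k < l" "l < 5" for i j k l
    using ray_cross_quadruple[OF g, of "v i" "v j" "v k" "v l"] that vV vne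
    by (simp add: C_def crossings_def S_def s_def)
  have move: "x = y + z + c1 + c2 + c3" if "x + y + z = c1 + c2 + c3" for x y z c1 c2 c3 :: bit
    using that[symmetric] by (simp add: add.assoc)
  \<comment> \<open>\<open>BT\<close> for each edge and its opposite triangle, solved for one term,
    with the straight pairs brought into the order of \<open>K5_sum\<close> by
    \<open>Cs\<close>.\<close>
  have BT': "B 0 1 2 3 = B 0 1 2 4 + B 0 1 3 4 + C 0 1 2 3 + C 0 1 2 4 + C 0 1 3 4"
    "B 0 2 1 3 = B 0 2 1 4 + B 0 2 3 4 + C 0 2 1 3 + C 0 2 1 4 + C 0 2 3 4"
    "B 0 3 1 2 = B 0 3 1 4 + B 0 3 2 4 + C 0 3 1 2 + C 0 3 1 4 + C 0 3 2 4"
    "B 0 4 1 2 = B 0 4 1 3 + B 0 4 2 3 + C 0 4 1 2 + C 0 4 1 3 + C 0 4 2 3"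
    "B 1 2 0 3 = B 1 2 0 4 + B 1 2 3 4 + C 0 3 1 2 + C 0 4 1 2 + C 1 2 3 4"
    "B 1 3 0 2 = B 1 3 0 4 + B 1 3 2 4 + C 0 2 1 3 + C 0 4 1 3 + C 1 3 2 4"
    "B 1 4 0 2 = B 1 4 0 3 + B 1 4 2 3 + C 0 2 1 4 + C 0 3 1 4 + C 1 4 2 3"
    "B 2 3 0 1 = B 2 3 0 4 + B 2 3 1 4 + C 0 1 2 3 + C 0 4 2 3 + C 1 4 2 3"
    "B 2 4 0 1 = B 2 4 0 3 + B 2 4 1 3 + C 0 1 2 4 + C 0 3 2 4 + C 1 3 2 4"
    "B 3 4 0 1 = B 3 4 0 2 + B 3 4 1 2 + C 0 1 3 4 + C 0 2 3 4 + C 1 2 3 4"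
    subgoal by (rule move[OF BT[of 0 1 2 3 4]]) simp_all
    subgoal by (rule move[OF BT[of 0 2 1 3 4]]) simp_all
    subgoal by (rule move[OF BT[of 0 3 1 2 4]]) simp_all
    subgoal by (rule move[OF BT[of 0 4 1 2 3]]) simp_all
    subgoal unfolding Cs[of 0 3 1 2] Cs[of 0 4 1 2] by (rule move[OF BT[of 1 2 0 3 4]]) simp_all
    subgoal unfolding Cs[of 0 2 1 3] Cs[of 0 4 1 3] by (rule move[OF BT[of 1 3 0 2 4]]) simp_all
    subgoal unfolding Cs[of 0 2 1 4] Cs[of 0 3 1 4] by (rule move[OF BT[of 1 4 0 2 3]]) simp_all
    subgoal unfolding Cs[of 0 1 2 3] Cs[of 0 4 2 3] Cs[of 1 4 2 3] by (rule move[OF BT[of 2 3 0 1 4]]) simp_all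
    subgoal unfolding Cs[of 0 1 2 4] Cs[of 0 3 2 4] Cs[of 1 3 2 4] by (rule move[OF BT[of 2 4 0 1 3]]) simp_all
    subgoal unfolding Cs[of 0 1 3 4] Cs[of 0 2 3 4] Cs[of 1 2 3 4] by (rule move[OF BT[of 3 4 0 1 2]]) simp_all
    done
  have "K 0 1 2 3 + K 0 1 2 4 + K 0 1 3 4 + K 0 2 1 3 + K 0 2 1 4 + K 0 2 3 4 + K 0 3 1 2 + K 0 3 1 4 + K 0 3 2 4 + K 0 4 1 2 + K 0 4 1 3 + K 0 4 2 3 + K 1 2 3 4 + K 1 3 2 4 + K 1 4 2 3
    = C 0 1 2 3 + C 0 1 2 4 + C 0 1 3 4 + C 0 2 1 3 + C 0 2 1 4 + C 0 2 3 4 + C 0 3 1 2 + C 0 3 1 4 + C 0 3 2 4 + C 0 4 1 2 + C 0 4 1 3 + C 0 4 2 3 + C 1 2 3 4 + C 1 3 2 4 + C 1 4 2 3"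
    by (rule K5_bookkeeping[OF A A A A A A A A A A A A A A A BT']) auto
  \<comment> \<open>Grouped by the vertex that a pair of edges leaves out.\<close>
  also have "\<dots> = (C 1 2 3 4 + C 1 3 2 4 + C 1 4 2 3) + (C 0 2 3 4 + C 0 3 2 4 + C 0 4 2 3) + (C 0 1 3 4 + C 0 3 1 4 + C 0 4 1 3) + (C 0 1 2 4 + C 0 2 1 4 + C 0 4 1 2) + (C 0 1 2 3 + C 0 2 1 3 + C 0 3 1 2)"
    by (simp only: ac_simps)
  also have "\<dots> = (1 + s 1 2 3 + s 1 2 4 + s 1 3 4 + s 2 3 4) + (1 + s 0 2 3 + s 0 2 4 + s 0 3 4 + s 2 3 4) + (1 + s 0 1 3 + s 0 1 4 + s 0 3 4 + s 1 3 4) + (1 + s 0 1 2 + s 0 1 4 + s 0 2 4 + s 1 2 4) + (1 + s 0 1 2 + s 0 1 3 + s 0 2 3 + s 1 2 3)"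
    by (intro arg_cong2[where f = "(+)"] quad) auto
  also have "\<dots> = 1" by (simp add: ac_simps)
  finally show ?thesis unfolding K5_sum_def K_def .
qed

section \<open>Polygonal approximation of tame embeddings\<close>

definition moment :: "real \<Rightarrow> real^3" where
  "moment s = vector [s, s^2, s^3]"

lemma moment_nth [simp]: "moment s $ 1 = s" "moment s $ 2 = s^2" "moment s $ 3 = s^3"
  by (simp_all add: moment_def vector_3)

text \<open>A Vandermonde determinant in which the origin is the point of parameter 0.\<close>

lemma det3_moment:
  "det3 (moment a) (moment b) (moment c) = a * b * c * ((b - a) * (c - a) * (c - b))"
  by (simp add: det3_def algebra_simps power2_eq_square power3_eq_cube)

lemma det3_moment_diff:
  "det3 (moment b - moment a) (moment c - moment a) (moment d - moment a) =
    (b - a) * (c - a) * (d - a) * ((c - b) * (d - b) * (d - c))"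
  by (simp add: det3_def algebra_simps power2_eq_square power3_eq_cube)

text \<open>The determinant is a cubic in \<open>\<epsilon>\<close> whose leading coefficient is
  that of the directions alone.\<close>

lemma finite_det3_roots:
  assumes "det3 x y z \<noteq> 0"
  shows "finite {\<epsilon>. det3 (u + \<epsilon> *\<^sub>R x) (v + \<epsilon> *\<^sub>R y) (w + \<epsilon> *\<^sub>R z) = 0}"
proof -
  define P where "P = [:det3 u v w, det3 x v w + det3 u y w + det3 u v z,
     det3 x y w + det3 x v z + det3 u y z, det3 x y z:]"
  have "P \<noteq> 0" using assms by (auto simp: P_def)
  moreover have "poly P \<epsilon> = det3 (u + \<epsilon> *\<^sub>R x) (v + \<epsilon> *\<^sub>R y) (w + \<epsilon> *\<^sub>R z)" for \<epsilon>
    by (simp add: P_def det3_def algebra_simps)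
  ultimately show ?thesis using poly_roots_finite[of P] by simp
qed

lemma finite_affine_roots:
  fixes x :: "real^3"
  assumes "x \<noteq> 0"
  shows "finite {\<epsilon>. u + \<epsilon> *\<^sub>R x = 0}"
proof (rule finite_subset)
  show "{\<epsilon>. u + \<epsilon> *\<^sub>R x = 0} \<subseteq> {- (u \<bullet> x) / (x \<bullet> x)}"
  proof clarify
    fix \<epsilon> assume "u + \<epsilon> *\<^sub>R x = 0"
    then have "(u + \<epsilon> *\<^sub>R x) \<bullet> x = 0" by simp
    then show "\<epsilon> = - (u \<bullet> x) / (x \<bullet> x)" using assms by (simp add: inner_add_left field_simps)
  qed
qed simp

text \<open>Each point moves by \<open>\<epsilon>\<close> times its own point on the moment curve.
  These directions satisfy all the nondegeneracy conditions, so every condition fails for finitely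
  many \<open>\<epsilon>\<close> only, and arbitrarily small good values remain.\<close>

lemma perturb_general_position:
  fixes c :: "'i \<Rightarrow> real^3"
  assumes fin: "finite I" and "\<eta> > 0"
  obtains c' where "inj_on c' I" "\<And>i. i \<in> I \<Longrightarrow> dist (c' i) (c i) < \<eta>"
    "\<And>i j k. {i, j, k} \<subseteq> I \<Longrightarrow> distinct [i, j, k] \<Longrightarrow> det3 (c' i) (c' j) (c' k) \<noteq> 0"
    "\<And>i j k l. {i, j, k, l} \<subseteq> I \<Longrightarrow> distinct [i, j, k, l] \<Longrightarrow>
        det3 (c' j - c' i) (c' k - c' i) (c' l - c' i) \<noteq> 0"
proof -
  obtain f :: "'i \<Rightarrow> nat" where f: "inj_on f I" using fin finite_imp_inj_to_nat_seg by metis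
  \<comment> \<open>The shift by 1 keeps parameters away from 0, where the determinants with the
    origin vanish.\<close>
  define t where "t i = real (f i) + 1" for i
  have t: "t i > 0" "t i = t j \<longleftrightarrow> f i = f j" for i j by (auto simp: t_def)
  have tne: "t i \<noteq> t j" if "i \<in> I" "j \<in> I" "i \<noteq> j" for i j using that f t by (auto simp: inj_on_def)
  define m where "m i = moment (t i)" for i
  define C where "C \<epsilon> i = c i + \<epsilon> *\<^sub>R m i" for \<epsilon> i
  have 2: "finite {\<epsilon>. C \<epsilon> i = C \<epsilon> j}" if "i \<in> I" "j \<in> I" "i \<noteq> j" for i j
  proof -
    have "(m i - m j)$1 \<noteq> 0" using tne that by (simp add: m_def)
    then have "m i - m j \<noteq> 0" by (metis zero_index)
    moreover have "C \<epsilon> i = C \<epsilon> j \<longleftrightarrow> (c i - c j) + \<epsilon> *\<^sub>R (m i - m j) = 0" for \<epsilon>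
      by (simp add: C_def algebra_simps)
    ultimately show ?thesis using finite_affine_roots[of "m i - m j"] by simp
  qed
  have 3: "finite {\<epsilon>. det3 (C \<epsilon> i) (C \<epsilon> j) (C \<epsilon> k) = 0}" if "{i, j, k} \<subseteq> I" "distinct [i, j, k]" for i j k
  proof -
    have "det3 (m i) (m j) (m k) \<noteq> 0"
      using that tne[of i j] tne[of i k] tne[of j k] t(1)[of i] t(1)[of j] t(1)[of k]
      by (auto simp: m_def det3_moment)
    then show ?thesis unfolding C_def by (rule finite_det3_roots)
  qed
  have 4: "finite {\<epsilon>. det3 (C \<epsilon> j - C \<epsilon> i) (C \<epsilon> k - C \<epsilon> i) (C \<epsilon> l - C \<epsilon> i) = 0}"
    if "{i, j, k, l} \<subseteq> I" "distinct [i, j, k, l]" for i j k l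
  proof -
    have "C \<epsilon> a - C \<epsilon> b = (c a - c b) + \<epsilon> *\<^sub>R (m a - m b)" for \<epsilon> a b by (simp add: C_def algebra_simps)
    moreover have "det3 (m j - m i) (m k - m i) (m l - m i) \<noteq> 0"
      using that tne[of i j] tne[of i k] tne[of i l] tne[of j k] tne[of j l] tne[of k l]
      by (auto simp: m_def det3_moment_diff)
    ultimately show ?thesis using finite_det3_roots[of "m j - m i" "m k - m i" "m l - m i"] by simp
  qed
  define bad where "bad = (\<Union>i\<in>I. \<Union>j\<in>I - {i}. {\<epsilon>. C \<epsilon> i = C \<epsilon> j}) \<union>
     (\<Union>i\<in>I. \<Union>j\<in>I - {i}. \<Union>k\<in>I - {i, j}. {\<epsilon>. det3 (C \<epsilon> i) (C \<epsilon> j) (C \<epsilon> k) = 0}) \<union>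
     (\<Union>i\<in>I. \<Union>j\<in>I - {i}. \<Union>k\<in>I - {i, j}. \<Union>l\<in>I - {i, j, k}.
        {\<epsilon>. det3 (C \<epsilon> j - C \<epsilon> i) (C \<epsilon> k - C \<epsilon> i) (C \<epsilon> l - C \<epsilon> i) = 0})"
  have "finite bad" unfolding bad_def
    using 2 3 4 fin by (intro finite_UnI finite_UN_I finite_Diff) auto
  define M where "M = (\<Sum>i\<in>I. norm (m i))"
  have M: "norm (m i) \<le> M" if "i \<in> I" for i
    unfolding M_def using that fin by (intro member_le_sum) auto
  have "M \<ge> 0" unfolding M_def by (intro sum_nonneg) auto
  then have "\<eta> / (M + 1) > 0" using assms(2) by simp
  then have "infinite {0<..<\<eta> / (M + 1)}" by (rule infinite_Ioo)
  then obtain \<epsilon> where e: "\<epsilon> \<in> {0<..<\<eta> / (M + 1)}" "\<epsilon> \<notin> bad"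
    using \<open>finite bad\<close> by (meson finite_subset subsetI)
  show thesis
  proof
    show "inj_on (C \<epsilon>) I" using e(2) unfolding bad_def inj_on_def by blast
    show "dist (C \<epsilon> i) (c i) < \<eta>" if "i \<in> I" for i
    proof -
      have "dist (C \<epsilon> i) (c i) = \<epsilon> * norm (m i)" using e(1) by (simp add: C_def dist_norm)
      also have "\<dots> \<le> \<epsilon> * (M + 1)" using M[OF that] e(1) by (intro mult_left_mono) auto
      also have "\<dots> < \<eta>" using e(1) \<open>M \<ge> 0\<close> by (simp add: pos_less_divide_eq)
      finally show ?thesis .
    qed
    show "det3 (C \<epsilon> i) (C \<epsilon> j) (C \<epsilon> k) \<noteq> 0" if "{i, j, k} \<subseteq> I" "distinct [i, j, k]" for i j k
      using e(2) that unfolding bad_def by auto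
    show "det3 (C \<epsilon> j - C \<epsilon> i) (C \<epsilon> k - C \<epsilon> i) (C \<epsilon> l - C \<epsilon> i) \<noteq> 0"
      if "{i, j, k, l} \<subseteq> I" "distinct [i, j, k, l]" for i j k l
      using e(2) that unfolding bad_def by auto
  qed
qed

text \<open>The same sphere serves: it has a positive distance \<open>d\<close> from the two compact
  sets, and the ball of radius \<open>d\<close> about any of their points stays in one component of
  its complement. No isotopy between old and new sets is involved.\<close>

lemma split_link_disjoint_nearby:
  assumes "split_link K1 K2" "compact K1" "compact K2"
  obtains d where "d > 0" "\<And>L1 L2. (\<And>x. x \<in> L1 \<Longrightarrow> \<exists>y\<in>K1. dist x y < d) \<Longrightarrow>
      (\<And>x. x \<in> L2 \<Longrightarrow> \<exists>y\<in>K2. dist x y < d) \<Longrightarrow> split_link L1 L2"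
proof -
  obtain S :: "(real^3) set" where hom: "S homeomorphic sphere (0::real^3) 1"
    and disj: "S \<inter> (K1 \<union> K2) = {}"
    and sep: "\<And>x y. x \<in> K1 \<Longrightarrow> y \<in> K2 \<Longrightarrow> \<not> connected_component (- S) x y"
    using assms(1) unfolding split_link_def by blast
  have "compact S" using hom homeomorphic_compactness compact_sphere by blast
  then have "closed S" by (rule compact_imp_closed)
  moreover have "compact (K1 \<union> K2)" using assms by (intro compact_Un)
  ultimately obtain d where d: "d > 0" "\<And>x y. x \<in> K1 \<union> K2 \<Longrightarrow> y \<in> S \<Longrightarrow> d \<le> dist x y"
    using separate_compact_closed[of "K1 \<union> K2" S] disj by (metis inf_commute)
  have near: "x \<notin> S \<and> connected_component (- S) y x" if "y \<in> K1 \<union> K2" "dist x y < d" for x y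
  proof -
    have "ball y d \<subseteq> - S" using d(2)[OF that(1)] by (auto simp: not_less[symmetric])
    moreover have "x \<in> ball y d" "y \<in> ball y d" using that d(1) by (auto simp: dist_commute)
    ultimately show ?thesis unfolding connected_component_def
      using connected_ball[of y d] by blast
  qed
  show thesis
  proof
    fix L1 L2 assume L: "\<And>x. x \<in> L1 \<Longrightarrow> \<exists>y\<in>K1. dist x y < d" "\<And>x. x \<in> L2 \<Longrightarrow> \<exists>y\<in>K2. dist x y < d"
    show "split_link L1 L2" unfolding split_link_def
    proof (intro exI[of _ S] conjI ballI notI)
      show "S \<inter> (L1 \<union> L2) = {}"
      proof -
        have "x \<notin> S" if "x \<in> L1 \<union> L2" for x using that L near by blast
        then show ?thesis by blast
      qed
    next
      fix x y assume xy: "x \<in> L1" "y \<in> L2" "connected_component (- S) x y"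
      obtain x' y' where "x' \<in> K1" "dist x x' < d" "y' \<in> K2" "dist y y' < d" using L xy by blast
      then have "connected_component (- S) x' x" "connected_component (- S) y' y" using near by blast+
      then have "connected_component (- S) x' y'" using xy(3)
        by (meson connected_component_sym connected_component_trans)
      then show False using sep \<open>x' \<in> K1\<close> \<open>y' \<in> K2\<close> by blast
    qed (rule hom)
  qed (rule d(1))
qed

lemma split_link_translation:
  fixes K1 K2 :: "(real^3) set"
  assumes "split_link K1 K2"
  shows "split_link ((+) s ` K1) ((+) s ` K2)"
proof -
  obtain S :: "(real^3) set" where hom: "S homeomorphic sphere (0::real^3) 1"
    and disj: "S \<inter> (K1 \<union> K2) = {}"
    and sep: "\<And>x y. x \<in> K1 \<Longrightarrow> y \<in> K2 \<Longrightarrow> \<not> connected_component (- S) x y"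
    using assms(1) unfolding split_link_def by blast
  show ?thesis unfolding split_link_def
  proof (intro exI[of _ "(+) s ` S"] conjI ballI notI)
    show "(+) s ` S homeomorphic sphere (0::real^3) 1"
      using hom homeomorphic_translation homeomorphic_sym homeomorphic_trans by blast
    show "(+) s ` S \<inter> ((+) s ` K1 \<union> (+) s ` K2) = {}" using disj by auto
    fix x y assume "x \<in> (+) s ` K1" "y \<in> (+) s ` K2"
    then obtain x' y' where xy: "x = s + x'" "x' \<in> K1" "y = s + y'" "y' \<in> K2" by auto
    assume "connected_component (- (+) s ` S) x y"
    then obtain T where T: "connected T" "T \<subseteq> - (+) s ` S" "x \<in> T" "y \<in> T"
      unfolding connected_component_def by blast
    have "connected ((+) (- s) ` T)" using T(1)
      by (intro connected_continuous_image continuous_intros)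
    moreover have "(+) (- s) ` T \<subseteq> - S" using T(2) by force
    moreover have "x' \<in> (+) (- s) ` T" "y' \<in> (+) (- s) ` T" using T(3,4) xy by force+
    ultimately have "connected_component (- S) x' y'" unfolding connected_component_def by blast
    then show False using sep xy by blast
  qed
qed

text \<open>Exactly one strand is in front. At a crossing \<open>\<alpha>\<close> and
  \<open>\<beta>\<close> have opposite signs, as the third coordinates in
  \<open>det3_combination\<close> show, while their sum is nonzero; hence the sum agrees in sign
  with exactly one of them.\<close>

lemma ray_cross_pierces:
  assumes gp: "general_position V" and V: "p \<in> V" "q \<in> V" "a \<in> V" "b \<in> V" and d: "distinct [p, q, a, b]"
  shows "rc p q a b = of_bool (pierces p q a b) + of_bool (pierces a b p q)"
proof -
  define \<alpha> where "\<alpha> = det3 a b q - det3 a b p"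
  define \<beta> where "\<beta> = det3 p q b - det3 p q a"
  have "det3 (q - p) (a - p) (b - p) = \<alpha> + \<beta>" by (simp add: \<alpha>_def \<beta>_def det3_def algebra_simps)
  moreover have "det3 (q - p) (a - p) (b - p) \<noteq> 0" using gp V d unfolding general_position_def by blast
  ultimately have nz: "\<alpha> + \<beta> \<noteq> 0" by simp
  have pos: "p$3 > 0" "q$3 > 0" "a$3 > 0" "b$3 > 0" using gp V unfolding general_position_def by auto
  have P: "pierces p q a b \<longleftrightarrow> ray_cross p q a b \<and> (\<alpha> + \<beta>) * \<alpha> > 0"
    "pierces a b p q \<longleftrightarrow> ray_cross p q a b \<and> (\<alpha> + \<beta>) * \<beta> > 0"
    by (auto simp: pierces_def \<alpha>_def \<beta>_def ray_cross_sym(1)[of a b] add.commute)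
  show ?thesis
  proof (cases "ray_cross p q a b")
    case True
    then have r: "det3 p q a * det3 p q b < 0" "det3 a b p * det3 a b q < 0" by (auto simp: ray_cross_def)
    have third: "det3 a b q * p$3 - det3 a b p * q$3 = det3 p q a * b$3 - det3 p q b * a$3"
      using det3_combination[of a b q p] by (simp add: vec_eq_iff)
    have "\<alpha> * \<beta> < 0"
    proof -
      have "(det3 a b q > 0 \<and> det3 a b p < 0) \<or> (det3 a b q < 0 \<and> det3 a b p > 0)"
        using r(2) by (auto simp: mult_less_0_iff)
      then show ?thesis
      proof
        assume *: "det3 a b q > 0 \<and> det3 a b p < 0"
        have "det3 a b q * p$3 - det3 a b p * q$3 > 0"
          using mult_pos_pos[of "det3 a b q" "p$3"] mult_neg_pos[of "det3 a b p" "q$3"] * pos by linarith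
        moreover have "det3 p q a * b$3 < 0 \<and> det3 p q b * a$3 > 0" if "det3 p q a < 0"
          using that r(1) pos by (auto simp: mult_less_0_iff)
        ultimately have "\<not> det3 p q a < 0" using third by fastforce
        then have "\<beta> < 0" using r(1) by (auto simp: \<beta>_def mult_less_0_iff)
        moreover have "\<alpha> > 0" using * by (simp add: \<alpha>_def)
        ultimately show ?thesis by (simp add: mult_pos_neg)
      next
        assume *: "det3 a b q < 0 \<and> det3 a b p > 0"
        have "det3 a b q * p$3 - det3 a b p * q$3 < 0"
          using mult_neg_pos[of "det3 a b q" "p$3"] mult_pos_pos[of "det3 a b p" "q$3"] * pos by linarith
        moreover have "det3 p q a * b$3 > 0 \<and> det3 p q b * a$3 < 0" if "det3 p q a > 0"
          using that r(1) pos by (auto simp: mult_less_0_iff)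
        ultimately have "\<not> det3 p q a > 0" using third by fastforce
        then have "\<beta> > 0" using r(1) by (auto simp: \<beta>_def mult_less_0_iff)
        moreover have "\<alpha> < 0" using * by (simp add: \<alpha>_def)
        ultimately show ?thesis by (simp add: mult_neg_pos)
      qed
    qed
    then have "((\<alpha> + \<beta>) * \<alpha> > 0) \<noteq> ((\<alpha> + \<beta>) * \<beta> > 0)"
      using nz by (auto simp: mult_less_0_iff zero_less_mult_iff)
    then show ?thesis using P True by auto
  qed (simp add: P)
qed

lemma pierces_flip: "pierces q p a b = pierces p q a b" "pierces p q b a = pierces p q a b"
proof -
  have "det3 q p b = - det3 p q b" "det3 q p a = - det3 p q a" "det3 b a q = - det3 a b q" "det3 b a p = - det3 a b p"
    by (simp_all add: det3_def algebra_simps)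
  then show "pierces q p a b = pierces p q a b" "pierces p q b a = pierces p q a b"
    by (auto simp: pierces_def ray_cross_sym(2)[of q p] ray_cross_sym(3)[of p q b a] zero_less_mult_iff)
qed

section \<open>Graph edges and cycles as chains of segments\<close>

definition simple_graph :: "'a graph \<Rightarrow> bool" where
  "simple_graph G \<longleftrightarrow> finite (verts G) \<and>
     (\<forall>e\<in>edges G. \<exists>u v. e = {u, v} \<and> u \<noteq> v \<and> u \<in> verts G \<and> v \<in> verts G)"

definition consec :: "'v list \<Rightarrow> ('v \<times> 'v) list" where
  "consec xs = zip xs (tl xs)"

definition cyc_pairs :: "'v list \<Rightarrow> ('v \<times> 'v) list" where
  "cyc_pairs xs = zip xs (rotate1 xs)"

lemma mset_consec:
  assumes "xs \<noteq> []"
  shows "mset (map fst (consec xs)) + {#last xs#} = mset xs"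
    "mset (map snd (consec xs)) + {#hd xs#} = mset xs"
proof -
  have "map fst (consec xs) = butlast xs"
    unfolding consec_def by (simp add: map_fst_zip_take butlast_conv_take min.absorb2)
  moreover have "mset (butlast xs @ [last xs]) = mset xs" using assms by simp
  ultimately show "mset (map fst (consec xs)) + {#last xs#} = mset xs" by simp
  have "map snd (consec xs) = tl xs"
    unfolding consec_def by (simp add: map_snd_zip_take)
  then show "mset (map snd (consec xs)) + {#hd xs#} = mset xs" using assms by (cases xs) auto
qed

lemma set_consec_nth:
  assumes "(a, b) \<in> set (consec xs)"
  obtains k where "Suc k < length xs" "a = xs ! k" "b = xs ! Suc k"
proof -
  obtain k where "k < length (consec xs)" "consec xs ! k = (a, b)" using assms by (metis in_set_conv_nth)
  then show thesis using that[of k] by (auto simp: consec_def nth_tl)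
qed

lemma set_cyc_pairs_edges: "(\<lambda>(u, v). {u, v}) ` set (cyc_pairs vs) = cycle_edges vs"
proof -
  have "set (cyc_pairs vs) = {(vs ! i, vs ! (Suc i mod length vs)) | i. i < length vs}"
    unfolding cyc_pairs_def set_zip by (auto simp: nth_rotate1)
  then show ?thesis unfolding cycle_edges_def by auto
qed

lemma cyc_pairs_edge:
  assumes "is_cycle G vs" "(u, v) \<in> set (cyc_pairs vs)"
  shows "{u, v} \<in> edges G" "u \<in> set vs" "v \<in> set vs"
proof -
  obtain i where "i < length vs" "u = vs ! i" "v = rotate1 vs ! i"
    using assms(2) unfolding cyc_pairs_def set_zip by auto
  then show "{u, v} \<in> edges G" using assms(1) by (simp add: is_cycle_def nth_rotate1)
  show "u \<in> set vs" "v \<in> set vs"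
    using assms(2) set_zip_leftD set_zip_rightD unfolding cyc_pairs_def by fastforce+
qed

lemma closed_chain_cyc_pairs: "closed_chain (cyc_pairs vs)"
  unfolding closed_chain_def cyc_pairs_def by (cases vs) (simp_all add: map_fst_zip_take map_snd_zip_take)

lemma chain_image_concat: "chain_image (concat (map h ss)) = (\<Union>s\<in>set ss. chain_image (h s))"
  unfolding chain_image_def by auto

lemma finite_uniform_bound:
  fixes P :: "'b \<Rightarrow> real \<Rightarrow> bool"
  assumes "finite A" "\<And>a. a \<in> A \<Longrightarrow> \<exists>d>0. P a d" "\<And>a d d'. P a d \<Longrightarrow> 0 < d' \<Longrightarrow> d' \<le> d \<Longrightarrow> P a d'"
  shows "\<exists>d>0. \<forall>a\<in>A. P a d"
  using assms(1,2)
proof (induction rule: finite_induct)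
  case empty
  then show ?case by (intro exI[of _ 1]) auto
next
  case (insert x F)
  then obtain d where d: "d > 0" "\<forall>a\<in>F. P a d" by auto
  obtain d' where d': "d' > 0" "P x d'" using insert.prems by auto
  show ?case
    using d d' by (intro exI[of _ "min d d'"]) (auto intro: assms(3)[OF bspec[OF d(2)]] assms(3)[OF d'(2)])
qed

lemma path_subdivision:
  fixes g :: "real \<Rightarrow> real^3"
  assumes "path g" "\<eta> > 0"
  shows "\<exists>N\<ge>1::nat. \<forall>k<N. dist (g (real k / real N)) (g (real (Suc k) / real N)) < \<eta>"
proof -
  have "uniformly_continuous_on {0..1} g"
    using assms(1) unfolding path_def by (intro compact_uniformly_continuous) auto
  then obtain d where d: "d > 0" "\<And>x y. x \<in> {0..1} \<Longrightarrow> y \<in> {0..1} \<Longrightarrow> dist y x < d \<Longrightarrow> dist (g y) (g x) < \<eta>"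
    using assms(2) unfolding uniformly_continuous_on_def by meson
  obtain N :: nat where N: "N > 0" "1 / real N < d"
    using reals_Archimedean[OF d(1)] by (metis inverse_eq_divide zero_less_Suc)
  have "dist (g (real k / real N)) (g (real (Suc k) / real N)) < \<eta>" if "k < N" for k
  proof (rule d(2))
    show "dist (real k / real N) (real (Suc k) / real N) < d"
      using N by (simp add: dist_real_def abs_divide flip: diff_divide_distrib)
  qed (use that N in auto)
  then show ?thesis using N(1) by (intro exI[of _ N]) auto
qed

lemma simple_graph_finite_edges:
  assumes "simple_graph G" shows "finite (edges G)"
proof (rule finite_subset)
  show "edges G \<subseteq> (\<lambda>(u, v). {u, v}) ` (verts G \<times> verts G)"
    using assms unfolding simple_graph_def by fastforce
qed (use assms in \<open>auto simp: simple_graph_def\<close>)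

lemma finite_cycles:
  assumes "simple_graph G" shows "finite {vs. is_cycle G vs}"
proof (rule finite_subset)
  have f: "finite (verts G)" using assms by (simp add: simple_graph_def)
  show "{vs. is_cycle G vs} \<subseteq> {vs. set vs \<subseteq> verts G \<and> length vs \<le> card (verts G)}"
    using card_mono[OF f] by (auto simp: is_cycle_def) (metis distinct_card)
  show "finite {vs. set vs \<subseteq> verts G \<and> length vs \<le> card (verts G)}"
    by (rule finite_lists_length_le[OF f])
qed

text \<open>The multiset equation says that \<open>sg u v\<close> is a chain from
  \<open>pt u\<close> to \<open>pt v\<close>. The model keeps what the parity counts consume:
  positions, boundaries, disjointness of points, and the splitting of disjoint cycles.\<close>

definition polygonal_model ::
  "'a graph \<Rightarrow> (real^3) set \<Rightarrow> ('a \<Rightarrow> real^3) \<Rightarrow> ('a \<Rightarrow> 'a \<Rightarrow> ((real^3) \<times> (real^3)) list) \<Rightarrow> bool" where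
  "polygonal_model G V pt sg \<longleftrightarrow> general_position V \<and> inj_on pt (verts G) \<and> pt ` verts G \<subseteq> V \<and>
    (\<forall>u v. {u, v} \<in> edges G \<longrightarrow> chain_points (sg u v) \<subseteq> V \<and>
       mset (map fst (sg u v)) + {#pt v#} = mset (map snd (sg u v)) + {#pt u#} \<and>
       (\<forall>(a, b)\<in>set (sg u v). a \<noteq> b) \<and>
       sg v u = map prod.swap (sg u v) \<and>
       (\<forall>w\<in>verts G. w \<notin> {u, v} \<longrightarrow> pt w \<notin> chain_points (sg u v)) \<and>
       (\<forall>u' v'. {u', v'} \<in> edges G \<longrightarrow> {u, v} \<inter> {u', v'} = {} \<longrightarrow>
          chain_points (sg u v) \<inter> chain_points (sg u' v') = {})) \<and>
    (\<forall>C D. is_cycle G C \<longrightarrow> is_cycle G D \<longrightarrow> set C \<inter> set D = {} \<longrightarrow>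
       split_link (chain_image (concat (map (\<lambda>(u, v). sg u v) (cyc_pairs C))))
         (chain_image (concat (map (\<lambda>(u, v). sg u v) (cyc_pairs D)))))"

lemma tame_embedding_arc: "tame_embedding G p \<gamma> \<Longrightarrow> e \<in> edges G \<Longrightarrow> arc (\<gamma> e)"
  unfolding tame_embedding_def by auto

lemma tame_embedding_endpoints:
  assumes "simple_graph G" "tame_embedding G p \<gamma>" "e \<in> edges G"
  shows "\<exists>u v. e = {u, v} \<and> u \<noteq> v \<and> u \<in> verts G \<and> v \<in> verts G \<and> p u = pathstart (\<gamma> e) \<and> p v = pathfinish (\<gamma> e)"
proof -
  obtain a b where e: "e = {a, b}" "a \<noteq> b" "a \<in> verts G" "b \<in> verts G"
    using assms(1,3) unfolding simple_graph_def by blast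
  have "{pathstart (\<gamma> e), pathfinish (\<gamma> e)} = {p a, p b}"
    using assms(2,3) e(1) unfolding tame_embedding_def by auto
  then consider "p a = pathstart (\<gamma> e)" "p b = pathfinish (\<gamma> e)" | "p b = pathstart (\<gamma> e)" "p a = pathfinish (\<gamma> e)"
    by (metis doubleton_eq_iff)
  then show ?thesis
  proof cases
    case 1 then show ?thesis using e by blast
  next
    case 2 then show ?thesis using e by (metis insert_commute)
  qed
qed

lemma cycle_image_compact:
  assumes "is_cycle G C" "tame_embedding G p \<gamma>"
  shows "compact (cycle_image \<gamma> C)"
proof -
  have "compact (path_image (\<gamma> e))" if "e \<in> cycle_edges C" for e
  proof -
    have "e \<in> edges G" using that assms(1) unfolding cycle_edges_def is_cycle_def by auto
    then show ?thesis using assms(2) unfolding tame_embedding_def by (auto intro: compact_arc_image)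
  qed
  moreover have "finite (cycle_edges C)" unfolding cycle_edges_def by auto
  ultimately show ?thesis unfolding cycle_image_def by (intro compact_UN) auto
qed

text \<open>Each arc is subdivided finely, lifted into the upper half space, and its division points
  are perturbed. The polygons stay so close to the cycles that, after undoing the lift, the old
  spheres still separate them; \<open>\<delta>\<close> can be uniform because there are finitely
  many cycles.\<close>

lemma exists_polygonal_model:
  assumes G: "simple_graph G" and tame: "tame_embedding G p \<gamma>"
    and split: "\<And>C D. is_cycle G C \<Longrightarrow> is_cycle G D \<Longrightarrow> set C \<inter> set D = {} \<Longrightarrow>
      split_link (cycle_image \<gamma> C) (cycle_image \<gamma> D)"
  obtains V pt sg where "polygonal_model G V pt sg"
proof -
  define near :: "(real^3) set \<Rightarrow> (real^3) set \<Rightarrow> real \<Rightarrow> bool"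
    where "near L K d \<longleftrightarrow> (\<forall>x\<in>L. \<exists>y\<in>K. dist x y < d)" for L K d
  define CC where "CC = {(C, D). is_cycle G C \<and> is_cycle G D \<and> set C \<inter> set D = {}}"
  have "finite CC"
    by (rule finite_subset[of _ "{vs. is_cycle G vs} \<times> {vs. is_cycle G vs}"])
       (use finite_cycles[OF G] in \<open>auto simp: CC_def\<close>)
  then obtain \<delta> where \<delta>: "\<delta> > 0" "\<forall>z\<in>CC. \<forall>L1 L2. near L1 (cycle_image \<gamma> (fst z)) \<delta> \<longrightarrow>
     near L2 (cycle_image \<gamma> (snd z)) \<delta> \<longrightarrow> split_link L1 L2"
  proof (atomize_elim, intro finite_uniform_bound)
    fix z assume "z \<in> CC"
    then obtain C D where z: "z = (C, D)" "is_cycle G C" "is_cycle G D" "set C \<inter> set D = {}"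
      unfolding CC_def by auto
    obtain d where "d > 0" "\<And>L1 L2. (\<And>x. x \<in> L1 \<Longrightarrow> \<exists>y\<in>cycle_image \<gamma> C. dist x y < d) \<Longrightarrow>
      (\<And>x. x \<in> L2 \<Longrightarrow> \<exists>y\<in>cycle_image \<gamma> D. dist x y < d) \<Longrightarrow> split_link L1 L2"
      using split_link_disjoint_nearby[OF split[OF z(2-4)] cycle_image_compact[OF z(2) tame]
        cycle_image_compact[OF z(3) tame]] by metis
    then show "\<exists>d>0. \<forall>L1 L2. near L1 (cycle_image \<gamma> (fst z)) d \<longrightarrow>
       near L2 (cycle_image \<gamma> (snd z)) d \<longrightarrow> split_link L1 L2"
      unfolding near_def z(1) by auto
  next
    fix z :: "'a list \<times> 'a list" and d d' :: real
    assume *: "\<forall>L1 L2. near L1 (cycle_image \<gamma> (fst z)) d \<longrightarrow> near L2 (cycle_image \<gamma> (snd z)) d \<longrightarrow> split_link L1 L2"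
      and "d' \<le> d"
    then have "near L K d' \<Longrightarrow> near L K d" for L K unfolding near_def by (meson order_less_le_trans)
    then show "\<forall>L1 L2. near L1 (cycle_image \<gamma> (fst z)) d' \<longrightarrow> near L2 (cycle_image \<gamma> (snd z)) d' \<longrightarrow> split_link L1 L2"
      using * by blast
  qed
  \<comment> \<open>A quarter, because four errors add up in \<open>cnear\<close>: the perturbation
    of \<open>a'\<close>, and in the length of the segment to \<open>b'\<close> the perturbations of
    both ends and one subdivision step.\<close>
  define \<eta> where "\<eta> = \<delta> / 4"
  have \<eta>: "\<eta> > 0" using \<delta>(1) by (simp add: \<eta>_def)
  have "\<forall>e\<in>edges G. \<exists>N\<ge>1::nat. \<forall>k<N. dist (\<gamma> e (real k / real N)) (\<gamma> e (real (Suc k) / real N)) < \<eta>"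
  proof
    fix e assume "e \<in> edges G"
    then have "path (\<gamma> e)" by (intro arc_imp_path tame_embedding_arc[OF tame])
    then show "\<exists>N\<ge>1::nat. \<forall>k<N. dist (\<gamma> e (real k / real N)) (\<gamma> e (real (Suc k) / real N)) < \<eta>"
      using \<eta> by (rule path_subdivision)
  qed
  from bchoice[OF this] obtain N :: "'a set \<Rightarrow> nat" where N0: "\<forall>e\<in>edges G. N e \<ge> 1 \<and>
      (\<forall>k<N e. dist (\<gamma> e (real k / real (N e))) (\<gamma> e (real (Suc k) / real (N e))) < \<eta>)" by blast
  then have N: "\<And>e. e \<in> edges G \<Longrightarrow> N e \<ge> 1"
    "\<And>e k. e \<in> edges G \<Longrightarrow> k < N e \<Longrightarrow> dist (\<gamma> e (real k / real (N e))) (\<gamma> e (real (Suc k) / real (N e))) < \<eta>"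
    by blast+
  have "\<forall>e\<in>edges G. \<exists>z. e = {fst z, snd z} \<and> fst z \<noteq> snd z \<and> fst z \<in> verts G \<and> snd z \<in> verts G \<and>
       p (fst z) = pathstart (\<gamma> e) \<and> p (snd z) = pathfinish (\<gamma> e)"
  proof
    fix e assume "e \<in> edges G"
    from tame_embedding_endpoints[OF G tame this] obtain u v where "e = {u, v}" "u \<noteq> v" "u \<in> verts G" "v \<in> verts G"
      "p u = pathstart (\<gamma> e)" "p v = pathfinish (\<gamma> e)" by (elim exE conjE) (rule that)
    then show "\<exists>z. e = {fst z, snd z} \<and> fst z \<noteq> snd z \<and> fst z \<in> verts G \<and> snd z \<in> verts G \<and>
       p (fst z) = pathstart (\<gamma> e) \<and> p (snd z) = pathfinish (\<gamma> e)"
      by (intro exI[of _ "(u, v)"]) simp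
  qed
  from bchoice[OF this] obtain z where z: "\<forall>e\<in>edges G. e = {fst (z e), snd (z e)} \<and> fst (z e) \<noteq> snd (z e) \<and>
       fst (z e) \<in> verts G \<and> snd (z e) \<in> verts G \<and> p (fst (z e)) = pathstart (\<gamma> e) \<and> p (snd (z e)) = pathfinish (\<gamma> e)"
    by (elim exE) (rule that)
  \<comment> \<open>An edge is an unordered pair, but its arc has a direction; \<open>st\<close> and
    \<open>fi\<close> name the ends in the order in which the arc runs.\<close>
  define st where "st e = fst (z e)" for e
  define fi where "fi e = snd (z e)" for e
  have sf: "e = {st e, fi e}" "st e \<noteq> fi e" "st e \<in> verts G" "fi e \<in> verts G" "p (st e) = \<gamma> e 0" "p (fi e) = \<gamma> e 1"
    if "e \<in> edges G" for e
    using bspec[OF z that] unfolding st_def fi_def pathstart_def pathfinish_def by blast+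
  have sfin: "st e \<in> e" "fi e \<in> e" if "e \<in> edges G" for e
  proof -
    have "st e \<in> {st e, fi e}" "fi e \<in> {st e, fi e}" by simp_all
    moreover have "{st e, fi e} = e" using sf(1)[OF that] by (rule sym)
    ultimately show "st e \<in> e" "fi e \<in> e" by (simp_all only:)
  qed
  \<comment> \<open>Names of the points of the polygons. Division points 0 and \<open>N e\<close>
    are not among the \<open>Inr\<close> names: they are the vertices, shared by all their
    edges.\<close>
  define I :: "('a + 'a set \<times> nat) set" where
    "I = Inl ` verts G \<union> Inr ` (SIGMA e:edges G. {1..<N e})"
  define c0 where "c0 i = (case i of Inl v \<Rightarrow> p v | Inr (e, k) \<Rightarrow> \<gamma> e (real k / real (N e)))" for i
  have finI: "finite I" unfolding I_def using G simple_graph_finite_edges[OF G] by (auto simp: simple_graph_def)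
  \<comment> \<open>The lift is high enough that a perturbation by less than \<open>\<eta>\<close>
    leaves every point above height 0.\<close>
  define s :: "real^3" where "s = axis 3 ((\<Sum>i\<in>I. \<bar>c0 i $ 3\<bar>) + \<eta> + 1)"
  have s3: "(s + c0 i) $ 3 > \<eta>" if "i \<in> I" for i
  proof -
    have "\<bar>c0 i $ 3\<bar> \<le> (\<Sum>i\<in>I. \<bar>c0 i $ 3\<bar>)" using that finI by (intro member_le_sum) auto
    then show ?thesis by (simp add: s_def axis_def)
  qed
  obtain c where c: "inj_on c I" "\<And>i. i \<in> I \<Longrightarrow> dist (c i) (s + c0 i) < \<eta>"
    "\<And>i j k. {i, j, k} \<subseteq> I \<Longrightarrow> distinct [i, j, k] \<Longrightarrow> det3 (c i) (c j) (c k) \<noteq> 0"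
    "\<And>i j k l. {i, j, k, l} \<subseteq> I \<Longrightarrow> distinct [i, j, k, l] \<Longrightarrow>
        det3 (c j - c i) (c k - c i) (c l - c i) \<noteq> 0"
    using perturb_general_position[OF finI \<eta>, of "\<lambda>i. s + c0 i"] by metis
  define V where "V = c ` I"
  have gp: "general_position V"
  proof -
    have "c i $ 3 > 0" if "i \<in> I" for i
      using s3[OF that] c(2)[OF that] component_le_norm_cart[of "c i - (s + c0 i)" 3] by (simp add: dist_norm)
    moreover have "det3 (c i) (c j) (c k) \<noteq> 0" if "i \<in> I" "j \<in> I" "k \<in> I" "distinct [c i, c j, c k]" for i j k
      using c(3)[of i j k] that by auto
    moreover have "det3 (c j - c i) (c k - c i) (c l - c i) \<noteq> 0"
      if "i \<in> I" "j \<in> I" "k \<in> I" "l \<in> I" "distinct [c i, c j, c k, c l]" for i j k l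
      using c(4)[of i j k l] that by auto
    ultimately show ?thesis unfolding general_position_def V_def by blast
  qed
  define idx where "idx e = Inl (st e) # map (\<lambda>k. Inr (e, k)) [1..<N e] @ [Inl (fi e)]" for e
  have idx_set: "set (idx e) = {Inl (st e), Inl (fi e)} \<union> Inr ` ({e} \<times> {1..<N e})" for e
    unfolding idx_def by auto
  have idxI: "set (idx e) \<subseteq> I" if "e \<in> edges G" for e
    using sf[OF that] that unfolding idx_set I_def by auto
  have idxd: "distinct (idx e)" if "e \<in> edges G" for e
    using sf(2)[OF that] unfolding idx_def by (auto simp: distinct_map inj_on_def)
  have idxl: "length (idx e) = Suc (N e)" if "e \<in> edges G" for e
    using N(1)[OF that] unfolding idx_def by simp
  have idxc: "c0 (idx e ! k) = \<gamma> e (real k / real (N e))" if "e \<in> edges G" "k \<le> N e" for e k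
  proof -
    have "k \<le> N e" by (rule that(2))
    then consider (1) "k = 0" | (2) "0 < k \<and> k < N e" | (3) "k = N e \<and> k > 0" by linarith
    then show ?thesis
    proof cases
      case 1 then show ?thesis using sf[OF that(1)] by (simp add: idx_def c0_def)
    next
      case 2 then show ?thesis by (auto simp: idx_def c0_def nth_Cons' nth_append)
    next
      case 3 then show ?thesis using sf[OF that(1)] N(1)[OF that(1)] by (auto simp: idx_def c0_def nth_Cons' nth_append)
    qed
  qed
  define sgi where "sgi u v = (if st {u, v} = u then consec (idx {u, v}) else map prod.swap (consec (idx {u, v})))" for u v
  define sg where "sg u v = map (map_prod c c) (sgi u v)" for u v
  define pt where "pt v = c (Inl v)" for v
  have sgi_set: "a \<in> set (idx {u, v}) \<and> b \<in> set (idx {u, v}) \<and> a \<noteq> b \<and>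
      (\<exists>k<N {u, v}. {a, b} = {idx {u, v} ! k, idx {u, v} ! Suc k})"
    if uv: "{u, v} \<in> edges G" and ab: "(a, b) \<in> set (sgi u v)" for u v a b
  proof -
    have "(a, b) \<in> set (consec (idx {u, v})) \<or> (b, a) \<in> set (consec (idx {u, v}))"
      using ab unfolding sgi_def by (auto split: if_splits)
    then obtain k where k: "Suc k < length (idx {u, v})" "{a, b} = {idx {u, v} ! k, idx {u, v} ! Suc k}"
      by (elim disjE; elim set_consec_nth) auto
    have "idx {u, v} ! k \<noteq> idx {u, v} ! Suc k"
      using k(1) idxd[OF uv] by (simp add: nth_eq_iff_index_eq)
    moreover have "idx {u, v} ! k \<in> set (idx {u, v})" "idx {u, v} ! Suc k \<in> set (idx {u, v})" using k(1) by auto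
    ultimately show ?thesis using k idxl[OF uv] by (auto simp: doubleton_eq_iff intro!: exI[of _ k])
  qed
  have cp: "chain_points (sg u v) \<subseteq> c ` set (idx {u, v})" if "{u, v} \<in> edges G" for u v
    using sgi_set[OF that] unfolding sg_def chain_points_def by fastforce
  have cnear: "\<exists>y\<in>path_image (\<gamma> {u, v}). dist x (s + y) < \<delta>"
    if uv: "{u, v} \<in> edges G" and x: "x \<in> chain_image (sg u v)" for u v x
  proof -
    obtain a b where ab: "(a, b) \<in> set (sgi u v)" "x \<in> closed_segment (c a) (c b)"
      using x unfolding chain_image_def sg_def by auto
    let ?e = "{u, v}"
    obtain k where k: "k < N ?e" "{a, b} = {idx ?e ! k, idx ?e ! Suc k}" using sgi_set[OF uv ab(1)] by blast
    define a' where "a' = idx ?e ! k"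
    define b' where "b' = idx ?e ! Suc k"
    have seg: "x \<in> closed_segment (c a') (c b')"
      using ab(2) k(2) unfolding a'_def b'_def by (auto simp: doubleton_eq_iff closed_segment_commute)
    have I': "a' \<in> I" "b' \<in> I" using idxI[OF uv] idxl[OF uv] k(1) unfolding a'_def b'_def by (auto intro!: subsetD[OF idxI[OF uv]])
    have ca: "c0 a' = \<gamma> ?e (real k / real (N ?e))" "c0 b' = \<gamma> ?e (real (Suc k) / real (N ?e))"
      unfolding a'_def b'_def using idxc[OF uv] k(1) by auto
    have "dist (s + c0 a') (s + c0 b') < \<eta>" unfolding ca using N(2)[OF uv k(1)] by (simp add: dist_norm)
    moreover have "dist x (c a') \<le> dist (c a') (c b')"
      using segment_bound(1)[OF seg] by (simp add: dist_norm norm_minus_commute)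
    moreover have "dist x (s + c0 a') \<le> dist x (c a') + dist (c a') (s + c0 a')" by (rule dist_triangle)
    moreover have "dist (c a') (c b') \<le> dist (c a') (s + c0 a') + dist (s + c0 a') (s + c0 b') + dist (c b') (s + c0 b')"
      by (smt (verit) dist_triangle dist_commute)
    ultimately have "dist x (s + c0 a') < \<delta>" using c(2)[OF I'(1)] c(2)[OF I'(2)] unfolding \<eta>_def by linarith
    moreover have "c0 a' \<in> path_image (\<gamma> ?e)" unfolding ca path_image_def using k(1) by auto
    ultimately show ?thesis by blast
  qed
  have "polygonal_model G V pt sg"
    unfolding polygonal_model_def
  proof (intro conjI allI impI)
    show "general_position V" by (rule gp)
    show "inj_on pt (verts G)"
      using c(1) unfolding pt_def I_def inj_on_def by auto
    show "pt ` verts G \<subseteq> V" unfolding pt_def V_def I_def by auto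
  next
    fix u v assume uv: "{u, v} \<in> edges G"
    let ?e = "{u, v}"
    have uvd: "(st ?e = u \<and> fi ?e = v) \<or> (st ?e = v \<and> fi ?e = u)" "u \<noteq> v"
      using sf(1,2)[OF uv] by (auto simp: doubleton_eq_iff)
    show "chain_points (sg u v) \<subseteq> V" using cp[OF uv] idxI[OF uv] unfolding V_def by auto
    show "mset (map fst (sg u v)) + {#pt v#} = mset (map snd (sg u v)) + {#pt u#}"
    proof -
      have ne: "idx ?e \<noteq> []" "hd (idx ?e) = Inl (st ?e)" "last (idx ?e) = Inl (fi ?e)" by (auto simp: idx_def)
      have m: "mset (map fst (consec (idx ?e))) + {#Inl (fi ?e)#} = mset (map snd (consec (idx ?e))) + {#Inl (st ?e)#}"
        using mset_consec[OF ne(1)] ne(2,3) by simp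
      have "mset (map fst (sgi u v)) + {#Inl v#} = mset (map snd (sgi u v)) + {#Inl u#}"
        using m uvd unfolding sgi_def by (auto simp: comp_def multiset.map_comp)
      then have "image_mset c (mset (map fst (sgi u v)) + {#Inl v#}) = image_mset c (mset (map snd (sgi u v)) + {#Inl u#})"
        by simp
      then show ?thesis unfolding sg_def pt_def by (simp add: comp_def multiset.map_comp)
    qed
    show "\<forall>(a, b)\<in>set (sg u v). a \<noteq> b"
    proof clarify
      fix b assume "(b, b) \<in> set (sg u v)"
      then obtain i j where ij: "(i, j) \<in> set (sgi u v)" "c i = c j" unfolding sg_def by auto
      then have "i \<in> I" "j \<in> I" "i \<noteq> j" using sgi_set[OF uv ij(1)] idxI[OF uv] by auto
      then show False using c(1) ij(2) by (auto simp: inj_on_def)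
    qed
    show "sg v u = map prod.swap (sg u v)"
      using uvd unfolding sg_def sgi_def insert_commute[of v u] by (auto simp: comp_def)
    have Iinj: "i = j" if "c i = c j" "i \<in> I" "j \<in> I" for i j using c(1) that by (auto simp: inj_on_def)
    show "\<forall>w\<in>verts G. w \<notin> {u, v} \<longrightarrow> pt w \<notin> chain_points (sg u v)"
    proof (intro ballI impI notI)
      fix w assume w: "w \<in> verts G" "w \<notin> {u, v}" "pt w \<in> chain_points (sg u v)"
      then obtain i where "i \<in> set (idx ?e)" "c (Inl w) = c i" using cp[OF uv] unfolding pt_def by blast
      then have "Inl w \<in> set (idx ?e)" using Iinj[of "Inl w" i] idxI[OF uv] w(1) by (auto simp: I_def)
      then show False using w(2) uvd(1) by (auto simp: idx_set)
    qed
    fix u' v' assume uv': "{u', v'} \<in> edges G" and dis: "{u, v} \<inter> {u', v'} = {}"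
    have "set (idx {u, v}) \<inter> set (idx {u', v'}) = {}"
    proof -
      note sfin[OF uv] sfin[OF uv']
      moreover have "?e \<noteq> {u', v'}" using dis by auto
      ultimately show ?thesis using dis unfolding idx_set by auto
    qed
    then have "c ` set (idx {u, v}) \<inter> c ` set (idx {u', v'}) = {}"
      using inj_on_image_Int[OF c(1) idxI[OF uv] idxI[OF uv']] by simp
    then show "chain_points (sg u v) \<inter> chain_points (sg u' v') = {}"
      using cp[OF uv] cp[OF uv'] by blast
  next
    fix C D assume CD: "is_cycle G C" "is_cycle G D" "set C \<inter> set D = {}"
    let ?im = "\<lambda>C. chain_image (concat (map (\<lambda>(u, v). sg u v) (cyc_pairs C)))"
    have "near ((+) (- s) ` ?im C) (cycle_image \<gamma> C) \<delta>" if C: "is_cycle G C" for C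
      unfolding near_def
    proof clarify
      fix x assume "x \<in> ?im C"
      then obtain u v where uv: "(u, v) \<in> set (cyc_pairs C)" "x \<in> chain_image (sg u v)"
        unfolding chain_image_concat by auto
      then obtain y where y: "y \<in> path_image (\<gamma> {u, v})" "dist x (s + y) < \<delta>"
        using cnear[OF cyc_pairs_edge(1)[OF C]] by blast
      have "{u, v} \<in> cycle_edges C" using uv(1) unfolding set_cyc_pairs_edges[symmetric] by force
      then have "y \<in> cycle_image \<gamma> C" using y(1) unfolding cycle_image_def by blast
      moreover have "dist (- s + x) y < \<delta>" using y(2) by (simp add: dist_norm algebra_simps)
      ultimately show "\<exists>y\<in>cycle_image \<gamma> C. dist (- s + x) y < \<delta>" by blast
    qed
    then have "near ((+) (- s) ` ?im C) (cycle_image \<gamma> (fst (C, D))) \<delta>"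
      "near ((+) (- s) ` ?im D) (cycle_image \<gamma> (snd (C, D))) \<delta>" using CD by simp_all
    moreover have "(C, D) \<in> CC" using CD by (simp add: CC_def)
    ultimately have "split_link ((+) (- s) ` ?im C) ((+) (- s) ` ?im D)"
      using \<delta>(2) by blast
    then have "split_link ((+) s ` (+) (- s) ` ?im C) ((+) s ` (+) (- s) ` ?im D)"
      by (rule split_link_translation)
    then show "split_link (?im C) (?im D)" by (simp add: image_image)
  qed
  then show thesis by (rule that)
qed

section \<open>Transfer of the parity laws to the edges of the graph\<close>

definition pair_sum :: "('v \<Rightarrow> 'w \<Rightarrow> bit) \<Rightarrow> 'v list \<Rightarrow> 'w list \<Rightarrow> bit" where
  "pair_sum x ss tt = (\<Sum>s\<leftarrow>ss. \<Sum>t\<leftarrow>tt. x s t)"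

lemma sum_list_concat_map: "(\<Sum>s\<leftarrow>concat (map h ss). f s) = (\<Sum>s\<leftarrow>ss. \<Sum>t\<leftarrow>h s. f t :: 'b::comm_monoid_add)"
  by (induction ss) auto

lemma chain_points_concat: "chain_points (concat (map h ss)) = (\<Union>s\<in>set ss. chain_points (h s))"
  unfolding chain_points_def by auto

lemma mset_concat_boundary:
  assumes "\<And>u v. (u, v) \<in> set ss \<Longrightarrow> mset (map fst (h (u, v))) + {#f v#} = mset (map snd (h (u, v))) + {#f u#}"
  shows "mset (map fst (concat (map h ss))) + image_mset f (mset (map snd ss))
     = mset (map snd (concat (map h ss))) + image_mset f (mset (map fst ss))"
  using assms
proof (induction ss)
  case (Cons s ss)
  obtain u v where s: "s = (u, v)" by fastforce
  have "mset (map fst (h s)) + {#f v#} = mset (map snd (h s)) + {#f u#}" using Cons.prems[of u v] s by simp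
  moreover have "mset (map fst (concat (map h ss))) + image_mset f (mset (map snd ss))
     = mset (map snd (concat (map h ss))) + image_mset f (mset (map fst ss))" using Cons by simp
  ultimately have "(mset (map fst (h s)) + {#f v#}) + (mset (map fst (concat (map h ss))) + image_mset f (mset (map snd ss)))
    = (mset (map snd (h s)) + {#f u#}) + (mset (map snd (concat (map h ss))) + image_mset f (mset (map fst ss)))"
    by simp
  then show ?case using s by (simp add: ac_simps)
qed simp

lemma mod2_boundary_of_mset:
  assumes "mset (map fst ss) + {#b#} = mset (map snd ss) + {#a#}"
  shows "mod2_boundary ss \<phi> = \<phi> a + \<phi> b"
proof -
  have "sum_mset (image_mset \<phi> (mset (map fst ss) + {#b#})) = sum_mset (image_mset \<phi> (mset (map snd ss) + {#a#}))"
    using assms by simp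
  then have *: "(\<Sum>s\<leftarrow>ss. \<phi> (fst s)) + \<phi> b = (\<Sum>s\<leftarrow>ss. \<phi> (snd s)) + \<phi> a"
    by (simp add: sum_mset_sum_list multiset.map_comp comp_def ac_simps flip: mset_map)
  have "mod2_boundary ss \<phi> = (\<Sum>s\<leftarrow>ss. \<phi> (fst s)) + (\<Sum>s\<leftarrow>ss. \<phi> (snd s))"
    by (simp add: mod2_boundary_def case_prod_unfold sum_list_addf)
  then show ?thesis using * by (cases "\<phi> b"; cases "\<phi> a"; cases "(\<Sum>s\<leftarrow>ss. \<phi> (snd s))"; cases "(\<Sum>s\<leftarrow>ss. \<phi> (fst s))") auto
qed

lemma mod2_boundary_concat:
  assumes "\<And>u v. (u, v) \<in> set ss \<Longrightarrow> mod2_boundary (h (u, v)) \<phi> = \<phi> (f u) + \<phi> (f v)"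
  shows "mod2_boundary (concat (map h ss)) \<phi> = mod2_boundary ss (\<lambda>v. \<phi> (f v))"
  using assms
proof (induction ss)
  case (Cons s ss)
  then show ?case by (cases s) (simp add: mod2_boundary_def)
qed (simp add: mod2_boundary_def)

text \<open>A subdivided K5 in \<open>G\<close> with branch vertices \<open>b i\<close>. Its paths
  are lists of edges with the right boundary modulo 2, so their order along the path need not be
  specified.\<close>

definition K5_model :: "'a graph \<Rightarrow> (nat \<Rightarrow> 'a) \<Rightarrow> (nat \<Rightarrow> nat \<Rightarrow> ('a \<times> 'a) list) \<Rightarrow> bool" where
  "K5_model G b q \<longleftrightarrow> inj_on b {..<5} \<and> b ` {..<5} \<subseteq> verts G \<and>
     (\<forall>i j. i < j \<longrightarrow> j < 5 \<longrightarrow> (\<forall>(u, v)\<in>set (q i j). {u, v} \<in> edges G) \<and>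
        (\<forall>\<phi>. mod2_boundary (q i j) \<phi> = \<phi> (b i) + \<phi> (b j)) \<and>
        (\<forall>k l. k < l \<longrightarrow> l < 5 \<longrightarrow> {i, j} \<inter> {k, l} = {} \<longrightarrow> chain_points (q i j) \<inter> chain_points (q k l) = {}) \<and>
        (\<forall>k<5. k \<notin> {i, j} \<longrightarrow> b k \<notin> chain_points (q i j)))"

text \<open>A putative unlinked embedding is condensed into the bit \<open>x (u, v) (u', v')\<close> counting, modulo 2,
  how often the edge \<open>uv\<close> passes in front of the edge \<open>u'v'\<close> when seen from the origin.\<close>
lemma unlinked_crossing_data:
  fixes G :: "'a graph"
  assumes G: "simple_graph G" and nl: "\<not> intrinsically_linked G"
  obtains x :: "'a \<times> 'a \<Rightarrow> 'a \<times> 'a \<Rightarrow> bit" where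
    "\<And>u v t. {u, v} \<in> edges G \<Longrightarrow> x (v, u) t = x (u, v) t"
    "\<And>u v s. {u, v} \<in> edges G \<Longrightarrow> x s (v, u) = x s (u, v)"
    "\<And>C D. is_cycle G C \<Longrightarrow> is_cycle G D \<Longrightarrow> set C \<inter> set D = {} \<Longrightarrow>
       pair_sum x (cyc_pairs C) (cyc_pairs D) = 0"
    "\<And>b q. K5_model G b q \<Longrightarrow>
       K5_sum (\<lambda>i j k l. pair_sum x (q i j) (q k l) + pair_sum x (q k l) (q i j)) = 1"
proof -
  obtain p \<gamma> where tame: "tame_embedding G p \<gamma>"
    and split: "\<And>C D. is_cycle G C \<Longrightarrow> is_cycle G D \<Longrightarrow> set C \<inter> set D = {} \<Longrightarrow>
      split_link (cycle_image \<gamma> C) (cycle_image \<gamma> D)"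
    using nl unfolding intrinsically_linked_def by blast
  obtain V pt sg where "polygonal_model G V pt sg"
    using exists_polygonal_model[OF G tame split] by blast
  note pm = this[unfolded polygonal_model_def]
  note gp = pm[THEN conjunct1]
  note pti = pm[THEN conjunct2, THEN conjunct1]
  note ptV = pm[THEN conjunct2, THEN conjunct2, THEN conjunct1]
  note edge = pm[THEN conjunct2, THEN conjunct2, THEN conjunct2, THEN conjunct1, rule_format]
  note sgl = pm[THEN conjunct2, THEN conjunct2, THEN conjunct2, THEN conjunct2, rule_format]
  note sgV = edge[THEN conjunct1]
  note sgb = edge[THEN conjunct2, THEN conjunct1]
  have sgp: "a \<noteq> b" if "{u, v} \<in> edges G" "(a, b) \<in> set (sg u v)" for u v a b
    using edge[OF that(1), THEN conjunct2, THEN conjunct2, THEN conjunct1] that(2) by fast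
  note sgs = edge[THEN conjunct2, THEN conjunct2, THEN conjunct2, THEN conjunct1]
  note sgw = edge[THEN conjunct2, THEN conjunct2, THEN conjunct2, THEN conjunct2, THEN conjunct1, rule_format]
  note sgd = edge[THEN conjunct2, THEN conjunct2, THEN conjunct2, THEN conjunct2, THEN conjunct2, rule_format]
  have rg: "radially_generic V" using gp unfolding general_position_def radially_generic_def by blast
  define h where "h = (\<lambda>(u, v). sg u v)"
  define X where "X s t = (\<Sum>(p, q)\<leftarrow>h s. \<Sum>(a, b)\<leftarrow>h t. of_bool (pierces p q a b) :: bit)" for s t
  define ex where "ex ss = concat (map h ss)" for ss
  have Xex: "(\<Sum>(p, q)\<leftarrow>ex ss. \<Sum>(a, b)\<leftarrow>ex tt. of_bool (pierces p q a b) :: bit) = pair_sum X ss tt" for ss tt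
  proof -
    have "(\<Sum>(p, q)\<leftarrow>ex ss. \<Sum>(a, b)\<leftarrow>ex tt. of_bool (pierces p q a b) :: bit) =
      (\<Sum>s\<leftarrow>ss. \<Sum>(p, q)\<leftarrow>h s. \<Sum>t\<leftarrow>tt. \<Sum>(a, b)\<leftarrow>h t. of_bool (pierces p q a b))"
      unfolding ex_def by (simp add: sum_list_concat_map)
    also have "\<dots> = (\<Sum>s\<leftarrow>ss. \<Sum>t\<leftarrow>tt. \<Sum>(p, q)\<leftarrow>h s. \<Sum>(a, b)\<leftarrow>h t. of_bool (pierces p q a b))"
      unfolding case_prod_unfold
      by (intro arg_cong[where f = sum_list] map_cong refl sum_list_swap)
    finally show ?thesis by (simp add: pair_sum_def X_def)
  qed
  have edge_ex: "chain_points (ex ss) \<subseteq> V" "\<And>a b. (a, b) \<in> set (ex ss) \<Longrightarrow> a \<noteq> b"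
    if "\<And>u v. (u, v) \<in> set ss \<Longrightarrow> {u, v} \<in> edges G" for ss
  proof -
    show "chain_points (ex ss) \<subseteq> V"
      unfolding ex_def chain_points_concat h_def using that sgV by fastforce
    show "a \<noteq> b" if "(a, b) \<in> set (ex ss)" for a b
      using that sgp \<open>\<And>u v. (u, v) \<in> set ss \<Longrightarrow> {u, v} \<in> edges G\<close> unfolding ex_def h_def by fastforce
  qed
  have dis_ex: "chain_points (ex ss) \<inter> chain_points (ex tt) = {}"
    if ess: "\<And>u v. (u, v) \<in> set ss \<Longrightarrow> {u, v} \<in> edges G"
      and ett: "\<And>u v. (u, v) \<in> set tt \<Longrightarrow> {u, v} \<in> edges G"
      and dis: "chain_points ss \<inter> chain_points tt = {}" for ss tt
  proof -
    have "chain_points (h s) \<inter> chain_points (h t) = {}" if s: "s \<in> set ss" and t: "t \<in> set tt" for s t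
    proof -
      obtain u v where uv: "s = (u, v)" by fastforce
      obtain u' v' where uv': "t = (u', v')" by fastforce
      have "u \<in> chain_points ss" "v \<in> chain_points ss" "u' \<in> chain_points tt" "v' \<in> chain_points tt"
        using s t unfolding uv uv' chain_points_def by force+
      then have "{u, v} \<inter> {u', v'} = {}" using dis by blast
      then show ?thesis
        using sgd[OF ess ett] s t unfolding uv uv' h_def by simp
    qed
    then show ?thesis unfolding ex_def chain_points_concat by blast
  qed
  show thesis
  proof (rule that[of X])
    show "X (v, u) t = X (u, v) t" if "{u, v} \<in> edges G" for u v t
      unfolding X_def h_def using sgs[OF that] by (simp add: case_prod_unfold pierces_flip comp_def)
    show "X s (v, u) = X s (u, v)" if "{u, v} \<in> edges G" for u v s
      unfolding X_def h_def using sgs[OF that] by (simp add: case_prod_unfold pierces_flip comp_def)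
  next
    fix C D assume CD: "is_cycle G C" "is_cycle G D" "set C \<inter> set D = {}"
    note ed = cyc_pairs_edge(1)[OF CD(1)] cyc_pairs_edge(1)[OF CD(2)]
    have cc: "closed_chain (ex (cyc_pairs C))" if C: "is_cycle G C" for C
    proof -
      have "mset (map fst (ex (cyc_pairs C))) + image_mset pt (mset (map snd (cyc_pairs C)))
        = mset (map snd (ex (cyc_pairs C))) + image_mset pt (mset (map fst (cyc_pairs C)))"
        unfolding ex_def
        by (rule mset_concat_boundary, unfold h_def prod.case, rule sgb[OF cyc_pairs_edge(1)[OF C]])
      then show ?thesis using closed_chain_cyc_pairs[of C] unfolding closed_chain_def by simp
    qed
    have cp: "chain_points (cyc_pairs C) \<subseteq> set C" if "is_cycle G C" for C
      using cyc_pairs_edge(2,3)[OF that] unfolding chain_points_def by fastforce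
    have dis: "chain_points (cyc_pairs C) \<inter> chain_points (cyc_pairs D) = {}"
      using cp[OF CD(1)] cp[OF CD(2)] CD(3) by blast
    have "(\<Sum>(p, q)\<leftarrow>ex (cyc_pairs C). \<Sum>(a, b)\<leftarrow>ex (cyc_pairs D). of_bool (pierces p q a b) :: bit) = 0"
    proof (rule split_link_even)
      show "split_link (chain_image (ex (cyc_pairs C))) (chain_image (ex (cyc_pairs D)))"
        using sgl[OF CD] unfolding ex_def h_def .
      show "closed_chain (ex (cyc_pairs C))" "closed_chain (ex (cyc_pairs D))" using cc CD by blast+
      show "general_position (chain_points (ex (cyc_pairs C)) \<union> chain_points (ex (cyc_pairs D)))"
        using gp edge_ex(1)[OF ed(1)] edge_ex(1)[OF ed(2)] unfolding general_position_def by blast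
      show "chain_points (ex (cyc_pairs C)) \<inter> chain_points (ex (cyc_pairs D)) = {}"
        by (rule dis_ex[OF ed dis])
    qed (use edge_ex(2)[OF ed(1)] edge_ex(2)[OF ed(2)] in blast)+
    then show "pair_sum X (cyc_pairs C) (cyc_pairs D) = 0" unfolding Xex .
  next
    fix b :: "nat \<Rightarrow> 'a" and q
    assume model: "K5_model G b q"
    have b: "inj_on b {..<5}" "b ` {..<5} \<subseteq> verts G"
      using model by (simp_all add: K5_model_def)
    have qe: "{u, v} \<in> edges G" if "i < j" "j < 5" "(u, v) \<in> set (q i j)" for i j u v
    proof -
      have "\<forall>(u, v)\<in>set (q i j). {u, v} \<in> edges G" using model that(1,2) by (simp add: K5_model_def)
      then show ?thesis using that(3) by fast
    qed
    have qb: "mod2_boundary (q i j) \<phi> = \<phi> (b i) + \<phi> (b j)" if "i < j" "j < 5" for i j \<phi>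
      using model that by (simp add: K5_model_def)
    have qd: "chain_points (q i j) \<inter> chain_points (q k l) = {}"
      if "i < j" "j < 5" "k < l" "l < 5" "{i, j} \<inter> {k, l} = {}" for i j k l
      using model that by (simp add: K5_model_def)
    have qw: "b k \<notin> chain_points (q i j)" if "i < j" "j < 5" "k < 5" "k \<notin> {i, j}" for i j k
      using model that by (simp add: K5_model_def)
    define Q where "Q i j = ex (q i j)" for i j
    \<comment> \<open>The symmetric crossing number is the sum of the two asymmetric front
      counts.\<close>
    have vk: "crossings (Q i j) (Q k l) = pair_sum X (q i j) (q k l) + pair_sum X (q k l) (q i j)"
      if ijkl: "i < j" "j < 5" "k < l" "l < 5" "{i, j} \<inter> {k, l} = {}" for i j k l
    proof -
      have "rc (fst s) (snd s) (fst t) (snd t) = of_bool (pierces (fst s) (snd s) (fst t) (snd t)) +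
          of_bool (pierces (fst t) (snd t) (fst s) (snd s))" if st: "s \<in> set (Q i j)" "t \<in> set (Q k l)" for s t
      proof (rule ray_cross_pierces[OF gp])
        have m: "fst s \<in> chain_points (Q i j)" "snd s \<in> chain_points (Q i j)"
          "fst t \<in> chain_points (Q k l)" "snd t \<in> chain_points (Q k l)" using st unfolding chain_points_def by auto
        moreover have sub: "chain_points (Q i j) \<subseteq> V" "chain_points (Q k l) \<subseteq> V"
          unfolding Q_def using edge_ex(1) qe ijkl by blast+
        ultimately show "fst s \<in> V" "snd s \<in> V" "fst t \<in> V" "snd t \<in> V" by auto
        have "chain_points (Q i j) \<inter> chain_points (Q k l) = {}"
          unfolding Q_def by (rule dis_ex) (use qe ijkl qd in blast)+
        moreover have "fst s \<noteq> snd s" using edge_ex(2)[of "q i j" "fst s" "snd s"] qe ijkl st unfolding Q_def by auto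
        moreover have "fst t \<noteq> snd t" using edge_ex(2)[of "q k l" "fst t" "snd t"] qe ijkl st unfolding Q_def by auto
        ultimately show "distinct [fst s, snd s, fst t, snd t]" using m by auto
      qed
      then have "crossings (Q i j) (Q k l) = (\<Sum>s\<leftarrow>Q i j. \<Sum>t\<leftarrow>Q k l.
          of_bool (pierces (fst s) (snd s) (fst t) (snd t)) + of_bool (pierces (fst t) (snd t) (fst s) (snd s)))"
        unfolding crossings_def case_prod_unfold
        by (intro arg_cong[where f = sum_list] map_cong refl) blast
      also have "\<dots> = (\<Sum>s\<leftarrow>Q i j. \<Sum>t\<leftarrow>Q k l. of_bool (pierces (fst s) (snd s) (fst t) (snd t))) +
         (\<Sum>t\<leftarrow>Q k l. \<Sum>s\<leftarrow>Q i j. of_bool (pierces (fst t) (snd t) (fst s) (snd s)))"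
        by (simp add: sum_list_addf) (rule sum_list_swap)
      also have "\<dots> = pair_sum X (q i j) (q k l) + pair_sum X (q k l) (q i j)"
        using Xex[of "q i j" "q k l"] Xex[of "q k l" "q i j"] unfolding Q_def case_prod_unfold by simp
      finally show ?thesis .
    qed
    have mb: "mod2_boundary (h (u, v)) \<phi> = \<phi> (pt u) + \<phi> (pt v)" if "{u, v} \<in> edges G" for u v \<phi>
      using mod2_boundary_of_mset[OF sgb[OF that]] by (simp add: h_def)
    have K5: "K5_sum (\<lambda>i j k l. crossings (Q i j) (Q k l)) = 1"
    proof (rule van_kampen_K5[OF rg, of "\<lambda>i. pt (b i)" Q])
      show "inj_on (\<lambda>i. pt (b i)) {..<5}"
        using comp_inj_on[OF b(1) inj_on_subset[OF pti b(2)]] by (simp add: comp_def)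
      show "pt (b i) \<in> V" if "i < 5" for i using that b(2) ptV by blast
      show "chain_points (Q i j) \<subseteq> V" if "i < j" "j < 5" for i j unfolding Q_def using edge_ex(1) qe that by blast
      show "mod2_boundary (Q i j) \<phi> = \<phi> (pt (b i)) + \<phi> (pt (b j))" if "i < j" "j < 5" for i j \<phi>
      proof -
        have "mod2_boundary (Q i j) \<phi> = mod2_boundary (q i j) (\<lambda>v. \<phi> (pt v))"
          unfolding Q_def ex_def by (rule mod2_boundary_concat) (use mb qe that in blast)
        then show ?thesis using qb that by simp
      qed
      show "chain_points (Q i j) \<inter> chain_points (Q k l) = {}"
        if "i < j" "j < 5" "k < l" "l < 5" "{i, j} \<inter> {k, l} = {}" for i j k l
        unfolding Q_def by (rule dis_ex) (use qe that qd in blast)+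
      show "pt (b k) \<notin> chain_points (Q i j)" if "i < j" "j < 5" "k < 5" "k \<notin> {i, j}" for i j k
      proof
        assume "pt (b k) \<in> chain_points (Q i j)"
        then obtain u v where uv: "(u, v) \<in> set (q i j)" "pt (b k) \<in> chain_points (sg u v)"
          unfolding Q_def ex_def chain_points_concat h_def by auto
        moreover have "b k \<notin> {u, v}" using qw[OF that] uv(1) unfolding chain_points_def by force
        ultimately show False using sgw[of u v "b k"] qe[OF that(1,2)] b(2) that(3) by blast
      qed
      show "p \<noteq> p'" if "i < j" "j < 5" "(p, p') \<in> set (Q i j)" for i j p p'
        using edge_ex(2)[of "q i j" p p'] qe that unfolding Q_def by blast
    qed
    moreover have "K5_sum (\<lambda>i j k l. crossings (Q i j) (Q k l)) =
      K5_sum (\<lambda>i j k l. pair_sum X (q i j) (q k l) + pair_sum X (q k l) (q i j))"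
      unfolding K5_sum_def by (intro arg_cong2[where f = "(+)"] vk) auto
    ultimately show "K5_sum (\<lambda>i j k l. pair_sum X (q i j) (q k l) + pair_sum X (q k l) (q i j)) = 1" by simp
  qed
qed

section \<open>Delta-Wye exchanges of the complete graph on six vertices\<close>

text \<open>The ten splittings of K6 into two triangles, the one through vertex 5 listed first. A
  term with an edge at 5 occurs in two splittings and cancels. A pair of disjoint edges avoiding 5
  occurs once in each order, which gives the two summands under \<open>K5_sum\<close>.\<close>

lemma K6_bookkeeping:
  fixes L :: "nat \<Rightarrow> nat \<Rightarrow> nat \<Rightarrow> nat \<Rightarrow> bit"
  defines "R \<equiv> \<lambda>i j k l m. L i j k l + L i j k m + L i j l m"
  assumes H: "\<And>i j k l m. i < j \<Longrightarrow> j < 5 \<Longrightarrow> k < l \<Longrightarrow> l < m \<Longrightarrow> m < 5 \<Longrightarrow> {i, j} \<inter> {k, l, m} = {} \<Longrightarrow>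
     R i j k l m + R i 5 k l m + R j 5 k l m = 0"
  shows "K5_sum (\<lambda>i j k l. L i j k l + L k l i j) = 0"
proof -
  have "(R 0 1 2 3 4 + R 0 5 2 3 4 + R 1 5 2 3 4) + (R 0 2 1 3 4 + R 0 5 1 3 4 + R 2 5 1 3 4) + (R 0 3 1 2 4 + R 0 5 1 2 4 + R 3 5 1 2 4) + (R 0 4 1 2 3 + R 0 5 1 2 3 + R 4 5 1 2 3) + (R 1 2 0 3 4 + R 1 5 0 3 4 + R 2 5 0 3 4) + (R 1 3 0 2 4 + R 1 5 0 2 4 + R 3 5 0 2 4) + (R 1 4 0 2 3 + R 1 5 0 2 3 + R 4 5 0 2 3) + (R 2 3 0 1 4 + R 2 5 0 1 4 + R 3 5 0 1 4) + (R 2 4 0 1 3 + R 2 5 0 1 3 + R 4 5 0 1 3) + (R 3 4 0 1 2 + R 3 5 0 1 2 + R 4 5 0 1 2) = 0"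
    by (simp add: H)
  then show ?thesis unfolding R_def K5_sum_def by (simp add: ac_simps)
qed

lemma pair_sum_append:
  "pair_sum x (ss @ ss') tt = pair_sum x ss tt + pair_sum x ss' tt"
  "pair_sum x ss (tt @ tt') = pair_sum x ss tt + pair_sum x ss tt'"
  by (simp_all add: pair_sum_def sum_list_addf)

definition opt_list :: "'v option \<Rightarrow> 'v list" where
  "opt_list z = (case z of None \<Rightarrow> [] | Some y \<Rightarrow> [y])"

lemma set_opt_list: "set (opt_list z) = {y. z = Some y}"
  by (auto simp: opt_list_def split: option.splits)

lemma distinct_opt_list: "distinct (opt_list z)"
  by (simp add: opt_list_def split: option.split)

definition via_path :: "('v \<Rightarrow> 'v \<Rightarrow> 'v option) \<Rightarrow> 'v \<Rightarrow> 'v \<Rightarrow> ('v \<times> 'v) list" where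
  "via_path via i j = (case via i j of None \<Rightarrow> [(i, j)] | Some y \<Rightarrow> [(i, y), (y, j)])"

definition via_cycle :: "('v \<Rightarrow> 'v \<Rightarrow> 'v option) \<Rightarrow> 'v \<Rightarrow> 'v \<Rightarrow> 'v \<Rightarrow> 'v list" where
  "via_cycle via i j k = i # opt_list (via i j) @ j # opt_list (via j k) @ k # opt_list (via k i)"

lemma simple_graph_edge_subset:
  assumes "simple_graph G" "e \<in> edges G" shows "e \<subseteq> verts G"
proof -
  obtain u v where "e = {u, v}" "u \<in> verts G" "v \<in> verts G"
    using assms unfolding simple_graph_def by auto
  then show ?thesis by simp
qed

lemma is_cycleI:
  assumes "simple_graph G" "distinct vs" "length vs \<ge> 3" "\<forall>(u, v)\<in>set (cyc_pairs vs). {u, v} \<in> edges G"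
  shows "is_cycle G vs"
proof -
  have e: "{vs ! i, vs ! (Suc i mod length vs)} \<in> edges G" if "i < length vs" for i
  proof -
    have "(vs ! i, rotate1 vs ! i) \<in> set (cyc_pairs vs)"
      using that unfolding cyc_pairs_def set_zip by auto
    then show ?thesis using assms(4) that by (auto simp: nth_rotate1)
  qed
  moreover have "set vs \<subseteq> verts G"
  proof
    fix v assume "v \<in> set vs"
    then obtain i where "i < length vs" "v = vs ! i" by (metis in_set_conv_nth)
    then show "v \<in> verts G" using simple_graph_edge_subset[OF assms(1) e] by auto
  qed
  ultimately show ?thesis using assms unfolding is_cycle_def by simp
qed

text \<open>\<open>via i j\<close> is the new vertex through which the edge \<open>ij\<close> of \<open>K\<^sub>6\<close> is rerouted, if any; since the edges
  sharing a new vertex form a triangle, this is a Delta-Wye exchange.\<close>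
lemma delta_wye_K6_linked:
  fixes G :: "nat graph" and via :: "nat \<Rightarrow> nat \<Rightarrow> nat option"
  assumes G: "simple_graph G" and six: "{..<6} \<subseteq> verts G"
    and sym: "\<And>i j. via j i = via i j"
    and fresh: "\<And>i j y. via i j = Some y \<Longrightarrow> y \<ge> 6"
    and ed: "\<And>i j. i < j \<Longrightarrow> j < 6 \<Longrightarrow>
       (case via i j of None \<Rightarrow> {i, j} \<in> edges G | Some y \<Rightarrow> {i, y} \<in> edges G \<and> {y, j} \<in> edges G)"
    and indep: "\<And>i j k l y. {i, j} \<inter> {k, l} = {} \<Longrightarrow> via i j = Some y \<Longrightarrow> via k l \<noteq> Some y"
    and tri: "\<And>i j k y. distinct [i, j, k] \<Longrightarrow> via i j = Some y \<Longrightarrow> via i k = Some y \<Longrightarrow> via j k = Some y"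
  shows "intrinsically_linked G"
proof (rule ccontr)
  assume nl: "\<not> intrinsically_linked G"
  show False
  proof (rule unlinked_crossing_data[OF G nl])
  fix x :: "nat \<times> nat \<Rightarrow> nat \<times> nat \<Rightarrow> bit"
  assume xs:
    "\<And>u v t. {u, v} \<in> edges G \<Longrightarrow> x (v, u) t = x (u, v) t"
    "\<And>u v s. {u, v} \<in> edges G \<Longrightarrow> x s (v, u) = x s (u, v)"
    and xc: "\<And>C D. is_cycle G C \<Longrightarrow> is_cycle G D \<Longrightarrow> set C \<inter> set D = {} \<Longrightarrow>
       pair_sum x (cyc_pairs C) (cyc_pairs D) = 0"
    and xk: "\<And>b q. K5_model G b q \<Longrightarrow>
       K5_sum (\<lambda>i j k l. pair_sum x (q i j) (q k l) + pair_sum x (q k l) (q i j)) = 1"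
  let ?q = "via_path via"
  have edN: "{i, j} \<in> edges G" if "via i j = None" "i \<noteq> j" "i < 6" "j < 6" for i j
    using ed[of i j] ed[of j i] sym[of i j] that by (cases "i < j") (auto simp: insert_commute)
  have edS: "{i, y} \<in> edges G" "{y, j} \<in> edges G" "{j, y} \<in> edges G" "{y, i} \<in> edges G"
    if v: "via i j = Some y" and n: "i \<noteq> j" "i < 6" "j < 6" for i j y
  proof -
    have "{i, y} \<in> edges G \<and> {y, j} \<in> edges G"
    proof (cases "i < j")
      case True
      then show ?thesis using ed[OF True n(3)] v by simp
    next
      case False
      then have "{j, y} \<in> edges G \<and> {y, i} \<in> edges G" using ed[of j i] n v sym[of j i] by simp
      then show ?thesis by (simp only: insert_commute[of j y] insert_commute[of y i] simp_thms)
    qed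
    then show "{i, y} \<in> edges G" "{y, j} \<in> edges G" "{j, y} \<in> edges G" "{y, i} \<in> edges G"
      by (simp_all only: insert_commute[of j y] insert_commute[of y i])
  qed
  have ends: "y \<noteq> i" if "via k l = Some y" "i < 6" for i k l y using fresh[OF that(1)] that(2) by simp
  have K: "K5_sum (\<lambda>i j k l. pair_sum x (?q i j) (?q k l) + pair_sum x (?q k l) (?q i j)) = 1"
  proof (rule xk[of "\<lambda>i. i"], unfold K5_model_def, intro conjI allI impI)
    fix i j :: nat assume ij: "i < j" "j < 5"
    show "\<forall>(u, v)\<in>set (?q i j). {u, v} \<in> edges G"
      using ed[of i j] ij by (auto simp: via_path_def split: option.splits)
    show "mod2_boundary (?q i j) \<phi> = \<phi> i + \<phi> j" for \<phi>
      by (auto simp: via_path_def mod2_boundary_def ac_simps split: option.splits)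
    show "chain_points (?q i j) \<inter> chain_points (?q k l) = {}"
      if "k < l" "l < 5" "{i, j} \<inter> {k, l} = {}" for k l
      using that ij indep[OF that(3)] ends[of i j _ k] ends[of i j _ l] ends[of k l _ i] ends[of k l _ j]
      by (auto simp: via_path_def chain_points_def split: option.splits)
    show "k \<notin> chain_points (?q i j)" if "k < 5" "k \<notin> {i, j}" for k
      using that ij ends[of i j _ k] by (auto simp: via_path_def chain_points_def split: option.splits)
  qed (use six in auto)
  define triv where "triv i j k \<longleftrightarrow> (\<exists>y. via i j = Some y \<and> via j k = Some y \<and> via i k = Some y)" for i j k
  let ?ch = "\<lambda>i j k. ?q i j @ ?q j k @ ?q i k"
  let ?w = "via_cycle via"
  have tv: "y \<noteq> z" if "via a b = Some y" "via b c = Some z" "\<not> triv a b c" "distinct [a, b, c]" for a b c y z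
    using tri[of b a c y] that sym[of a b] unfolding triv_def by auto
  have trivs: "triv b c a = triv a b c" "triv c a b = triv a b c" for a b c
    unfolding triv_def sym[of a c] sym[of a b] sym[of b c] by auto
  have cyc: "is_cycle G (?w i j k)" if d: "distinct [i, j, k]" "i < 6" "j < 6" "k < 6" and nt: "\<not> triv i j k" for i j k
  proof (rule is_cycleI[OF G])
    show "3 \<le> length (?w i j k)" by (simp add: via_cycle_def)
    have new: "set (opt_list (via a b)) \<inter> {i, j, k} = {}" for a b
      using fresh[of a b] d(2-4) by (fastforce simp: set_opt_list)
    have diff: "set (opt_list (via a b)) \<inter> set (opt_list (via b c)) = {}"
      if "\<not> triv a b c" "distinct [a, b, c]" for a b c
      unfolding set_opt_list using tv[OF _ _ that] by blast
    have "\<not> triv j k i" "\<not> triv k i j"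
      using nt by (simp_all only: trivs[where a = i and b = j and c = k] not_False_eq_True)
    moreover have "distinct [j, k, i]" "distinct [k, i, j]" using d(1) by auto
    ultimately have diffs: "set (opt_list (via i j)) \<inter> set (opt_list (via j k)) = {}"
      "set (opt_list (via j k)) \<inter> set (opt_list (via k i)) = {}"
      "set (opt_list (via k i)) \<inter> set (opt_list (via i j)) = {}"
      using diff[OF nt d(1)] diff[of j k i] diff[of k i j] by blast+
    show "distinct (?w i j k)"
      using d(1) new[of i j] new[of j k] new[of k i] diffs distinct_opt_list[of "via i j"]
        distinct_opt_list[of "via j k"] distinct_opt_list[of "via k i"]
      unfolding via_cycle_def by auto
    have E: "case via a b of None \<Rightarrow> {a, b} \<in> edges G | Some y \<Rightarrow> {a, y} \<in> edges G \<and> {y, b} \<in> edges G"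
      if "a \<noteq> b" "a < 6" "b < 6" for a b
    proof (cases "via a b")
      case None
      then show ?thesis using edN[OF None that] by simp
    next
      case (Some y)
      then show ?thesis using edS(1,2)[OF Some that] by simp
    qed
    show "\<forall>(u, v)\<in>set (cyc_pairs (?w i j k)). {u, v} \<in> edges G"
      using E[of i j] E[of j k] E[of k i] d
      by (cases "via i j"; cases "via j k"; cases "via k i") (simp_all add: via_cycle_def opt_list_def cyc_pairs_def)
  qed
  have chain: "(\<Sum>s\<leftarrow>?ch i j k. f s) = (if triv i j k then 0 else (\<Sum>s\<leftarrow>cyc_pairs (?w i j k). f s))"
    if f: "\<And>u v. {u, v} \<in> edges G \<Longrightarrow> f (v, u) = f (u, v)"
      and d: "distinct [i, j, k]" "i < 6" "j < 6" "k < 6" for f :: "nat \<times> nat \<Rightarrow> bit" and i j k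
  proof (cases "triv i j k")
    case True
    then obtain y where y: "via i j = Some y" "via j k = Some y" "via i k = Some y" unfolding triv_def by blast
    then have "f (y, j) = f (j, y)" "f (y, k) = f (k, y)"
      using f[of j y] f[of k y] edS d by auto
    then show ?thesis using y True by (simp add: via_path_def ac_simps)
  next
    case False
    have fl: "f (k, i) = f (i, k)" if "via k i = None" using f[of i k] edN[of k i] that d by (auto simp: insert_commute)
    have fy: "f (k, y) = f (y, k)" "f (y, i) = f (i, y)" if "via k i = Some y" for y
      using f[of y k] f[of i y] edS[of k i y] that d by auto
    show ?thesis
      using False fl fy sym[of i k]
      by (auto simp: via_path_def via_cycle_def opt_list_def cyc_pairs_def ac_simps split: option.splits)
  qed
  have zero: "pair_sum x (?ch i j k) (?ch l m n) = 0"
    if d: "distinct [i, j, k]" "i < 6" "j < 6" "k < 6" "distinct [l, m, n]" "l < 6" "m < 6" "n < 6"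
      and dis: "{i, j, k} \<inter> {l, m, n} = {}" for i j k l m n
  proof -
    have in2: "(\<Sum>t\<leftarrow>?ch l m n. x s t) = (if triv l m n then 0 else (\<Sum>t\<leftarrow>cyc_pairs (?w l m n). x s t))" for s
      by (rule chain) (use xs d in auto)
    have sw: "(\<Sum>t\<leftarrow>ts. x (v, u) t) = (\<Sum>t\<leftarrow>ts. x (u, v) t)" if "{u, v} \<in> edges G" for u v ts
      by (simp only: xs(1)[OF that])
    show ?thesis
    proof (cases "triv l m n \<or> triv i j k")
      case True
      then show ?thesis
      proof
        assume "triv l m n"
        then show ?thesis unfolding pair_sum_def in2 by simp
      next
        assume t: "triv i j k"
        have "pair_sum x (?ch i j k) (?ch l m n) = (\<Sum>t\<leftarrow>?ch l m n. \<Sum>s\<leftarrow>?ch i j k. x s t)"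
          unfolding pair_sum_def by (rule sum_list_swap)
        also have "\<dots> = (\<Sum>t\<leftarrow>?ch l m n. 0)"
          by (intro arg_cong[where f = sum_list] map_cong refl, subst chain) (use xs d t in auto)
        finally show ?thesis by simp
      qed
    next
      case False
      have "pair_sum x (?ch i j k) (?ch l m n) = (\<Sum>s\<leftarrow>?ch i j k. \<Sum>t\<leftarrow>cyc_pairs (?w l m n). x s t)"
        unfolding pair_sum_def in2 using False by simp
      also have "\<dots> = (\<Sum>s\<leftarrow>cyc_pairs (?w i j k). \<Sum>t\<leftarrow>cyc_pairs (?w l m n). x s t)"
        using chain[of "\<lambda>s. \<Sum>t\<leftarrow>cyc_pairs (?w l m n). x s t" i j k, OF sw] d False by simp
      also have "\<dots> = pair_sum x (cyc_pairs (?w i j k)) (cyc_pairs (?w l m n))" by (simp add: pair_sum_def)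
      also have "\<dots> = 0"
      proof (rule xc)
        show "is_cycle G (?w i j k)" "is_cycle G (?w l m n)" using cyc d False by auto
        have W: "y \<in> {a, b, c} \<or> (\<exists>a' b'. {a', b'} \<subseteq> {a, b, c} \<and> via a' b' = Some y)"
          if "y \<in> set (?w a b c)" for y a b c
          using that by (auto simp: via_cycle_def set_opt_list)
        \<comment> \<open>Old vertices are below 6 and new ones are not, so only a new vertex could
          be common; it would then serve two disjoint edges, against \<open>indep\<close>.\<close>
        show "set (?w i j k) \<inter> set (?w l m n) = {}"
        proof (rule equals0I)
          fix y assume "y \<in> set (?w i j k) \<inter> set (?w l m n)"
          then have y: "y \<in> {i, j, k} \<or> (\<exists>a b. {a, b} \<subseteq> {i, j, k} \<and> via a b = Some y)"
            "y \<in> {l, m, n} \<or> (\<exists>a b. {a, b} \<subseteq> {l, m, n} \<and> via a b = Some y)"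
            using W[of y i j k] W[of y l m n] by (simp_all only: Int_iff simp_thms)
          show False
          proof (cases "y < 6")
            case True
            then have n: "\<nexists>a b. via a b = Some y" using fresh by (metis leD)
            have "y \<in> {i, j, k}" using y(1)
            proof
              assume "\<exists>a b. {a, b} \<subseteq> {i, j, k} \<and> via a b = Some y" then show ?thesis using n by metis
            qed
            moreover have "y \<in> {l, m, n}" using y(2)
            proof
              assume "\<exists>a b. {a, b} \<subseteq> {l, m, n} \<and> via a b = Some y" then show ?thesis using n by metis
            qed
            ultimately show False using dis by (metis IntI empty_iff)
          next
            case False
            then have "y \<notin> {i, j, k}" "y \<notin> {l, m, n}" using d by auto
            then have e: "\<exists>a b. {a, b} \<subseteq> {i, j, k} \<and> via a b = Some y" "\<exists>a b. {a, b} \<subseteq> {l, m, n} \<and> via a b = Some y"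
              using y by metis+
            obtain a b where ab: "{a, b} \<subseteq> {i, j, k}" "via a b = Some y" using e(1) by (elim exE conjE)
            obtain a' b' where ab': "{a', b'} \<subseteq> {l, m, n}" "via a' b' = Some y" using e(2) by (elim exE conjE)
            have "{a, b} \<inter> {a', b'} \<subseteq> {i, j, k} \<inter> {l, m, n}" using ab(1) ab'(1) by (rule Int_mono)
            then have "{a, b} \<inter> {a', b'} = {}" unfolding dis by (rule subset_empty[THEN iffD1])
            then show False using indep[OF _ ab(2)] ab'(2) by metis
          qed
        qed
      qed
      finally show ?thesis .
    qed
  qed
  define L where "L i j k l = pair_sum x (?q i j) (?q k l)" for i j k l
  have "K5_sum (\<lambda>i j k l. L i j k l + L k l i j) = 0"
  proof (rule K6_bookkeeping)
    fix i j k l m :: nat assume "i < j" "j < 5" "k < l" "l < m" "m < 5" "{i, j} \<inter> {k, l, m} = {}"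
    then have "pair_sum x (?ch i j 5) (?ch k l m) = 0" by (intro zero) auto
    then show "L i j k l + L i j k m + L i j l m + (L i 5 k l + L i 5 k m + L i 5 l m) +
       (L j 5 k l + L j 5 k m + L j 5 l m) = 0"
      unfolding L_def pair_sum_append by (simp only: ac_simps)
  qed
  then show False using K unfolding L_def by (simp only: one_neq_zero)
  qed
qed

section \<open>K6 after at most two Delta-Wye moves\<close>

definition dw_edges :: "nat list \<Rightarrow> nat list \<Rightarrow> (nat \<times> nat) list" where
  "dw_edges T1 T2 = filter (\<lambda>(i, j). i < j \<and> \<not> (i \<in> set T1 \<and> j \<in> set T1) \<and> \<not> (i \<in> set T2 \<and> j \<in> set T2))
     (List.product [0..<6] [0..<6]) @ map (\<lambda>i. (i, 6)) T1 @ map (\<lambda>i. (i, 7)) T2"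

definition dw_size :: "nat list \<Rightarrow> nat list \<Rightarrow> nat" where
  "dw_size T1 T2 = (if T1 = [] then 6 else if T2 = [] then 7 else 8)"

text \<open>\<open>K\<^sub>6\<close> after Delta-Wye moves on the triangles \<open>T1\<close> and \<open>T2\<close> (an empty list stands for no move).\<close>
definition dw_graph :: "nat list \<Rightarrow> nat list \<Rightarrow> nat graph" where
  "dw_graph T1 T2 = ({..<dw_size T1 T2}, (\<lambda>(u, v). {u, v}) ` set (dw_edges T1 T2))"

text \<open>Two triangles with at most one common vertex share no edge, so the second move is still
  possible after the first. For disjoint triangles the resulting graph is K_{4,4} minus the edge
  joining the two new vertices.\<close>

definition dw_ok :: "nat list \<Rightarrow> nat list \<Rightarrow> bool" where
  "dw_ok T1 T2 \<longleftrightarrow> length T1 \<le> 3 \<and> length T2 \<le> 3 \<and> (\<forall>i\<in>set T1 \<union> set T2. i < 6) \<and>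
     (T1 = [] \<longrightarrow> T2 = []) \<and> (\<forall>i\<in>set T1 \<inter> set T2. \<forall>j\<in>set T1 \<inter> set T2. i = j)"

lemma card_four_le:
  assumes "{i, j, k, l} \<subseteq> set T" "i \<noteq> j" "k \<noteq> l" "{i, j} \<inter> {k, l} = {}"
  shows "4 \<le> length T"
proof -
  have "card {i, j, k, l} = 4" using assms(2-4) by auto
  then show ?thesis using card_mono[OF finite_set assms(1)] card_length[of T] by linarith
qed

lemma dw_edges_bounds:
  assumes "dw_ok T1 T2" "(u, v) \<in> set (dw_edges T1 T2)"
  shows "u < dw_size T1 T2" "v < dw_size T1 T2" "u \<noteq> v"
proof -
  have "u < 6 \<and> (u < v \<and> v < 6 \<or> v = 6 \<and> T1 \<noteq> [] \<or> v = 7 \<and> T2 \<noteq> [] \<and> T1 \<noteq> [])"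
    using assms unfolding dw_edges_def dw_ok_def by auto
  then show "u < dw_size T1 T2" "v < dw_size T1 T2" "u \<noteq> v" unfolding dw_size_def by auto
qed

lemma simple_graph_dw:
  assumes "dw_ok T1 T2"
  shows "simple_graph (dw_graph T1 T2)"
  unfolding simple_graph_def
proof (intro conjI ballI)
  show "finite (verts (dw_graph T1 T2))" by (simp add: verts_def dw_graph_def)
  fix e assume "e \<in> edges (dw_graph T1 T2)"
  then obtain u v where "(u, v) \<in> set (dw_edges T1 T2)" "e = {u, v}"
    by (auto simp: edges_def dw_graph_def)
  then show "\<exists>u v. e = {u, v} \<and> u \<noteq> v \<and> u \<in> verts (dw_graph T1 T2) \<and> v \<in> verts (dw_graph T1 T2)"
    using dw_edges_bounds[OF assms] by (intro exI[of _ u] exI[of _ v]) (simp add: verts_def dw_graph_def)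
qed

lemma dw_graph_linked:
  assumes ok: "dw_ok T1 T2"
  shows "intrinsically_linked (dw_graph T1 T2)"
proof -
  define via where "via i j = (if i \<noteq> j \<and> {i, j} \<subseteq> set T1 then Some (6::nat)
     else if i \<noteq> j \<and> {i, j} \<subseteq> set T2 then Some 7 else None)" for i j
  have v6: "via i j = Some 6 \<longleftrightarrow> i \<noteq> j \<and> {i, j} \<subseteq> set T1" for i j by (simp add: via_def)
  have v7: "via i j = Some y \<Longrightarrow> y \<noteq> 6 \<Longrightarrow> y = 7 \<and> i \<noteq> j \<and> {i, j} \<subseteq> set T2 \<and> \<not> {i, j} \<subseteq> set T1" for i j y
    by (auto simp: via_def split: if_splits)
  have v7': "via i j = Some 7 \<longleftrightarrow> i \<noteq> j \<and> {i, j} \<subseteq> set T2 \<and> \<not> {i, j} \<subseteq> set T1" for i j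
    by (auto simp: via_def)
  show ?thesis
  proof (rule delta_wye_K6_linked[of _ via])
    show "simple_graph (dw_graph T1 T2)" by (rule simple_graph_dw[OF ok])
    show "{..<6} \<subseteq> verts (dw_graph T1 T2)" by (auto simp: verts_def dw_graph_def dw_size_def)
    show "via j i = via i j" for i j by (auto simp: via_def)
    show "6 \<le> y" if "via i j = Some y" for i j y using that by (auto simp: via_def split: if_splits)
    show "case via i j of None \<Rightarrow> {i, j} \<in> edges (dw_graph T1 T2)
        | Some y \<Rightarrow> {i, y} \<in> edges (dw_graph T1 T2) \<and> {y, j} \<in> edges (dw_graph T1 T2)"
      if "i < j" "j < 6" for i j
    proof -
      have e: "{u, v} \<in> edges (dw_graph T1 T2)" if "(u, v) \<in> set (dw_edges T1 T2)" for u v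
        using that unfolding dw_graph_def edges_def by force
      consider (1) "{i, j} \<subseteq> set T1" | (2) "\<not> {i, j} \<subseteq> set T1" "{i, j} \<subseteq> set T2"
        | (3) "\<not> {i, j} \<subseteq> set T1" "\<not> {i, j} \<subseteq> set T2" by blast
      then show ?thesis
      proof cases
        case 1
        then have "(i, 6) \<in> set (dw_edges T1 T2)" "(j, 6) \<in> set (dw_edges T1 T2)" by (auto simp: dw_edges_def)
        then show ?thesis using 1 \<open>i < j\<close> e[of i 6] e[of j 6] by (simp add: via_def insert_commute)
      next
        case 2
        then have "(i, 7) \<in> set (dw_edges T1 T2)" "(j, 7) \<in> set (dw_edges T1 T2)" by (auto simp: dw_edges_def)
        then show ?thesis using 2 \<open>i < j\<close> e[of i 7] e[of j 7] by (auto simp: via_def insert_commute)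
      next
        case 3
        then have "(i, j) \<in> set (dw_edges T1 T2)" using that by (auto simp: dw_edges_def)
        then show ?thesis using 3 e[of i j] by (auto simp: via_def)
      qed
    qed
    show "via k l \<noteq> Some y" if d: "{i, j} \<inter> {k, l} = {}" and ij: "via i j = Some y" for i j k l y
    proof
      assume kl: "via k l = Some y"
      show False
      proof (cases "y = 6")
        case True
        then have "i \<noteq> j" "k \<noteq> l" "{i, j, k, l} \<subseteq> set T1" using ij kl v6 by auto
        then show False using card_four_le[of i j k l T1] d ok by (simp add: dw_ok_def)
      next
        case False
        then have "i \<noteq> j" "k \<noteq> l" "{i, j, k, l} \<subseteq> set T2" using v7[OF ij] v7[OF kl] by auto
        then show False using card_four_le[of i j k l T2] d ok by (simp add: dw_ok_def)
      qed
    qed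
    show "via j k = Some y" if d: "distinct [i, j, k]" and ij: "via i j = Some y" and ik: "via i k = Some y" for i j k y
    proof (cases "y = 6")
      case True
      then show ?thesis using ij ik d unfolding v6 True by auto
    next
      case False
      have y: "y = 7" using v7[OF ij False] by blast
      have m: "{i, j, k} \<subseteq> set T2" "i \<noteq> j" using v7[OF ij False] v7[OF ik False] by auto
      \<comment> \<open>Otherwise \<open>j\<close> and \<open>k\<close> would be two common vertices
        of the triangles.\<close>
      have "\<not> {j, k} \<subseteq> set T1"
        using ok m d unfolding dw_ok_def by auto
      then show ?thesis using m d unfolding y v7' by auto
    qed
  qed
qed

lemma cycle_edges_image: "cycle_edges c = (\<lambda>i. {c ! i, c ! (Suc i mod length c)}) ` {..<length c}"
  unfolding cycle_edges_def setcompr_eq_image lessThan_def by simp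

text \<open>An embedding of \<open>G\<close> restricts along \<open>f\<close> to one of
  \<open>H\<close>, and the linked cycles found there have the same images in
  \<open>G\<close>.\<close>

lemma intrinsically_linked_mono:
  assumes H: "simple_graph H" and lk: "intrinsically_linked H"
    and inj: "inj_on f (verts H)" and fv: "f ` verts H \<subseteq> verts G"
    and fe: "\<And>e. e \<in> edges H \<Longrightarrow> f ` e \<in> edges G"
  shows "intrinsically_linked G"
  unfolding intrinsically_linked_def
proof (intro allI impI)
  fix p \<gamma> assume tame: "tame_embedding G p \<gamma>"
  have sub: "e \<subseteq> verts H" if "e \<in> edges H" for e by (rule simple_graph_edge_subset[OF H that])
  have tm: "inj_on p (verts G)"
    "\<And>e v. e \<in> edges G \<Longrightarrow> v \<in> verts G \<Longrightarrow> p v \<in> path_image (\<gamma> e) \<Longrightarrow> v \<in> e"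
    "\<And>e e'. e \<in> edges G \<Longrightarrow> e' \<in> edges G \<Longrightarrow> e \<noteq> e' \<Longrightarrow> path_image (\<gamma> e) \<inter> path_image (\<gamma> e') \<subseteq> p ` (e \<inter> e')"
    using tame by (simp_all add: tame_embedding_def)
  let ?p = "\<lambda>v. p (f v)" and ?\<gamma> = "\<lambda>e. \<gamma> (f ` e)"
  have "tame_embedding H ?p ?\<gamma>"
    unfolding tame_embedding_def
  proof (intro conjI ballI impI)
    show "inj_on ?p (verts H)"
      using comp_inj_on[OF inj inj_on_subset[OF tm(1) fv]] by (simp add: comp_def)
  next
    fix e assume e: "e \<in> edges H"
    have t: "arc (\<gamma> (f ` e))" "{pathstart (\<gamma> (f ` e)), pathfinish (\<gamma> (f ` e))} = p ` f ` e"
      "\<exists>F :: ((real^3) \<times> (real^3)) set. finite F \<and> path_image (\<gamma> (f ` e)) = (\<Union>(a, b)\<in>F. closed_segment a b)"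
      using tame fe[OF e] unfolding tame_embedding_def by simp_all
    show "arc (\<gamma> (f ` e))" by (rule t(1))
    show "{pathstart (\<gamma> (f ` e)), pathfinish (\<gamma> (f ` e))} = ?p ` e" using t(2) by (simp add: image_image)
    show "\<exists>F :: ((real^3) \<times> (real^3)) set. finite F \<and> path_image (\<gamma> (f ` e)) = (\<Union>(a, b)\<in>F. closed_segment a b)"
      by (rule t(3))
    fix v assume v: "v \<in> verts H" "?p v \<in> path_image (\<gamma> (f ` e))"
    have "f v \<in> f ` e" using fv v(1) by (intro tm(2)[OF fe[OF e] _ v(2)]) auto
    then show "v \<in> e" using inj_on_image_mem_iff[OF inj v(1) sub[OF e]] by simp
  next
    fix e e' assume e: "e \<in> edges H" "e' \<in> edges H" "e \<noteq> e'"
    then have "f ` e \<noteq> f ` e'" using inj_on_image_eq_iff[OF inj sub[OF e(1)] sub[OF e(2)]] by simp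
    then have "path_image (\<gamma> (f ` e)) \<inter> path_image (\<gamma> (f ` e')) \<subseteq> p ` (f ` e \<inter> f ` e')"
      by (rule tm(3)[OF fe[OF e(1)] fe[OF e(2)]])
    also have "f ` e \<inter> f ` e' = f ` (e \<inter> e')" using inj_on_image_Int[OF inj sub[OF e(1)] sub[OF e(2)]] by simp
    finally show "path_image (\<gamma> (f ` e)) \<inter> path_image (\<gamma> (f ` e')) \<subseteq> ?p ` (e \<inter> e')" by (simp add: image_image)
  qed
  then obtain c1 c2 where c: "is_cycle H c1" "is_cycle H c2" "set c1 \<inter> set c2 = {}"
    "\<not> split_link (cycle_image ?\<gamma> c1) (cycle_image ?\<gamma> c2)"
    using lk unfolding intrinsically_linked_def by blast
  have next_less: "Suc i mod n < n" if "i < n" for i n :: nat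
    using that by (intro mod_less_divisor) auto
  have cyc: "is_cycle G (map f c)" if "is_cycle H c" for c
  proof -
    have "distinct (map f c)" using that inj unfolding is_cycle_def by (auto simp: distinct_map intro: inj_on_subset)
    moreover have "{f (c ! i), f (c ! (Suc i mod length c))} \<in> edges G" if "i < length c" for i
      using fe[of "{c ! i, c ! (Suc i mod length c)}"] that \<open>is_cycle H c\<close> unfolding is_cycle_def by auto
    moreover have "set (map f c) \<subseteq> verts G" using that fv unfolding is_cycle_def by auto
    ultimately show ?thesis using that unfolding is_cycle_def by (simp add: next_less)
  qed
  have im: "cycle_image \<gamma> (map f c) = cycle_image ?\<gamma> c" for c
  proof -
    have "cycle_edges (map f c) = (`) f ` cycle_edges c"
      unfolding cycle_edges_image image_image
      by (simp only: length_map) (intro image_cong refl, simp add: next_less)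
    then show ?thesis unfolding cycle_image_def by simp
  qed
  show "\<exists>c1 c2. is_cycle G c1 \<and> is_cycle G c2 \<and> set c1 \<inter> set c2 = {} \<and>
           \<not> split_link (cycle_image \<gamma> c1) (cycle_image \<gamma> c2)"
  proof (intro exI conjI)
    show "is_cycle G (map f c1)" "is_cycle G (map f c2)" using cyc c by auto
    have "set c1 \<subseteq> verts H" "set c2 \<subseteq> verts H" using c unfolding is_cycle_def by auto
    then show "set (map f c1) \<inter> set (map f c2) = {}"
      using inj_on_image_Int[OF inj, of "set c1" "set c2"] c(3) by simp
    show "\<not> split_link (cycle_image \<gamma> (map f c1)) (cycle_image \<gamma> (map f c2))" using c(4) by (simp add: im)
  qed
qed

section \<open>Copies in complete partite graphs\<close>

definition is_vertex :: "nat list \<Rightarrow> nat \<times> nat \<Rightarrow> bool" where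
  "is_vertex ns x \<longleftrightarrow> fst x < length ns \<and> snd x < ns ! fst x"

lemma verts_complete_partite: "verts (complete_partite ns) = {x. is_vertex ns x}"
  by (auto simp: verts_def complete_partite_def is_vertex_def)

lemma edges_complete_partite:
  "edges (complete_partite ns) = {{x, y} | x y. is_vertex ns x \<and> is_vertex ns y \<and> fst x \<noteq> fst y}"
  unfolding edges_def complete_partite_def is_vertex_def snd_conv
  by (rule Collect_cong) (simp add: split_paired_Ex)

text \<open>The witness lists below name the vertex \<open>(i, j)\<close> by the number \<open>10 i + j\<close>.\<close>
definition decode :: "nat \<Rightarrow> nat \<times> nat" where
  "decode n = (n div 10, n mod 10)"

text \<open>\<open>(T1, T2, m)\<close> places the vertex \<open>i\<close> of \<open>dw_graph T1 T2\<close> at the vertex named \<open>m ! i\<close>.\<close>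
type_synonym dw_copy = "nat list \<times> nat list \<times> nat list"

definition copy_edges :: "dw_copy \<Rightarrow> (nat \<times> nat) list" where
  "copy_edges w = (case w of (T1, T2, m) \<Rightarrow> map (\<lambda>(u, v). (m ! u, m ! v)) (dw_edges T1 T2))"

definition copy_ok :: "nat list \<Rightarrow> dw_copy \<Rightarrow> bool" where
  "copy_ok ns w \<longleftrightarrow> (case w of (T1, T2, m) \<Rightarrow> dw_ok T1 T2 \<and> length m = dw_size T1 T2 \<and> distinct m \<and>
     (\<forall>x\<in>set m. is_vertex ns (decode x)) \<and> (\<forall>(u, v)\<in>set (copy_edges w). u div 10 \<noteq> v div 10))"

definition copy_avoids :: "nat \<Rightarrow> nat \<Rightarrow> dw_copy \<Rightarrow> bool" where
  "copy_avoids a b w \<longleftrightarrow> (\<forall>(u, v)\<in>set (copy_edges w). \<not> (u = a \<and> v = b \<or> u = b \<and> v = a))"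

lemma inj_decode: "inj decode"
  unfolding decode_def inj_def by (metis Pair_inject div_mult_mod_eq)

lemma copy_linked:
  assumes ok: "copy_ok ns w" and av: "\<And>u v. (u, v) \<in> set (copy_edges w) \<Longrightarrow> {decode u, decode v} \<noteq> e"
  shows "intrinsically_linked (delete_edge (complete_partite ns) e)"
proof -
  obtain T1 T2 m where w: "w = (T1, T2, m)" by (cases w) auto
  have o: "dw_ok T1 T2" "length m = dw_size T1 T2" "distinct m" "\<And>x. x \<in> set m \<Longrightarrow> is_vertex ns (decode x)"
    "\<And>u v. (u, v) \<in> set (copy_edges w) \<Longrightarrow> u div 10 \<noteq> v div 10"
    using ok unfolding copy_ok_def w by auto
  let ?f = "\<lambda>i. decode (m ! i)"
  show ?thesis
  proof (rule intrinsically_linked_mono[OF simple_graph_dw[OF o(1)] dw_graph_linked[OF o(1)]])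
    show "inj_on ?f (verts (dw_graph T1 T2))"
      using o(2,3) by (auto simp: inj_on_def verts_def dw_graph_def nth_eq_iff_index_eq dest!: injD[OF inj_decode])
    show "?f ` verts (dw_graph T1 T2) \<subseteq> verts (delete_edge (complete_partite ns) e)"
      using o(2,4) by (auto simp: delete_edge_def verts_complete_partite)
        (auto simp: verts_def dw_graph_def verts_complete_partite[unfolded verts_def])
    fix e' assume "e' \<in> edges (dw_graph T1 T2)"
    then obtain u v where uv: "(u, v) \<in> set (dw_edges T1 T2)" "e' = {u, v}"
      by (auto simp: edges_def dw_graph_def)
    then have c: "(m ! u, m ! v) \<in> set (copy_edges w)" by (force simp: copy_edges_def w)
    have "{u, v} \<subseteq> verts (dw_graph T1 T2)"
      using simple_graph_edge_subset[OF simple_graph_dw[OF o(1)]] \<open>e' \<in> _\<close> uv(2) by blast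
    then have "u < length m" "v < length m" using o(2) by (auto simp: verts_def dw_graph_def)
    then have "is_vertex ns (?f u)" "is_vertex ns (?f v)" using o(4) by auto
    moreover have "fst (?f u) \<noteq> fst (?f v)" using o(5)[OF c] by (simp add: decode_def)
    ultimately have "{?f u, ?f v} \<in> edges (complete_partite ns)" unfolding edges_complete_partite by blast
    moreover have "{?f u, ?f v} \<noteq> e" using av[OF c] .
    ultimately show "?f ` e' \<in> edges (delete_edge (complete_partite ns) e)"
      unfolding uv(2) delete_edge_def edges_def by simp
  qed
qed

lemma doubleton_decode: "{decode u, decode v} = {decode a, decode b} \<longleftrightarrow> u = a \<and> v = b \<or> u = b \<and> v = a"
  using inj_decode by (auto simp: doubleton_eq_iff dest: injD)

lemma copy_avoids_linked:
  assumes "copy_ok ns w" "copy_avoids a b w"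
  shows "intrinsically_linked (delete_edge (complete_partite ns) {decode a, decode b})"
  using assms by (intro copy_linked) (auto simp: copy_avoids_def doubleton_decode)

text \<open>Only edges of the first copy have to be examined: when any other edge is deleted, the
  first copy itself survives.\<close>

definition copies_cover :: "nat list \<Rightarrow> dw_copy list \<Rightarrow> bool" where
  "copies_cover ns ws \<longleftrightarrow> list_all (copy_ok ns) ws \<and>
     list_all (\<lambda>(a, b). list_ex (copy_avoids a b) ws) (copy_edges (hd ws)) \<and> ws \<noteq> []"

lemma copies_cover_linked:
  assumes "copies_cover ns ws"
  shows "\<forall>e\<in>edges (complete_partite ns). intrinsically_linked (delete_edge (complete_partite ns) e)"
proof
  fix e
  have ok: "\<forall>w\<in>set ws. copy_ok ns w" "hd ws \<in> set ws"
    and ex: "\<And>a b. (a, b) \<in> set (copy_edges (hd ws)) \<Longrightarrow> \<exists>w\<in>set ws. copy_avoids a b w"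
    using assms unfolding copies_cover_def by (auto simp: list_all_iff list_ex_iff)
  show "intrinsically_linked (delete_edge (complete_partite ns) e)"
  proof (cases "\<exists>(a, b)\<in>set (copy_edges (hd ws)). {decode a, decode b} = e")
    case True
    then obtain a b where "(a, b) \<in> set (copy_edges (hd ws))" "{decode a, decode b} = e" by blast
    then show ?thesis using ex ok(1) copy_avoids_linked by blast
  next
    case False
    then show ?thesis using ok by (intro copy_linked[of ns "hd ws"]) auto
  qed
qed

section \<open>Linked copies in partite graphs\<close>

text \<open>The bounds by 10 make the decimal names of the vertices in the two parts
  unambiguous.\<close>

definition copies_cover_between :: "nat list \<Rightarrow> nat \<Rightarrow> nat \<Rightarrow> dw_copy list \<Rightarrow> bool" where
  "copies_cover_between ns a b ws \<longleftrightarrow> ns ! a \<le> 10 \<and> ns ! b \<le> 10 \<and> list_all (copy_ok ns) ws \<and>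
     list_all (\<lambda>j. list_all (\<lambda>j'. list_ex (copy_avoids (10 * a + j) (10 * b + j')) ws) [0..<ns ! b]) [0..<ns ! a]"

lemma copies_cover_between_linked:
  assumes cov: "copies_cover_between ns a b ws" and e: "edge_between ns a b e"
  shows "intrinsically_linked (delete_edge (complete_partite ns) e)"
proof -
  obtain j j' where j: "e = {(a, j), (b, j')}" "j < ns ! a" "j' < ns ! b"
    using e unfolding edge_between_def by blast
  have d: "decode (10 * a + j) = (a, j)" "decode (10 * b + j') = (b, j')"
    using j(2,3) cov by (simp_all add: decode_def copies_cover_between_def)
  have "list_ex (copy_avoids (10 * a + j) (10 * b + j')) ws"
    using cov j(2,3) unfolding copies_cover_between_def list_all_iff set_upt by simp
  then obtain w where "w \<in> set ws" "copy_avoids (10 * a + j) (10 * b + j') w" "copy_ok ns w"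
    using cov unfolding copies_cover_between_def list_all_iff list_ex_iff by blast
  then show ?thesis unfolding j(1) d[symmetric] by (intro copy_avoids_linked)
qed

text \<open>An entry is K_{4,4} minus the edge between its last two vertices, so there is one entry
  for each of the sixteen edges.\<close>

lemma linked_44: "copies_cover [4, 4]
    [([0, 1, 2], [3, 4, 5], [13, 12, 10, 0, 2, 3, 1, 11]),
     ([0, 1, 2], [3, 4, 5], [12, 13, 11, 2, 1, 0, 3, 10]),
     ([0, 1, 2], [3, 4, 5], [11, 13, 10, 2, 0, 3, 1, 12]),
     ([0, 1, 2], [3, 4, 5], [2, 1, 0, 12, 13, 10, 11, 3]),
     ([0, 1, 2], [3, 4, 5], [13, 12, 11, 0, 3, 1, 2, 10]),
     ([0, 1, 2], [3, 4, 5], [1, 2, 3, 13, 10, 12, 11, 0]),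
     ([0, 1, 2], [3, 4, 5], [1, 3, 0, 12, 10, 13, 11, 2]),
     ([0, 1, 2], [3, 4, 5], [12, 13, 11, 3, 1, 2, 0, 10]),
     ([0, 1, 2], [3, 4, 5], [3, 2, 0, 11, 12, 10, 13, 1]),
     ([0, 1, 2], [3, 4, 5], [3, 2, 1, 10, 11, 13, 12, 0]),
     ([0, 1, 2], [3, 4, 5], [2, 1, 0, 13, 10, 11, 12, 3]),
     ([0, 1, 2], [3, 4, 5], [13, 12, 11, 3, 2, 0, 1, 10]),
     ([0, 1, 2], [3, 4, 5], [12, 10, 11, 0, 1, 2, 3, 13]),
     ([0, 1, 2], [3, 4, 5], [1, 0, 3, 12, 10, 11, 13, 2]),
     ([0, 1, 2], [3, 4, 5], [11, 10, 12, 2, 3, 1, 0, 13]),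
     ([0, 1, 2], [3, 4, 5], [3, 0, 1, 10, 13, 11, 12, 2])]"
  by code_simp

text \<open>The parts after the first together form one side of a K_{4,4}; an edge inside that side
  is missed by every entry. The lists for \<open>[4, 2, 2]\<close> follow the same pattern.\<close>

lemma linked_431: "copies_cover [4, 3, 1]
    [([0, 1, 2], [3, 4, 5], [3, 1, 0, 12, 11, 20, 10, 2]),
     ([0, 1, 2], [3, 4, 5], [20, 12, 11, 0, 2, 3, 1, 10]),
     ([0, 1, 2], [3, 4, 5], [1, 3, 2, 20, 10, 11, 12, 0]),
     ([0, 1, 2], [3, 4, 5], [0, 1, 3, 11, 20, 10, 12, 2]),
     ([0, 1, 2], [3, 4, 5], [2, 1, 3, 20, 11, 12, 10, 0]),
     ([0, 1, 2], [3, 4, 5], [12, 11, 20, 1, 2, 0, 3, 10]),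
     ([0, 1, 2], [3, 4, 5], [11, 12, 10, 1, 2, 0, 3, 20]),
     ([0, 1, 2], [3, 4, 5], [12, 20, 10, 2, 3, 1, 0, 11]),
     ([0, 1, 2], [3, 4, 5], [0, 3, 2, 11, 12, 10, 20, 1]),
     ([0, 1, 2], [3, 4, 5], [3, 1, 0, 12, 10, 11, 20, 2]),
     ([0, 1, 2], [3, 4, 5], [10, 20, 12, 0, 1, 3, 2, 11]),
     ([0, 1, 2], [3, 4, 5], [2, 0, 3, 11, 10, 20, 12, 1]),
     ([0, 1, 2], [3, 4, 5], [20, 11, 10, 1, 2, 0, 3, 12]),
     ([0, 1, 2], [3, 4, 5], [3, 1, 2, 11, 10, 12, 20, 0]),
     ([0, 1, 2], [3, 4, 5], [2, 0, 1, 12, 20, 10, 11, 3]),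
     ([0, 1, 2], [3, 4, 5], [2, 3, 0, 12, 20, 10, 11, 1])]"
  by code_simp

lemma linked_332: "copies_cover [3, 3, 2]
    [([0, 1, 2], [3, 4, 5], [2, 1, 0, 10, 11, 12, 20, 21]),
     ([0, 1, 2], [3, 4, 5], [10, 12, 11, 0, 2, 1, 20, 21]),
     ([0, 1, 2], [0, 3, 4], [0, 2, 1, 21, 20, 10, 12, 11]),
     ([0, 1, 2], [0, 3, 4], [10, 11, 12, 20, 21, 1, 2, 0]),
     ([0, 1, 2], [0, 3, 4], [0, 1, 2, 20, 21, 11, 12, 10]),
     ([0, 1, 2], [0, 3, 4], [0, 21, 20, 1, 2, 10, 12, 11]),
     ([0, 1, 2], [0, 3, 4], [11, 20, 21, 12, 10, 1, 0, 2])]"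
  by code_simp

lemma linked_422: "copies_cover [4, 2, 2]
    [([0, 1, 2], [3, 4, 5], [2, 0, 1, 11, 21, 20, 10, 3]),
     ([0, 1, 2], [3, 4, 5], [1, 3, 2, 21, 20, 10, 11, 0]),
     ([0, 1, 2], [3, 4, 5], [20, 10, 21, 2, 0, 1, 3, 11]),
     ([0, 1, 2], [3, 4, 5], [0, 3, 1, 10, 11, 21, 20, 2]),
     ([0, 1, 2], [3, 4, 5], [3, 2, 1, 21, 20, 11, 10, 0]),
     ([0, 1, 2], [3, 4, 5], [10, 11, 20, 2, 3, 0, 1, 21]),
     ([0, 1, 2], [3, 4, 5], [3, 1, 2, 10, 11, 20, 21, 0]),
     ([0, 1, 2], [3, 4, 5], [3, 1, 0, 20, 10, 21, 11, 2]),
     ([0, 1, 2], [3, 4, 5], [2, 0, 3, 10, 11, 21, 20, 1]),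
     ([0, 1, 2], [3, 4, 5], [21, 11, 20, 3, 0, 2, 1, 10]),
     ([0, 1, 2], [3, 4, 5], [2, 3, 0, 21, 20, 10, 11, 1]),
     ([0, 1, 2], [3, 4, 5], [10, 11, 21, 2, 0, 1, 3, 20]),
     ([0, 1, 2], [3, 4, 5], [21, 11, 20, 0, 1, 3, 2, 10]),
     ([0, 1, 2], [3, 4, 5], [0, 1, 2, 11, 10, 20, 21, 3]),
     ([0, 1, 2], [3, 4, 5], [20, 10, 11, 3, 0, 1, 2, 21]),
     ([0, 1, 2], [3, 4, 5], [11, 10, 21, 2, 3, 1, 0, 20])]"
  by code_simp

text \<open>The three entries merge the four parts in the three possible ways into the two sides of
  a K_{4,4}. An edge between two parts is absent from the entry that merges them.\<close>

lemma linked_2222: "copies_cover [2, 2, 2, 2]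
    [([0, 1, 2], [3, 4, 5], [0, 10, 1, 20, 31, 30, 21, 11]),
     ([0, 1, 2], [3, 4, 5], [1, 20, 21, 31, 11, 10, 30, 0]),
     ([0, 1, 2], [3, 4, 5], [31, 0, 1, 21, 10, 11, 20, 30])]"
  by code_simp

lemma linked_4211: "copies_cover [4, 2, 1, 1]
    [([0, 1, 2], [], [3, 0, 1, 11, 20, 30, 10]),
     ([0, 1, 2], [], [0, 3, 2, 10, 20, 30, 11]),
     ([0, 1, 2], [], [1, 2, 0, 20, 10, 30, 11]),
     ([0, 1, 2], [], [2, 1, 3, 11, 30, 20, 10]),
     ([0, 1, 2], [3, 4, 5], [0, 1, 3, 20, 30, 10, 11, 2])]"
  by code_simp

lemma linked_3311: "copies_cover [3, 3, 1, 1]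
    [([0, 1, 2], [], [2, 1, 0, 12, 30, 20, 10]),
     ([0, 1, 2], [0, 3, 4], [0, 2, 1, 20, 30, 11, 12, 10]),
     ([0, 1, 2], [], [12, 10, 11, 0, 20, 30, 2]),
     ([0, 1, 2], [], [0, 2, 1, 30, 10, 20, 11]),
     ([0, 1, 2], [], [2, 0, 1, 20, 11, 30, 12])]"
  by code_simp

lemma linked_3221: "copies_cover [3, 2, 2, 1]
    [([0, 1, 2], [], [0, 2, 1, 11, 21, 30, 20]),
     ([0, 1, 2], [0, 3, 4], [11, 30, 10, 0, 1, 20, 2, 21]),
     ([0, 1, 2], [3, 4, 5], [2, 30, 1, 20, 11, 10, 21, 0]),
     ([0, 1, 2], [0, 3, 4], [20, 10, 21, 1, 0, 30, 2, 11]),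
     ([0, 1, 2], [], [2, 1, 0, 11, 20, 30, 10])]"
  by code_simp

lemma linked_41111: "copies_cover [4, 1, 1, 1, 1]
    [([0, 1, 2], [], [0, 2, 3, 20, 10, 40, 30]),
     ([0, 1, 2], [], [1, 0, 3, 30, 40, 20, 10]),
     ([0, 1, 2], [], [3, 2, 1, 20, 10, 30, 40]),
     ([0, 1, 2], [], [1, 2, 0, 10, 20, 30, 40])]"
  by code_simp

lemma linked_32111: "copies_cover [3, 2, 1, 1, 1]
    [([0, 1, 2], [], [2, 0, 1, 11, 30, 40, 10]),
     ([0, 1, 2], [], [0, 2, 40, 30, 10, 20, 11]),
     ([0, 1, 2], [], [2, 30, 1, 10, 20, 40, 11]),
     ([0, 1, 2], [0, 3, 4], [30, 11, 10, 40, 20, 1, 0, 2])]"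
  by code_simp

lemma linked_22211: "copies_cover [2, 2, 2, 1, 1]
    [([0, 1, 2], [], [11, 20, 21, 1, 40, 30, 0]),
     ([0, 1, 2], [0, 3, 4], [21, 40, 30, 20, 1, 10, 0, 11]),
     ([0, 1, 2], [0, 3, 4], [1, 11, 0, 30, 40, 21, 20, 10]),
     ([0, 1, 2], [], [10, 30, 11, 0, 40, 20, 21])]"
  by code_simp

lemma linked_211111: "copies_cover [2, 1, 1, 1, 1, 1]
    [([0, 1, 2], [], [20, 10, 30, 50, 40, 1, 0]),
     ([0, 1, 2], [], [10, 50, 40, 20, 1, 30, 0]),
     ([0, 1, 2], [], [20, 50, 40, 0, 10, 30, 1]),
     ([0, 1, 2], [], [50, 30, 40, 0, 10, 20, 1]),
     ([0, 1, 2], [], [20, 10, 30, 0, 50, 40, 1]),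
     ([0, 1, 2], [], [10, 0, 1, 50, 20, 40, 30])]"
  by code_simp

text \<open>The end in B of the deleted edge takes the place of the new vertex, which needs only its
  edges to the three vertices of A.\<close>

lemma linked_3211_bc:
  "copies_cover_between [3, 2, 1, 1] 1 2
    [([0, 1, 2], [], [1, 0, 2, 30, 20, 10, 11]), ([0, 1, 2], [], [0, 1, 2, 30, 11, 20, 10])]"
  by code_simp

text \<open>The two vertices of B and the one of C form the triangle that the move removes, so no
  edge between B and C is used.\<close>

lemma linked_22111_bc:
  "copies_cover_between [2, 2, 1, 1, 1] 1 2
    [([0, 1, 2], [], [20, 10, 11, 1, 40, 30, 0]), ([0, 1, 2], [], [20, 10, 11, 1, 40, 30, 0])]"
  by code_simp

lemma linked_31111_bc:
  "copies_cover_between [3, 1, 1, 1, 1] 1 2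
    [([0, 1, 2], [], [2, 0, 1, 10, 30, 40, 20])]"
  by code_simp

lemma edges_complete_graphI: "u < m \<Longrightarrow> v < m \<Longrightarrow> u \<noteq> v \<Longrightarrow> {u, v} \<in> edges (complete_graph m)"
  unfolding edges_def complete_graph_def snd_conv by (rule CollectI, rule exI[of _ u], rule exI[of _ v], intro conjI refl)

lemma edges_delete_edgeI: "d \<in> edges G \<Longrightarrow> d \<noteq> e \<Longrightarrow> d \<in> edges (delete_edge G e)"
  by (simp add: delete_edge_def edges_def)

lemma linked_K7:
  assumes "e \<in> edges (complete_graph 7)"
  shows "intrinsically_linked (delete_edge (complete_graph 7) e)"
proof -
  obtain u v where uv: "e = {u, v}" "u < 7" "v < 7" "u \<noteq> v"
    using assms by (auto simp: edges_def complete_graph_def)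
  let ?f = "\<lambda>i. if i < u then i else i + 1"
  have ok: "dw_ok [] []" by (simp add: dw_ok_def)
  show ?thesis
  proof (rule intrinsically_linked_mono[OF simple_graph_dw[OF ok] dw_graph_linked[OF ok]])
    show "inj_on ?f (verts (dw_graph [] []))" by (auto simp: inj_on_def)
    show "?f ` verts (dw_graph [] []) \<subseteq> verts (delete_edge (complete_graph 7) e)"
      by (auto simp: verts_def dw_graph_def dw_size_def delete_edge_def complete_graph_def)
    fix e' assume "e' \<in> edges (dw_graph [] [])"
    then obtain a b where ab: "e' = {a, b}" "a < b" "b < 6"
      by (auto simp: edges_def dw_graph_def dw_edges_def)
    have "?f a \<noteq> ?f b" "?f a \<noteq> u" "?f b \<noteq> u" "?f a < 7" "?f b < 7" using ab by auto
    have "{?f a, ?f b} \<in> edges (complete_graph 7)" by (rule edges_complete_graphI) fact+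
    moreover have "{?f a, ?f b} \<noteq> e"
    proof
      assume "{?f a, ?f b} = e"
      then have "u \<in> {?f a, ?f b}" unfolding uv(1) by (metis insertI1)
      then show False using \<open>?f a \<noteq> u\<close> \<open>?f b \<noteq> u\<close> by (metis insertE singletonD)
    qed
    ultimately show "?f ` e' \<in> edges (delete_edge (complete_graph 7) e)"
      unfolding ab(1) image_insert image_empty by (rule edges_delete_edgeI)
  qed
qed

text \<open>One vertex from each of six parts, leaving out the part \<open>k\<close> of one end of
  the deleted edge, spans a K6 that the deletion does not touch.\<close>

lemma linked_seven_parts:
  assumes ns: "length ns \<ge> 7" "\<forall>m\<in>set ns. m \<ge> 1" and e: "e \<in> edges (complete_partite ns)"
  shows "intrinsically_linked (delete_edge (complete_partite ns) e)"
proof -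
  obtain x y where xy: "e = {x, y}" using e unfolding edges_complete_partite by blast
  obtain k where k: "k = fst x" by blast
  let ?g = "\<lambda>i. if i < k then i else i + 1"
  let ?f = "\<lambda>i. (?g i, 0::nat)"
  have ok: "dw_ok [] []" by (simp add: dw_ok_def)
  have vx: "is_vertex ns (?f i)" if "i < 6" for i
  proof -
    have l: "?g i < length ns" using that ns(1) by auto
    then have "ns ! ?g i \<ge> 1" using ns(2) nth_mem by blast
    then show ?thesis using l by (simp add: is_vertex_def)
  qed
  show ?thesis
  proof (rule intrinsically_linked_mono[OF simple_graph_dw[OF ok] dw_graph_linked[OF ok]])
    show "inj_on ?f (verts (dw_graph [] []))" by (auto simp: inj_on_def)
    have "verts (dw_graph [] []) = {..<6}" by (simp add: verts_def dw_graph_def dw_size_def)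
    moreover have "verts (delete_edge (complete_partite ns) e) = {x. is_vertex ns x}"
      unfolding verts_complete_partite[symmetric] by (simp add: delete_edge_def verts_def)
    ultimately show "?f ` verts (dw_graph [] []) \<subseteq> verts (delete_edge (complete_partite ns) e)"
      using vx by blast
    fix e' assume "e' \<in> edges (dw_graph [] [])"
    then obtain a b where ab: "e' = {a, b}" "a < b" "b < 6"
      by (auto simp: edges_def dw_graph_def dw_edges_def)
    have "?g a \<noteq> ?g b" "?g a \<noteq> k" "?g b \<noteq> k" using ab by auto
    have "is_vertex ns (?f a)" "is_vertex ns (?f b)" using vx ab by simp_all
    moreover have "fst (?f a) \<noteq> fst (?f b)" using \<open>?g a \<noteq> ?g b\<close> by (simp only: fst_conv not_False_eq_True)
    ultimately have "{?f a, ?f b} \<in> edges (complete_partite ns)"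
      unfolding edges_complete_partite by (intro CollectI exI[of _ "?f a"] exI[of _ "?f b"] conjI refl)
    moreover have "{?f a, ?f b} \<noteq> e"
    proof
      assume "{?f a, ?f b} = e"
      then have "x \<in> {?f a, ?f b}" unfolding xy by (metis insertI1)
      then have "fst x \<in> {?g a, ?g b}" by (elim insertE emptyE) (simp_all only: fst_conv insert_iff simp_thms)
      then have "k = ?g a \<or> k = ?g b" unfolding k[symmetric] by blast
      then show False using \<open>?g a \<noteq> k\<close> \<open>?g b \<noteq> k\<close> by metis
    qed
    ultimately show "?f ` e' \<in> edges (delete_edge (complete_partite ns) e)"
      unfolding ab(1) image_insert image_empty by (rule edges_delete_edgeI)
  qed
qed

section \<open>Unlinked straight embeddings\<close>

lemma split_link_sym: "split_link K1 K2 \<Longrightarrow> split_link K2 K1"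
  unfolding split_link_def by (metis Un_commute connected_component_sym)

text \<open>The sphere is the frontier of the closed neighbourhood of \<open>T\<close> with half the
  distance to \<open>K2\<close> as radius. The thickening supplies the interior that a flat
  \<open>T\<close> does not have, so the frontier of this convex body is a sphere.\<close>

lemma split_link_convex:
  fixes T :: "(real^3) set"
  assumes T: "compact T" "convex T" "T \<noteq> {}" and K: "K1 \<subseteq> T" "compact K2" "K2 \<inter> T = {}"
  shows "split_link K1 K2"
proof -
  obtain d where d: "d > 0" "\<And>x y. x \<in> T \<Longrightarrow> y \<in> K2 \<Longrightarrow> d \<le> dist x y"
    using separate_compact_closed[OF T(1) compact_imp_closed[OF K(2)]] K(3) by (metis inf_commute)
  define C where "C = (\<Union>x\<in>T. \<Union>y\<in>cball 0 (d / 2). {x + y})"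
  have C: "C = {x + y |x y. x \<in> T \<and> y \<in> cball 0 (d / 2)}" unfolding C_def by blast
  have comp: "compact C" unfolding C by (rule compact_sums[OF T(1) compact_cball])
  have conv: "convex C" unfolding C_def by (rule convex_sums[OF T(2) convex_cball])
  have ball: "ball x (d / 2) \<subseteq> C" if "x \<in> T" for x
  proof
    fix z assume "z \<in> ball x (d / 2)"
    then have "z = x + (z - x)" "z - x \<in> cball 0 (d / 2)" by (auto simp: dist_norm norm_minus_commute)
    then show "z \<in> C" unfolding C using that by blast
  qed
  then have TI: "T \<subseteq> interior C" using d(1) by (meson centre_in_ball half_gt_zero interior_maximal open_ball subset_iff)
  then have ne: "interior C \<noteq> {}" using T(3) by blast
  have disj: "K2 \<inter> C = {}"
  proof (rule equals0I)
    fix z assume "z \<in> K2 \<inter> C"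
    then obtain x y where "z = x + y" "x \<in> T" "y \<in> cball 0 (d / 2)" "z \<in> K2" unfolding C by blast
    then have "dist x z \<le> d / 2" by (simp add: dist_norm)
    then show False using d(2)[OF \<open>x \<in> T\<close> \<open>z \<in> K2\<close>] d(1) by linarith
  qed
  have fr: "frontier C \<subseteq> C" using comp by (simp add: compact_imp_closed frontier_subset_closed)
  have "rel_frontier C homeomorphic rel_frontier (cball (0::real^3) 1)"
    by (rule homeomorphic_rel_frontiers_convex_bounded_sets[OF conv compact_imp_bounded[OF comp] convex_cball bounded_cball])
       (simp add: aff_dim_nonempty_interior ne)
  then have hom: "frontier C homeomorphic sphere (0::real^3) 1"
    by (simp add: rel_frontier_nonempty_interior ne)
  show ?thesis unfolding split_link_def
  proof (intro exI[of _ "frontier C"] conjI ballI notI)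
    have "K1 \<inter> frontier C = {}" using K(1) TI by (auto simp: frontier_def)
    then show "frontier C \<inter> (K1 \<union> K2) = {}" using disj fr by blast
    fix x y assume xy: "x \<in> K1" "y \<in> K2" "connected_component (- frontier C) x y"
    then obtain X where X: "connected X" "X \<subseteq> - frontier C" "x \<in> X" "y \<in> X"
      unfolding connected_component_def by blast
    have "x \<in> C" using xy(1) K(1) TI interior_subset by blast
    moreover have "y \<notin> C" using xy(2) disj by blast
    ultimately have "X \<inter> frontier C \<noteq> {}" using X by (intro connected_Int_frontier) auto
    then show False using X(2) by blast
  qed (rule hom)
qed

lemma det3_linear_first:
  "det3 (c *\<^sub>R x) a b = c * det3 x a b" "det3 a (c *\<^sub>R x) b = c * det3 a x b"
  by (simp_all add: det3_def algebra_simps)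

text \<open>If no four vertices are coplanar, disjoint edges cannot meet. A vertex outside any given
  three shows, moreover, that these are not collinear, so edges with a common end meet only there;
  this is what the bound of four vertices provides.\<close>

lemma straight_embedding:
  fixes p :: "'a \<Rightarrow> real^3"
  assumes G: "simple_graph G" and four: "card (verts G) \<ge> 4"
    and gp: "\<And>a b c d. {a, b, c, d} \<subseteq> verts G \<Longrightarrow> distinct [a, b, c, d] \<Longrightarrow> det3 (p b - p a) (p c - p a) (p d - p a) \<noteq> 0"
  obtains \<gamma> where "tame_embedding G p \<gamma>" "\<forall>u v. {u, v} \<in> edges G \<longrightarrow> path_image (\<gamma> {u, v}) = closed_segment (p u) (p v)"
proof -
  have fin: "finite (verts G)" using G by (simp add: simple_graph_def)
  have fourth: "\<exists>d\<in>verts G. d \<notin> {a, b, c}" for a b c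
  proof (rule ccontr)
    assume "\<not> ?thesis"
    then have "verts G \<subseteq> {a, b, c}" by blast
    then have "card (verts G) \<le> card {a, b, c}" by (intro card_mono) auto
    also have "\<dots> \<le> 3" using card_length[of "[a, b, c]"] by simp
    finally show False using four by simp
  qed
  have indep: "s = 0" if abc: "{a, b, c} \<subseteq> verts G" "distinct [a, b, c]" and e: "s *\<^sub>R (p b - p a) = t *\<^sub>R (p c - p a)" for a b c s t
  proof -
    obtain d where d: "d \<in> verts G" "d \<notin> {a, b, c}" using fourth by blast
    have "s * det3 (p b - p a) (p c - p a) (p d - p a) = det3 (t *\<^sub>R (p c - p a)) (p c - p a) (p d - p a)"
      unfolding e[symmetric] by (simp add: det3_linear_first)
    also have "\<dots> = 0" by (simp add: det3_linear_first)
    finally show ?thesis using gp[of a b c d] abc d by auto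
  qed
  have inj: "inj_on p (verts G)"
  proof (rule inj_onI, rule ccontr)
    fix a b assume ab: "a \<in> verts G" "b \<in> verts G" "p a = p b" "a \<noteq> b"
    obtain c where c: "c \<in> verts G" "c \<notin> {a, b, b}" using fourth by blast
    have "(1::real) = 0" by (rule indep[of a b c 1 0]) (use ab c in auto)
    then show False by simp
  qed
  have "\<forall>e\<in>edges G. \<exists>z. e = {fst z, snd z} \<and> fst z \<noteq> snd z \<and> fst z \<in> verts G \<and> snd z \<in> verts G"
    using G unfolding simple_graph_def by fastforce
  from bchoice[OF this] obtain z where z: "\<forall>e\<in>edges G. e = {fst (z e), snd (z e)} \<and> fst (z e) \<noteq> snd (z e) \<and>
     fst (z e) \<in> verts G \<and> snd (z e) \<in> verts G" by (elim exE) (rule that)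
  define \<gamma> where "\<gamma> e = linepath (p (fst (z e))) (p (snd (z e)))" for e
  have pi: "path_image (\<gamma> {u, v}) = closed_segment (p u) (p v)" if "{u, v} \<in> edges G" for u v
  proof -
    define a b where "a = fst (z {u, v})" and "b = snd (z {u, v})"
    have "{u, v} = {a, b}" unfolding a_def b_def by (rule bspec[OF z that, THEN conjunct1])
    moreover have "path_image (\<gamma> {u, v}) = closed_segment (p a) (p b)" by (simp add: \<gamma>_def a_def b_def)
    ultimately show ?thesis by (auto simp: doubleton_eq_iff closed_segment_commute)
  qed
  have ends: "\<exists>u v. e = {u, v} \<and> u \<noteq> v \<and> u \<in> verts G \<and> v \<in> verts G" if "e \<in> edges G" for e
    using G that unfolding simple_graph_def by blast
  have "tame_embedding G p \<gamma>" unfolding tame_embedding_def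
  proof (intro conjI ballI impI)
    show "inj_on p (verts G)" by (rule inj)
  next
    fix e assume e: "e \<in> edges G"
    have ze: "e = {fst (z e), snd (z e)}" "fst (z e) \<noteq> snd (z e)" "fst (z e) \<in> verts G" "snd (z e) \<in> verts G"
      using bspec[OF z e] by blast+
    have "p (fst (z e)) \<noteq> p (snd (z e))" using inj ze(2-4) by (auto simp: inj_on_def)
    then show "arc (\<gamma> e)" unfolding \<gamma>_def by (rule arc_linepath)
    have "p ` e = p ` {fst (z e), snd (z e)}" using ze(1) by (rule arg_cong)
    then show "{pathstart (\<gamma> e), pathfinish (\<gamma> e)} = p ` e" by (simp add: \<gamma>_def)
    show "\<exists>F :: ((real^3) \<times> (real^3)) set. finite F \<and> path_image (\<gamma> e) = (\<Union>(a, b)\<in>F. closed_segment a b)"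
      by (intro exI[of _ "{(p (fst (z e)), p (snd (z e)))}"]) (simp add: \<gamma>_def)
    fix v assume v: "v \<in> verts G" "p v \<in> path_image (\<gamma> e)"
    obtain a b where ab: "e = {a, b}" "a \<noteq> b" "a \<in> verts G" "b \<in> verts G" using ends[OF e] by blast
    show "v \<in> e"
    proof (rule ccontr)
      assume nv: "v \<notin> e"
      have "p v \<in> closed_segment (p a) (p b)" using v(2) pi[of a b] e unfolding ab(1) by simp
      then obtain t where t: "p v = (1 - t) *\<^sub>R p a + t *\<^sub>R p b" by (auto simp: closed_segment_def)
      have "(1::real) = 0"
        by (rule indep[of a v b 1 t]) (use ab v nv in \<open>auto simp: t algebra_simps\<close>)
      then show False by simp
    qed
  next
    fix e e' assume e: "e \<in> edges G" "e' \<in> edges G" "e \<noteq> e'"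
    show "path_image (\<gamma> e) \<inter> path_image (\<gamma> e') \<subseteq> p ` (e \<inter> e')"
    proof (cases "e \<inter> e' = {}")
      case True
      obtain a b where ab: "e = {a, b}" "a \<noteq> b" "a \<in> verts G" "b \<in> verts G" using ends[OF e(1)] by blast
      obtain c d where cd: "e' = {c, d}" "c \<noteq> d" "c \<in> verts G" "d \<in> verts G" using ends[OF e(2)] by blast
      let ?D = "det3 (p b - p a) (p c - p a) (p d - p a)"
      have D: "?D \<noteq> 0" using gp[of a b c d] ab cd True by auto
      have "x \<notin> path_image (\<gamma> e')" if xe: "x \<in> path_image (\<gamma> e)" for x
      proof
        assume "x \<in> path_image (\<gamma> e')"
        then obtain t where t: "x = (1 - t) *\<^sub>R p c + t *\<^sub>R p d"
          using pi[of c d] e(2) unfolding cd(1) by (auto simp: closed_segment_def)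
        obtain s where s: "x = (1 - s) *\<^sub>R p a + s *\<^sub>R p b"
          using xe pi[of a b] e(1) unfolding ab(1) by (auto simp: closed_segment_def)
        have r: "s *\<^sub>R (p b - p a) = (1 - t) *\<^sub>R (p c - p a) + t *\<^sub>R (p d - p a)"
          using s t by (simp add: algebra_simps)
        have "0 = det3 (p b - p a) (p c - p a) (s *\<^sub>R (p b - p a))" by (simp add: det3_linear_third)
        also have "\<dots> = t * ?D" unfolding r by (simp add: det3_linear_third)
        finally have "t = 0" using D by simp
        have "0 = det3 (p b - p a) (s *\<^sub>R (p b - p a)) (p d - p a)" by (simp add: det3_linear_first)
        also have "\<dots> = (1 - t) * ?D" unfolding r \<open>t = 0\<close> by simp
        finally show False using D \<open>t = 0\<close> by simp
      qed
      then show ?thesis by blast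
    next
      case False
      then obtain a where a: "a \<in> e" "a \<in> e'" by blast
      obtain b where b: "e = {a, b}" "a \<noteq> b" "a \<in> verts G" "b \<in> verts G"
        using ends[OF e(1)] a(1) by (metis insert_commute insertE singletonD)
      obtain c where c: "e' = {a, c}" "a \<noteq> c" "c \<in> verts G"
        using ends[OF e(2)] a(2) by (metis insert_commute insertE singletonD)
      have bc: "b \<noteq> c" using e(3) b(1) c(1) by blast
      show ?thesis
      proof
        fix x assume x: "x \<in> path_image (\<gamma> e) \<inter> path_image (\<gamma> e')"
        obtain s where s: "x = (1 - s) *\<^sub>R p a + s *\<^sub>R p b"
          using x pi[of a b] e(1) unfolding b(1) by (auto simp: closed_segment_def)
        obtain t where t: "x = (1 - t) *\<^sub>R p a + t *\<^sub>R p c"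
          using x pi[of a c] e(2) unfolding c(1) by (auto simp: closed_segment_def)
        have "s *\<^sub>R (p b - p a) = t *\<^sub>R (p c - p a)" using s t by (simp add: algebra_simps)
        then have "s = 0" by (rule indep[rotated 2]) (use b c bc in auto)
        then have "x = p a" using s by simp
        then show "x \<in> p ` (e \<inter> e')" using a by blast
      qed
    qed
  qed
  moreover have "\<forall>u v. {u, v} \<in> edges G \<longrightarrow> path_image (\<gamma> {u, v}) = closed_segment (p u) (p v)"
    using pi by blast
  ultimately show thesis by (rule that)
qed

section \<open>Graphs without disjoint cycles\<close>

lemma not_linked_without_disjoint_cycles:
  assumes G: "simple_graph G" "card (verts G) \<ge> 4"
    and no: "\<And>c1 c2. is_cycle G c1 \<Longrightarrow> is_cycle G c2 \<Longrightarrow> set c1 \<inter> set c2 \<noteq> {}"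
  shows "\<not> intrinsically_linked G"
proof -
  have "finite (verts G)" using G(1) by (simp add: simple_graph_def)
  \<comment> \<open>Some embedding has to be exhibited, since a graph without any would be linked
    vacuously. Perturbing the constant map already yields vertices in general position.\<close>
  then obtain p :: "'a \<Rightarrow> real^3" where p: "\<And>i j k l. {i, j, k, l} \<subseteq> verts G \<Longrightarrow> distinct [i, j, k, l] \<Longrightarrow>
        det3 (p j - p i) (p k - p i) (p l - p i) \<noteq> 0"
    by (rule perturb_general_position[of "verts G" 1 "\<lambda>_. 0"]) auto
  obtain \<gamma> where "tame_embedding G p \<gamma>" by (rule straight_embedding[OF G p])
  then show ?thesis using no unfolding intrinsically_linked_def by blast
qed

text \<open>Of two consecutive vertices one lies in the cover \<open>B\<close>. If
  \<open>c ! 1\<close> is outside, both its neighbours are inside; otherwise the edge following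
  \<open>c ! 2\<close> provides a second vertex.\<close>

lemma cycle_meets_cover_twice:
  assumes c: "is_cycle G c" and cov: "\<And>u v. {u, v} \<in> edges G \<Longrightarrow> u \<in> B \<or> v \<in> B"
  shows "2 \<le> card (set c \<inter> B)"
proof -
  have len: "length c \<ge> 3" and dist: "distinct c" using c by (auto simp: is_cycle_def)
  have e: "c ! i \<in> B \<or> c ! (Suc i mod length c) \<in> B" if "i < length c" for i
    using c that cov unfolding is_cycle_def by blast
  have "\<exists>i j. i < length c \<and> j < length c \<and> i \<noteq> j \<and> c ! i \<in> B \<and> c ! j \<in> B"
  proof (cases "c ! 1 \<in> B")
    case True
    \<comment> \<open>The successor of \<open>c ! 2\<close> has index 0 in a triangle and 3 in a
      longer cycle; it never is \<open>c ! 1\<close>.\<close>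
    have m: "3 mod length c \<noteq> 1" "3 mod length c < length c" using len by (cases "length c = 3"; simp)+
    have "c ! 2 \<in> B \<or> c ! (3 mod length c) \<in> B" using e[of 2] len by simp
    then show ?thesis
    proof
      assume "c ! 2 \<in> B"
      then show ?thesis using True len by (intro exI[of _ 1] exI[of _ 2]) simp
    next
      assume "c ! (3 mod length c) \<in> B"
      then show ?thesis using True len m by (intro exI[of _ 1] exI[of _ "3 mod length c"]) simp
    qed
  next
    case False
    have "c \<noteq> []" using len by auto
    then have "c ! 0 \<in> B" "c ! 2 \<in> B" using False e[of 0] e[of 1] len by (auto simp: numeral_2_eq_2 numeral_3_eq_3 Suc_le_eq)
    then show ?thesis using len by (intro exI[of _ 0] exI[of _ 2]) auto
  qed
  then obtain i j where ij: "i < length c" "j < length c" "i \<noteq> j" "c ! i \<in> B" "c ! j \<in> B" by blast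
  then have "card {c ! i, c ! j} = 2" using dist by (simp add: nth_eq_iff_index_eq)
  moreover have "{c ! i, c ! j} \<subseteq> set c \<inter> B" using ij by auto
  ultimately show ?thesis by (metis card_mono finite_Int finite_set)
qed

lemma simple_graph_complete_partite: "simple_graph (delete_edge (complete_partite ns) e)"
proof -
  have "finite (verts (complete_partite ns))"
  proof (rule finite_subset)
    show "verts (complete_partite ns) \<subseteq> (SIGMA i:{..<length ns}. {..<ns ! i})"
      by (auto simp: verts_complete_partite is_vertex_def)
  qed auto
  then have "finite (verts (delete_edge (complete_partite ns) e))" by (simp add: delete_edge_def verts_def)
  moreover have "verts (delete_edge (complete_partite ns) e) = {x. is_vertex ns x}"
    unfolding verts_complete_partite[symmetric] by (simp add: delete_edge_def verts_def)
  moreover have "\<exists>u v. e' = {u, v} \<and> u \<noteq> v \<and> is_vertex ns u \<and> is_vertex ns v"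
    if "e' \<in> edges (delete_edge (complete_partite ns) e)" for e'
  proof -
    have "e' \<in> edges (complete_partite ns)" using that by (simp add: delete_edge_def edges_def)
    then obtain u v where "e' = {u, v}" "is_vertex ns u" "is_vertex ns v" "fst u \<noteq> fst v"
      unfolding edges_complete_partite by blast
    then show ?thesis by (intro exI[of _ u] exI[of _ v]) auto
  qed
  ultimately show ?thesis unfolding simple_graph_def by simp
qed

lemma not_linked_three_off_one_part:
  assumes n: "n \<ge> 1" and B: "card {x. is_vertex (n # ns) x \<and> fst x \<noteq> 0} = 3"
  shows "\<not> intrinsically_linked (delete_edge (complete_partite (n # ns)) e)"
proof (rule not_linked_without_disjoint_cycles)
  let ?G = "delete_edge (complete_partite (n # ns)) e"
  let ?B = "{x. is_vertex (n # ns) x \<and> fst x \<noteq> 0}"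
  show sg: "simple_graph ?G" by (rule simple_graph_complete_partite)
  have v: "verts ?G = {x. is_vertex (n # ns) x}"
    unfolding verts_complete_partite[symmetric] by (simp add: delete_edge_def verts_def)
  have fin: "finite (verts ?G)" using sg by (simp add: simple_graph_def)
  have finB: "finite ?B" using B by (metis card.infinite zero_neq_numeral)
  have "insert (0, 0) ?B \<subseteq> verts ?G" using n unfolding v by (auto simp: is_vertex_def)
  then have "card (insert (0, 0) ?B) \<le> card (verts ?G)" using fin by (rule card_mono[rotated])
  then show "4 \<le> card (verts ?G)" using B finB by simp
  fix c1 c2 assume c: "is_cycle ?G c1" "is_cycle ?G c2"
  have cov: "u \<in> ?B \<or> v \<in> ?B" if "{u, v} \<in> edges ?G" for u v
  proof -
    have "{u, v} \<in> edges (complete_partite (n # ns))" using that by (simp add: delete_edge_def edges_def)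
    then show ?thesis unfolding edges_complete_partite by (auto simp: doubleton_eq_iff)
  qed
  show "set c1 \<inter> set c2 \<noteq> {}"
  proof
    assume "set c1 \<inter> set c2 = {}"
    then have "card ((set c1 \<inter> ?B) \<union> (set c2 \<inter> ?B)) = card (set c1 \<inter> ?B) + card (set c2 \<inter> ?B)"
      by (intro card_Un_disjoint) auto
    moreover have "card ((set c1 \<inter> ?B) \<union> (set c2 \<inter> ?B)) \<le> card ?B" using finB by (intro card_mono) auto
    ultimately show False using cycle_meets_cover_twice[OF c(1) cov] cycle_meets_cover_twice[OF c(2) cov] B by linarith
  qed
qed

section \<open>Straight embeddings whose triangles bound empty flat discs\<close>

lemma segment_misses_triangle:
  fixes A B C U W :: "real^3"
  defines "g \<equiv> \<lambda>Y Z. det3 (W - U) (Y - U) (Z - U)" and "h \<equiv> \<lambda>X. det3 (B - A) (C - A) (X - A)"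
  assumes nz: "g B C \<noteq> 0" "g C A \<noteq> 0" "g A B \<noteq> 0"
    and miss: "h U * h W > 0 \<or> \<not> (g B C * g A B > 0 \<and> g C A * g A B > 0)"
  shows "closed_segment U W \<inter> convex hull {A, B, C} = {}"
proof (rule equals0I)
  fix x assume x: "x \<in> closed_segment U W \<inter> convex hull {A, B, C}"
  from x[THEN IntD1] obtain t where t: "0 \<le> t" "t \<le> 1" "x = (1 - t) *\<^sub>R U + t *\<^sub>R W"
    unfolding closed_segment_def by blast
  obtain \<alpha> \<beta> \<gamma> where bc: "0 \<le> \<alpha>" "0 \<le> \<beta>" "0 \<le> \<gamma>" "\<alpha> + \<beta> + \<gamma> = 1" "x = \<alpha> *\<^sub>R A + \<beta> *\<^sub>R B + \<gamma> *\<^sub>R C"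
    using x[THEN IntD2] unfolding convex_hull_3 by blast
  have xA: "x - A = \<beta> *\<^sub>R (B - A) + \<gamma> *\<^sub>R (C - A)"
  proof -
    have \<alpha>: "\<alpha> = 1 - \<beta> - \<gamma>" using bc(4) by simp
    show ?thesis unfolding bc(5) \<alpha> by (simp add: algebra_simps)
  qed
  have xU: "t *\<^sub>R (W - U) = \<alpha> *\<^sub>R (A - U) + \<beta> *\<^sub>R (B - U) + \<gamma> *\<^sub>R (C - U)"
  proof -
    have \<alpha>: "\<alpha> = 1 - \<beta> - \<gamma>" using bc(4) by simp
    have "t *\<^sub>R (W - U) = x - U" unfolding t(3) by (simp add: algebra_simps)
    then show ?thesis unfolding bc(5) \<alpha> by (simp add: algebra_simps)
  qed
  \<comment> \<open>Taking determinants of \<open>xU\<close> with \<open>W - U\<close> kills the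
    left side. What remains says that the barycentric coordinates of a common point are proportional
    to \<open>g B C\<close>, \<open>g C A\<close>, \<open>g A B\<close>, so these have one sign; the
    second alternative in \<open>miss\<close> is thereby refuted, and \<open>h\<close> refutes the
    first.\<close>
  have rel: "\<alpha> * g A Z + \<beta> * g B Z + \<gamma> * g C Z = 0" for Z
  proof -
    have "0 = det3 (W - U) (t *\<^sub>R (W - U)) (Z - U)" by (simp add: det3_linear_first)
    also have "\<dots> = \<alpha> * g A Z + \<beta> * g B Z + \<gamma> * g C Z"
      unfolding xU g_def by (simp add: det3_def algebra_simps)
    finally show ?thesis by simp
  qed
  have sw: "g Y Z = - g Z Y" "g Y Y = 0" for Y Z by (simp_all add: g_def det3_def algebra_simps)
  have r1: "\<beta> * g A B = \<gamma> * g C A" using rel[of A] sw(1)[of B A] sw(2) by simp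
  have r2: "\<alpha> * g A B = \<gamma> * g B C" using rel[of B] sw(1)[of C B] sw(2) by simp
  have "\<gamma> \<noteq> 0" using r1 r2 nz(3) bc(4) by auto
  then have \<gamma>: "\<gamma> > 0" using bc(3) by simp
  have "g C A * g A B = \<beta> / \<gamma> * (g A B * g A B)" "g B C * g A B = \<alpha> / \<gamma> * (g A B * g A B)"
    using r1 r2 \<gamma> by (simp_all add: field_simps)
  then have "g C A * g A B \<ge> 0" "g B C * g A B \<ge> 0" using bc(1,2) \<gamma> by simp_all
  then have "g B C * g A B > 0 \<and> g C A * g A B > 0" using nz by (metis less_eq_real_def mult_eq_0_iff)
  then have hh: "h U * h W > 0" using miss by blast
  have "h x = 0" unfolding h_def xA by (simp add: det3_linear_third)
  moreover have "h x = (1 - t) * h U + t * h W"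
    unfolding h_def t(3) by (simp add: det3_def algebra_simps)
  ultimately have z: "(1 - t) * h U + t * h W = 0" by simp
  have "(1 - t) * (h U * h U) + t * (h U * h W) = h U * ((1 - t) * h U + t * h W)" by (simp add: algebra_simps)
  also have "\<dots> = 0" using z by simp
  finally have "(1 - t) * (h U * h U) + t * (h U * h W) = 0" .
  moreover have "h U * h U > 0" using hh by (metis mult_eq_0_iff not_real_square_gt_zero less_irrefl)
  then have "(1 - t) * (h U * h U) + t * (h U * h W) > 0"
    using t hh by (cases "t = 0") (auto intro!: add_nonneg_pos)
  ultimately show False by simp
qed

lemma not_linked_panelled:
  fixes p :: "'a \<Rightarrow> real^3"
  assumes G: "simple_graph G" and seven: "card (verts G) = 7"
    and gp: "\<And>a b c d. {a, b, c, d} \<subseteq> verts G \<Longrightarrow> distinct [a, b, c, d] \<Longrightarrow> det3 (p b - p a) (p c - p a) (p d - p a) \<noteq> 0"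
    and panel: "\<And>a b c u v. distinct [a, b, c, u, v] \<Longrightarrow> {a, b} \<in> edges G \<Longrightarrow> {b, c} \<in> edges G \<Longrightarrow> {c, a} \<in> edges G \<Longrightarrow>
      {u, v} \<in> edges G \<Longrightarrow> closed_segment (p u) (p v) \<inter> convex hull {p a, p b, p c} = {}"
  shows "\<not> intrinsically_linked G"
proof
  assume lk: "intrinsically_linked G"
  have four: "card (verts G) \<ge> 4" using seven by simp
  obtain \<gamma> where tame: "tame_embedding G p \<gamma>"
    and "\<forall>u v. {u, v} \<in> edges G \<longrightarrow> path_image (\<gamma> {u, v}) = closed_segment (p u) (p v)"
    by (rule straight_embedding[OF G four gp])
  then have pi: "\<And>u v. {u, v} \<in> edges G \<Longrightarrow> path_image (\<gamma> {u, v}) = closed_segment (p u) (p v)" by simp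
  have tri: "split_link (cycle_image \<gamma> c1) (cycle_image \<gamma> c2)"
    if c: "is_cycle G c1" "is_cycle G c2" "set c1 \<inter> set c2 = {}" "length c1 = 3" for c1 c2
  proof -
    obtain a b d where abd: "c1 = [a, b, d]"
      using c(4) by (auto simp: numeral_3_eq_3 length_Suc_conv)
    let ?T = "convex hull {p a, p b, p d}"
    have cp: "cyc_pairs c1 = [(a, b), (b, d), (d, a)]" by (simp add: abd cyc_pairs_def)
    have E: "{a, b} \<in> edges G" "{b, d} \<in> edges G" "{d, a} \<in> edges G"
      by (rule cyc_pairs_edge(1)[OF c(1)]; simp add: cp)+
    have ce: "cycle_edges c1 = {{a, b}, {b, d}, {d, a}}"
      unfolding set_cyc_pairs_edges[symmetric] cp by simp
    have sub: "cycle_image \<gamma> c1 \<subseteq> ?T"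
    proof -
      have "closed_segment (p a) (p b) \<subseteq> ?T" "closed_segment (p b) (p d) \<subseteq> ?T" "closed_segment (p d) (p a) \<subseteq> ?T"
        unfolding segment_convex_hull by (intro hull_mono; blast)+
      then show ?thesis unfolding cycle_image_def ce using pi[OF E(1)] pi[OF E(2)] pi[OF E(3)] by simp
    qed
    have "path_image (\<gamma> e) \<inter> ?T = {}" if "e \<in> cycle_edges c2" for e
    proof -
      obtain u v where uv: "(u, v) \<in> set (cyc_pairs c2)" "e = {u, v}"
        using \<open>e \<in> cycle_edges c2\<close> unfolding set_cyc_pairs_edges[symmetric] by auto
      note f = cyc_pairs_edge[OF c(2) uv(1)]
      have "u \<noteq> v" using G f(1) unfolding simple_graph_def by (metis doubleton_eq_iff)
      moreover have "distinct [a, b, d]" using c(1) by (simp add: abd is_cycle_def)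
      ultimately have "distinct [a, b, d, u, v]" using c(3) f(2,3) unfolding abd by auto
      then show ?thesis using panel[OF _ E f(1)] pi[OF f(1)] uv(2) by simp
    qed
    then have "cycle_image \<gamma> c2 \<inter> ?T = {}" unfolding cycle_image_def by blast
    then show ?thesis
      using sub cycle_image_compact[OF c(2) tame]
      by (intro split_link_convex[of ?T]) (auto intro: compact_convex_hull)
  qed
  obtain c1 c2 where c: "is_cycle G c1" "is_cycle G c2" "set c1 \<inter> set c2 = {}"
    "\<not> split_link (cycle_image \<gamma> c1) (cycle_image \<gamma> c2)"
    using lk tame unfolding intrinsically_linked_def by blast
  have fin: "finite (verts G)" using G by (simp add: simple_graph_def)
  have cl: "card (set c) = length c" "set c \<subseteq> verts G" "3 \<le> length c" if "is_cycle G c" for c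
    using that by (auto simp: is_cycle_def distinct_card)
  have "card (set c1 \<union> set c2) \<le> 7" using card_mono[OF fin, of "set c1 \<union> set c2"] cl(2) c seven by auto
  then have "length c1 + length c2 \<le> 7" using card_Un_disjoint[of "set c1" "set c2"] c(3) cl(1) c(1,2) by simp
  then have "length c1 = 3 \<or> length c2 = 3" using cl(3)[OF c(1)] cl(3)[OF c(2)] by linarith
  then show False
  proof
    assume "length c1 = 3"
    then show False using tri[OF c(1,2,3)] c(4) by blast
  next
    assume "length c2 = 3"
    then show False using tri[OF c(2,1)] c(3,4) split_link_sym by (metis inf_commute)
  qed
qed

section \<open>Integer coordinates and decidable checks\<close>

type_synonym int_point = "int \<times> int \<times> int"

definition int_vec :: "int_point \<Rightarrow> real^3" where
  "int_vec t = (case t of (x, y, z) \<Rightarrow> vector [of_int x, of_int y, of_int z])"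

fun int_det :: "int_point \<Rightarrow> int_point \<Rightarrow> int_point \<Rightarrow> int_point \<Rightarrow> int" where
  "int_det (a1, a2, a3) (b1, b2, b3) (c1, c2, c3) (d1, d2, d3) =
     (b1 - a1) * ((c2 - a2) * (d3 - a3) - (c3 - a3) * (d2 - a2))
     - (b2 - a2) * ((c1 - a1) * (d3 - a3) - (c3 - a3) * (d1 - a1))
     + (b3 - a3) * ((c1 - a1) * (d2 - a2) - (c2 - a2) * (d1 - a1))"

lemma int_vec_nth:
  "int_vec (x, y, z) $ 1 = of_int x" "int_vec (x, y, z) $ 2 = of_int y" "int_vec (x, y, z) $ 3 = of_int z"
  by (simp_all add: int_vec_def vector_3)

lemma det3_int_vec:
  "det3 (int_vec b - int_vec a) (int_vec c - int_vec a) (int_vec d - int_vec a) = of_int (int_det a b c d)"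
  by (cases a; cases b; cases c; cases d)
    (simp only: int_det.simps det3_def vector_minus_component int_vec_nth of_int_add of_int_diff of_int_mult)

definition nonadjacent :: "(nat \<times> nat) list \<Rightarrow> nat \<Rightarrow> nat \<Rightarrow> bool" where
  "nonadjacent nn a b \<longleftrightarrow> a = b \<or> (a, b) \<in> set nn \<or> (b, a) \<in> set nn"

definition K7_minus :: "(nat \<times> nat) list \<Rightarrow> nat graph" where
  "K7_minus nn = ({..<7}, {{a, b} | a b. a < 7 \<and> b < 7 \<and> \<not> nonadjacent nn a b})"

text \<open>The assumption \<open>miss\<close> of \<open>segment_misses_triangle\<close> in
  integers, for the segment from \<open>u\<close> to \<open>w\<close>.\<close>

definition int_miss :: "int_point \<Rightarrow> int_point \<Rightarrow> int_point \<Rightarrow> int_point \<Rightarrow> int_point \<Rightarrow> bool" where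
  "int_miss a b c u w \<longleftrightarrow> int_det a b c u * int_det a b c w > 0 \<or>
     \<not> (int_det u w b c * int_det u w a b > 0 \<and> int_det u w c a * int_det u w a b > 0)"

text \<open>The straight embedding with vertices \<open>cs\<close> is in general position, and in it no edge passes through a disjoint triangle.\<close>
definition panelled :: "(nat \<times> nat) list \<Rightarrow> int_point list \<Rightarrow> bool" where
  "panelled nn cs \<longleftrightarrow>
     list_all (\<lambda>a. list_all (\<lambda>b. list_all (\<lambda>c. list_all (\<lambda>d. int_det (cs ! a) (cs ! b) (cs ! c) (cs ! d) \<noteq> 0)
       [Suc c..<7]) [Suc b..<7]) [Suc a..<7]) [0..<7] \<and>
     list_all (\<lambda>a. list_all (\<lambda>b. nonadjacent nn a b \<or> list_all (\<lambda>c. nonadjacent nn a c \<or> nonadjacent nn b c \<or>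
       list_all (\<lambda>u. u = a \<or> u = b \<or> u = c \<or> list_all (\<lambda>w. w = a \<or> w = b \<or> w = c \<or> nonadjacent nn u w \<or>
         int_miss (cs ! a) (cs ! b) (cs ! c) (cs ! u) (cs ! w)) [Suc u..<7]) [0..<7])
       [Suc b..<7]) [Suc a..<7]) [0..<7]"

text \<open>Adjacent transpositions generate all orders, so a property stable under them need only
  be checked on increasing quadruples, the ones that \<open>panelled\<close> runs through.\<close>

lemma sorted_quadruple_induct:
  fixes P :: "nat \<Rightarrow> nat \<Rightarrow> nat \<Rightarrow> nat \<Rightarrow> bool"
  assumes s1: "\<And>a b c d. P a b c d \<Longrightarrow> P b a c d" and s2: "\<And>a b c d. P a b c d \<Longrightarrow> P a c b d"
    and s3: "\<And>a b c d. P a b c d \<Longrightarrow> P a b d c"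
    and base: "\<And>a b c d. a < b \<Longrightarrow> b < c \<Longrightarrow> c < d \<Longrightarrow> {a, b, c, d} \<subseteq> V \<Longrightarrow> P a b c d"
    and abcd: "distinct [a, b, c, d]" "{a, b, c, d} \<subseteq> V"
  shows "P a b c d"
proof -
  have P3: "P a b c d" if "a < b" "b < c" "distinct [a, b, c, d]" "{a, b, c, d} \<subseteq> V" for a b c d
  proof -
    have "d \<noteq> a" "d \<noteq> b" "d \<noteq> c" using that(3) by auto
    then consider "d < a" | "a < d" "d < b" | "b < d" "d < c" | "c < d" using linorder_neqE_nat by metis
    then show ?thesis
    proof cases
      case 1
      then have "P d a b c" using that by (intro base) auto
      then show ?thesis by (rule s3[OF s2[OF s1]])
    next
      case 2
      then have "P a d b c" using that by (intro base) auto
      then show ?thesis by (rule s3[OF s2])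
    next
      case 3
      then have "P a b d c" using that by (intro base) auto
      then show ?thesis by (rule s3)
    next
      case 4
      then show ?thesis using that by (intro base) auto
    qed
  qed
  have P2: "P a b c d" if "a < b" "distinct [a, b, c, d]" "{a, b, c, d} \<subseteq> V" for a b c d
  proof -
    have "c \<noteq> a" "c \<noteq> b" using that(2) by auto
    then consider "c < a" | "a < c" "c < b" | "b < c" using linorder_neqE_nat by metis
    then show ?thesis
    proof cases
      case 1
      then have "P c a b d" using that by (intro P3) auto
      then show ?thesis by (rule s2[OF s1])
    next
      case 2
      then have "P a c b d" using that by (intro P3) auto
      then show ?thesis by (rule s2)
    next
      case 3
      then show ?thesis using that by (intro P3) auto
    qed
  qed
  show ?thesis
  proof (cases "a < b")
    case True
    then show ?thesis by (rule P2[OF _ abcd])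
  next
    case False
    then have "P b a c d" using abcd by (intro P2) auto
    then show ?thesis by (rule s1)
  qed
qed

lemma sorted_triple:
  fixes a b c :: nat
  assumes "distinct [a, b, c]"
  obtains a' b' c' where "a' < b'" "b' < c'" "{a', b', c'} = {a, b, c}"
proof -
  have "a \<noteq> b" "b \<noteq> c" "a \<noteq> c" using assms by auto
  then have "a < b \<and> b < c \<or> a < c \<and> c < b \<or> b < a \<and> a < c \<or> b < c \<and> c < a \<or> c < a \<and> a < b \<or> c < b \<and> b < a"
    by linarith
  then show thesis
    by (elim disjE conjE) (erule (1) that, simp only: insert_commute)+
qed

lemma nonadjacent_commute: "nonadjacent nn a b \<longleftrightarrow> nonadjacent nn b a"
  by (auto simp: nonadjacent_def)

lemma simple_graph_K7_minus: "simple_graph (K7_minus nn)"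
proof -
  have "\<exists>u v. e = {u, v} \<and> u \<noteq> v \<and> u \<in> {..<7} \<and> v \<in> {..<7}" if "e \<in> edges (K7_minus nn)" for e
  proof -
    obtain a b where "e = {a, b}" "a < 7" "b < 7" "\<not> nonadjacent nn a b"
      using \<open>e \<in> edges (K7_minus nn)\<close> unfolding K7_minus_def edges_def snd_conv by blast
    moreover then have "a \<noteq> b" by (auto simp: nonadjacent_def)
    ultimately show ?thesis by (intro exI[of _ a] exI[of _ b]) simp
  qed
  moreover have "verts (K7_minus nn) = {..<7}" by (simp add: K7_minus_def verts_def)
  ultimately show ?thesis unfolding simple_graph_def by simp
qed

lemma edge_K7_minus: "{a, b} \<in> edges (K7_minus nn) \<longleftrightarrow> a < 7 \<and> b < 7 \<and> \<not> nonadjacent nn a b"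
proof
  assume "{a, b} \<in> edges (K7_minus nn)"
  then obtain x y where "{a, b} = {x, y}" "x < 7 \<and> y < 7 \<and> \<not> nonadjacent nn x y"
    unfolding K7_minus_def edges_def snd_conv by blast
  then show "a < 7 \<and> b < 7 \<and> \<not> nonadjacent nn a b"
    by (metis doubleton_eq_iff nonadjacent_commute)
next
  assume "a < 7 \<and> b < 7 \<and> \<not> nonadjacent nn a b"
  then show "{a, b} \<in> edges (K7_minus nn)"
    unfolding K7_minus_def edges_def snd_conv by (intro CollectI exI[of _ a] exI[of _ b] conjI refl) blast+
qed

lemma not_linked_K7_minus:
  assumes "panelled nn cs"
  shows "\<not> intrinsically_linked (K7_minus nn)"
proof -
  define p where "p i = int_vec (cs ! i)" for i
  have v: "verts (K7_minus nn) = {..<7}" by (simp add: K7_minus_def verts_def)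
  have quad: "int_det (cs ! a) (cs ! b) (cs ! c) (cs ! d) \<noteq> 0" if "a < b" "b < c" "c < d" "d < 7" for a b c d
    using assms that unfolding panelled_def list_all_iff by simp
  have gp: "det3 (p b - p a) (p c - p a) (p d - p a) \<noteq> 0"
    if "{a, b, c, d} \<subseteq> {..<7}" "distinct [a, b, c, d]" for a b c d
  proof (rule sorted_quadruple_induct[of "\<lambda>a b c d. det3 (p b - p a) (p c - p a) (p d - p a) \<noteq> 0", OF _ _ _ _ that(2,1)])
    show "det3 (p a - p b) (p c - p b) (p d - p b) \<noteq> 0" if "det3 (p b - p a) (p c - p a) (p d - p a) \<noteq> 0" for a b c d
    proof -
      have "det3 (p a - p b) (p c - p b) (p d - p b) = - det3 (p b - p a) (p c - p a) (p d - p a)"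
        by (simp add: det3_def algebra_simps)
      then show ?thesis using that by simp
    qed
    show "det3 (p c - p a) (p b - p a) (p d - p a) \<noteq> 0" if "det3 (p b - p a) (p c - p a) (p d - p a) \<noteq> 0" for a b c d
      using that det3_swap(1)[of "p c - p a" "p b - p a" "p d - p a"] by simp
    show "det3 (p b - p a) (p d - p a) (p c - p a) \<noteq> 0" if "det3 (p b - p a) (p c - p a) (p d - p a) \<noteq> 0" for a b c d
      using that det3_swap(2)[of "p b - p a" "p d - p a" "p c - p a"] by simp
    show "det3 (p b - p a) (p c - p a) (p d - p a) \<noteq> 0" if "a < b" "b < c" "c < d" "{a, b, c, d} \<subseteq> {..<7}" for a b c d
      unfolding p_def det3_int_vec using quad[OF that(1-3)] that(4) by simp
  qed
  have miss: "int_miss (cs ! a) (cs ! b) (cs ! c) (cs ! u) (cs ! w)"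
    if "a < b" "b < c" "u < w" "c < 7" "w < 7" "distinct [a, b, c, u, w]" "\<not> nonadjacent nn a b"
       "\<not> nonadjacent nn a c" "\<not> nonadjacent nn b c" "\<not> nonadjacent nn u w" for a b c u w
  proof -
    have "a \<in> {0..<7}" "b \<in> {Suc a..<7}" "c \<in> {Suc b..<7}" "u \<in> {0..<7}" "w \<in> {Suc u..<7}" using that by auto
    then show ?thesis using assms that unfolding panelled_def list_all_iff set_upt by fastforce
  qed
  show ?thesis
  proof (rule not_linked_panelled[OF simple_graph_K7_minus, of nn p])
    show "card (verts (K7_minus nn)) = 7" by (simp add: v)
    show "det3 (p b - p a) (p c - p a) (p d - p a) \<noteq> 0"
      if "{a, b, c, d} \<subseteq> verts (K7_minus nn)" "distinct [a, b, c, d]" for a b c d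
      using gp that unfolding v by blast
    fix a b c u w assume d: "distinct [a, b, c, u, w]"
      and E: "{a, b} \<in> edges (K7_minus nn)" "{b, c} \<in> edges (K7_minus nn)" "{c, a} \<in> edges (K7_minus nn)"
        "{u, w} \<in> edges (K7_minus nn)"
    have d3: "distinct [a, b, c]" using d by simp
    obtain a' b' c' where s: "a' < b'" "b' < c'" "{a', b', c'} = {a, b, c}" by (rule sorted_triple[OF d3])
    obtain u' w' where t: "u' < w'" "{u', w'} = {u, w}"
      using d by (metis distinct_length_2_or_more insert_commute linorder_neqE_nat)
    have adj: "\<not> nonadjacent nn x y" if "x \<in> {a, b, c}" "y \<in> {a, b, c}" "x \<noteq> y" for x y
      using that E(1-3) nonadjacent_commute unfolding edge_K7_minus by auto
    have mem: "a' \<in> {a, b, c}" "b' \<in> {a, b, c}" "c' \<in> {a, b, c}" "u' \<in> {u, w}" "w' \<in> {u, w}"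
      using s(3) t(2) by auto
    have m: "int_miss (cs ! a') (cs ! b') (cs ! c') (cs ! u') (cs ! w')"
    proof (rule miss)
      show "a' < b'" "b' < c'" "u' < w'" by (rule s t)+
      show "c' < 7" "w' < 7" using mem E unfolding edge_K7_minus by auto
      show "distinct [a', b', c', u', w']" using mem d s(1,2) t(1) by auto
      show "\<not> nonadjacent nn a' b'" "\<not> nonadjacent nn a' c'" "\<not> nonadjacent nn b' c'"
        using adj mem s(1,2) by auto
      show "\<not> nonadjacent nn u' w'" using E(4) t nonadjacent_commute unfolding edge_K7_minus by (auto simp: doubleton_eq_iff)
    qed
    have sub: "{u', w', a', b', c'} \<subseteq> {..<7}" using mem E unfolding edge_K7_minus by auto
    have dd: "distinct [u', w', a', b', c']" using mem d s(1,2) t(1) by auto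
    have "closed_segment (p u') (p w') \<inter> convex hull {p a', p b', p c'} = {}"
    proof (rule segment_misses_triangle)
      show "det3 (p w' - p u') (p b' - p u') (p c' - p u') \<noteq> 0" "det3 (p w' - p u') (p c' - p u') (p a' - p u') \<noteq> 0"
        "det3 (p w' - p u') (p a' - p u') (p b' - p u') \<noteq> 0"
        by (rule gp; use sub dd in auto)+
      show "0 < det3 (p b' - p a') (p c' - p a') (p u' - p a') * det3 (p b' - p a') (p c' - p a') (p w' - p a') \<or>
        \<not> (0 < det3 (p w' - p u') (p b' - p u') (p c' - p u') * det3 (p w' - p u') (p a' - p u') (p b' - p u') \<and>
           0 < det3 (p w' - p u') (p c' - p u') (p a' - p u') * det3 (p w' - p u') (p a' - p u') (p b' - p u'))"
        using m unfolding p_def det3_int_vec int_miss_def of_int_mult[symmetric] of_int_0_less_iff .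
    qed
    moreover have "closed_segment (p u') (p w') = closed_segment (p u) (p w)"
      using t(2) by (auto simp: doubleton_eq_iff closed_segment_commute)
    moreover have "p ` {a', b', c'} = p ` {a, b, c}" using s(3) by (rule arg_cong)
    then have "{p a', p b', p c'} = {p a, p b, p c}" by (simp only: image_insert image_empty)
    ultimately show "closed_segment (p u) (p w) \<inter> convex hull {p a, p b, p c} = {}" by simp
  qed
qed

abbreviation "path_pairs \<equiv> [(0, 1), (1, 2), (2, 3)] :: (nat \<times> nat) list"
abbreviation "matching_pairs \<equiv> [(0, 1), (2, 3), (4, 5)] :: (nat \<times> nat) list"

text \<open>Any seven points that pass \<open>panelled\<close> would do; integer coordinates make
  the determinants exact and small.\<close>

lemma not_linked_K7_minus_path: "\<not> intrinsically_linked (K7_minus path_pairs)"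
  by (rule not_linked_K7_minus[of _ "[(6, 2, 2), (3, 1, 4), (5, 2, 2), (4, 0, 5), (0, 0, 0), (1, 6, 3), (4, 1, 3)]"])
    code_simp

lemma not_linked_K7_minus_matching: "\<not> intrinsically_linked (K7_minus matching_pairs)"
  by (rule not_linked_K7_minus[of _ "[(0, 1, 3), (4, 1, 4), (0, 0, 3), (0, 3, 2), (1, 2, 0), (3, 4, 4), (2, 1, 3)]"])
    code_simp

section \<open>Placements of partite graphs on seven vertices\<close>

definition codes :: "nat list \<Rightarrow> nat list" where
  "codes ns = concat (map (\<lambda>i. map (\<lambda>j. 10 * i + j) [0..<ns ! i]) [0..<length ns])"

text \<open>\<open>(nn, m)\<close> places the \<open>i\<close>-th vertex in the order of \<open>codes ns\<close> at the vertex \<open>m ! i\<close> of \<open>K7_minus nn\<close>.\<close>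
type_synonym placement = "(nat \<times> nat) list \<times> nat list"

text \<open>The pairs missing from \<open>K7_minus nn\<close> may only fall on non-edges that remain
  after the deletion, those inside a part and the deleted edge; so the graph becomes a
  subgraph.\<close>

definition placement_ok :: "nat list \<Rightarrow> nat \<Rightarrow> nat \<Rightarrow> placement \<Rightarrow> bool" where
  "placement_ok ns x y w \<longleftrightarrow> (case w of (nn, m) \<Rightarrow>
     nn \<in> {path_pairs, matching_pairs} \<and> length m = length (codes ns) \<and> distinct m \<and> list_all (\<lambda>i. i < 7) m \<and>
     list_all (\<lambda>(a, s). list_all (\<lambda>(b, t). a div 10 = b div 10 \<or> a = x \<and> b = y \<or> a = y \<and> b = x \<or> \<not> nonadjacent nn s t)
       (zip (codes ns) m)) (zip (codes ns) m))"

text \<open>An edge is listed from its end in the earlier part, so \<open>P\<close> receives the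
  part numbers in increasing order.\<close>

definition placements_cover :: "nat list \<Rightarrow> (nat \<Rightarrow> nat \<Rightarrow> bool) \<Rightarrow> placement list \<Rightarrow> bool" where
  "placements_cover ns P ws \<longleftrightarrow> list_all (\<lambda>n. n < 10) ns \<and>
     list_all (\<lambda>x. list_all (\<lambda>y. x div 10 \<ge> y div 10 \<or> \<not> P (x div 10) (y div 10) \<or> list_ex (placement_ok ns x y) ws) (codes ns)) (codes ns)"

lemma set_codes: "set (codes ns) = {10 * i + j | i j. i < length ns \<and> j < ns ! i}"
  unfolding codes_def set_concat set_map set_upt
proof (intro equalityI subsetI)
  fix x assume "x \<in> (\<Union>xs\<in>(\<lambda>i. map (\<lambda>j. 10 * i + j) [0..<ns ! i]) ` {0..<length ns}. set xs)"
  then obtain i where i: "i < length ns" "x \<in> (\<lambda>j. 10 * i + j) ` {0..<ns ! i}"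
    by (metis (no_types, lifting) UN_E atLeastLessThan_iff imageE list.set_map set_upt)
  from i(2) obtain j where "x = 10 * i + j" "j < ns ! i" by (metis atLeastLessThan_iff imageE)
  then show "x \<in> {10 * i + j | i j. i < length ns \<and> j < ns ! i}" using i(1) by blast
next
  fix x assume "x \<in> {10 * i + j | i j. i < length ns \<and> j < ns ! i}"
  then obtain i j where "i < length ns" "j < ns ! i" "x = 10 * i + j" by blast
  then show "x \<in> (\<Union>xs\<in>(\<lambda>i. map (\<lambda>j. 10 * i + j) [0..<ns ! i]) ` {0..<length ns}. set xs)"
    by (auto intro!: bexI[of _ i])
qed

lemma decode_codes:
  assumes "\<forall>n\<in>set ns. n < 10"
  shows "decode ` set (codes ns) = {x. is_vertex ns x}"
proof -
  have lt: "j < 10" if "i < length ns" "j < ns ! i" for i j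
    using assms that by (meson less_trans nth_mem)
  have d: "decode (10 * i + j) = (i, j)" if "j < 10" for i j using that by (simp add: decode_def)
  show "decode ` set (codes ns) = {x. is_vertex ns x}"
  proof (intro equalityI subsetI)
    fix x assume "x \<in> decode ` set (codes ns)"
    then obtain i j where ij: "i < length ns" "j < ns ! i" "x = decode (10 * i + j)" by (auto simp: set_codes)
    then have "x = (i, j)" using d lt by simp
    then show "x \<in> {x. is_vertex ns x}" using ij by (simp add: is_vertex_def)
  next
    fix x assume "x \<in> {x. is_vertex ns x}"
    then obtain i j where ij: "x = (i, j)" "i < length ns" "j < ns ! i" by (cases x) (auto simp: is_vertex_def)
    have "10 * i + j \<in> set (codes ns)" using ij by (auto simp: set_codes)
    moreover have "x = decode (10 * i + j)" using d lt ij by simp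
    ultimately show "x \<in> decode ` set (codes ns)" by blast
  qed
qed

text \<open>By monotonicity linkedness would pass up to the seven-vertex graph, which is
  unlinked.\<close>

lemma placement_not_linked:
  assumes ns: "\<forall>n\<in>set ns. n < 10" and ok: "placement_ok ns x y w"
  shows "\<not> intrinsically_linked (delete_edge (complete_partite ns) {decode x, decode y})"
proof
  obtain nn m where w: "w = (nn, m)" by fastforce
  have o: "nn \<in> {path_pairs, matching_pairs}" "length m = length (codes ns)" "distinct m" "\<And>i. i \<in> set m \<Longrightarrow> i < 7"
    using ok unfolding placement_ok_def w by (auto simp: list_all_iff)
  have adj: "a div 10 = b div 10 \<or> a = x \<and> b = y \<or> a = y \<and> b = x \<or> \<not> nonadjacent nn s t"
    if "(a, s) \<in> set (zip (codes ns) m)" "(b, t) \<in> set (zip (codes ns) m)" for a b s t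
    using ok that unfolding placement_ok_def w list_all_iff by fastforce
  assume lk: "intrinsically_linked (delete_edge (complete_partite ns) {decode x, decode y})"
  define h where "h a = the (map_of (zip (codes ns) m) a)" for a
  define f where "f v = h (the_inv decode v)" for v
  have fd: "f (decode a) = h a" for a by (simp add: f_def the_inv_f_f[OF inj_decode])
  have hz: "(a, h a) \<in> set (zip (codes ns) m)" if "a \<in> set (codes ns)" for a
  proof -
    have "a \<in> fst ` set (zip (codes ns) m)" using that o(2) by (metis map_fst_zip set_map)
    then have "map_of (zip (codes ns) m) a \<noteq> None" by (simp add: map_of_eq_None_iff)
    then show ?thesis unfolding h_def using map_of_SomeD by fastforce
  qed
  have hm: "h a \<in> set m" if "a \<in> set (codes ns)" for a using hz[OF that] by (rule set_zip_rightD)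
  have hinj: "a = b" if ab: "a \<in> set (codes ns)" "b \<in> set (codes ns)" "h a = h b" for a b
  proof -
    obtain i where i: "i < length m" "codes ns ! i = a" "m ! i = h a" using hz[OF ab(1)] o(2) by (auto simp: set_zip)
    obtain j where j: "j < length m" "codes ns ! j = b" "m ! j = h b" using hz[OF ab(2)] o(2) by (auto simp: set_zip)
    have "i = j" using i j ab(3) o(3) by (metis nth_eq_iff_index_eq)
    then show ?thesis using i j by simp
  qed
  let ?G = "delete_edge (complete_partite ns) {decode x, decode y}"
  have v: "verts ?G = decode ` set (codes ns)"
    unfolding decode_codes[OF ns] verts_complete_partite[symmetric] by (simp add: delete_edge_def verts_def)
  have "intrinsically_linked (K7_minus nn)"
  proof (rule intrinsically_linked_mono[OF simple_graph_complete_partite lk])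
    show "inj_on f (verts ?G)" unfolding v by (auto simp: inj_on_def fd dest: hinj)
    show "f ` verts ?G \<subseteq> verts (K7_minus nn)" unfolding v using hm o(4) by (auto simp: fd K7_minus_def verts_def)
    fix e assume e: "e \<in> edges ?G"
    then have e1: "e \<in> edges (complete_partite ns)" "e \<noteq> {decode x, decode y}" by (auto simp: delete_edge_def edges_def)
    then obtain v1 v2 where "e = {v1, v2}" "is_vertex ns v1" "is_vertex ns v2" "fst v1 \<noteq> fst v2"
      unfolding edges_complete_partite by blast
    moreover then obtain a b where "v1 = decode a" "v2 = decode b" "a \<in> set (codes ns)" "b \<in> set (codes ns)"
      using decode_codes[OF ns] by blast
    ultimately have ab: "e = {decode a, decode b}" "a \<in> set (codes ns)" "b \<in> set (codes ns)" "a div 10 \<noteq> b div 10"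
      by (auto simp: decode_def)
    then have "\<not> nonadjacent nn (h a) (h b)"
      using adj[OF hz[OF ab(2)] hz[OF ab(3)]] e1(2) by auto
    then show "f ` e \<in> edges (K7_minus nn)"
      using hm[OF ab(2)] hm[OF ab(3)] o(4) unfolding ab(1) by (simp add: fd edge_K7_minus)
  qed
  then show False using o(1) not_linked_K7_minus_path not_linked_K7_minus_matching by auto
qed

lemma placements_cover_not_linked:
  assumes cov: "placements_cover ns P ws" and e: "e \<in> edges (complete_partite ns)"
    and P: "\<And>x y. e = {x, y} \<Longrightarrow> fst x < fst y \<Longrightarrow> P (fst x) (fst y)"
  shows "\<not> intrinsically_linked (delete_edge (complete_partite ns) e)"
proof -
  have ns: "\<forall>n\<in>set ns. n < 10" using cov by (simp add: placements_cover_def list_all_iff)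
  obtain v1 v2 where v: "e = {v1, v2}" "is_vertex ns v1" "is_vertex ns v2" "fst v1 \<noteq> fst v2"
    using e unfolding edges_complete_partite by blast
  have "\<exists>x y. e = {x, y} \<and> is_vertex ns x \<and> is_vertex ns y \<and> fst x < fst y"
    using v by (metis insert_commute linorder_neqE_nat)
  then obtain x y where xy: "e = {x, y}" "is_vertex ns x" "is_vertex ns y" "fst x < fst y" by blast
  obtain a b where ab: "x = decode a" "y = decode b" "a \<in> set (codes ns)" "b \<in> set (codes ns)"
    using decode_codes[OF ns] xy(2,3) by blast
  have "a div 10 < b div 10" "P (a div 10) (b div 10)" using P[OF xy(1,4)] xy(4) ab by (simp_all add: decode_def)
  then have "list_ex (placement_ok ns a b) ws"
    using cov ab unfolding placements_cover_def list_all_iff by fastforce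
  then obtain w where "placement_ok ns a b w" by (auto simp: list_ex_iff)
  then show ?thesis using placement_not_linked[OF ns] xy(1) ab by blast
qed

text \<open>The three missing pairs lie inside A, B and C, one in each, so one placement serves
  every deleted edge.\<close>

lemma not_linked_322: "placements_cover [3, 2, 2] (\<lambda>_ _. True)
    [(matching_pairs, [0, 1, 6, 2, 3, 4, 5])]"
  by code_simp

text \<open>In each entry the deleted edge takes one of the three missing pairs and the other two
  lie inside parts; there is one entry per edge.\<close>

lemma not_linked_331: "placements_cover [3, 3, 1] (\<lambda>_ _. True)
    [(path_pairs, [0, 4, 5, 1, 2, 3, 6]),
     (path_pairs, [0, 4, 5, 2, 1, 3, 6]),
     (path_pairs, [0, 4, 5, 2, 3, 1, 6]),
     (path_pairs, [1, 2, 3, 4, 5, 6, 0]),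
     (path_pairs, [0, 1, 4, 2, 3, 5, 6]),
     (path_pairs, [0, 1, 4, 3, 2, 5, 6]),
     (path_pairs, [0, 1, 4, 3, 5, 2, 6]),
     (path_pairs, [0, 2, 1, 4, 5, 6, 3]),
     (path_pairs, [0, 1, 2, 3, 4, 5, 6]),
     (path_pairs, [0, 1, 2, 4, 3, 5, 6]),
     (path_pairs, [0, 1, 2, 4, 5, 3, 6]),
     (path_pairs, [0, 1, 2, 4, 5, 6, 3]),
     (path_pairs, [4, 5, 6, 1, 2, 3, 0]),
     (path_pairs, [4, 5, 6, 0, 2, 1, 3]),
     (path_pairs, [4, 5, 6, 0, 1, 2, 3])]"
  by code_simp

lemma not_linked_2221: "placements_cover [2, 2, 2, 1] (\<lambda>_ _. True)
    [(matching_pairs, [0, 1, 2, 3, 4, 5, 6])]"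
  by code_simp

lemma not_linked_3211_ab: "placements_cover [3, 2, 1, 1] (\<lambda>i j. i = 0 \<and> j = 1)
    [(path_pairs, [1, 0, 4, 2, 3, 5, 6]),
     (path_pairs, [1, 0, 4, 3, 2, 5, 6]),
     (path_pairs, [0, 1, 4, 2, 3, 5, 6]),
     (path_pairs, [0, 1, 4, 3, 2, 5, 6]),
     (path_pairs, [0, 1, 2, 3, 4, 5, 6]),
     (path_pairs, [0, 1, 2, 4, 3, 5, 6])]"
  by code_simp

lemma not_linked_3211_ac: "placements_cover [3, 2, 1, 1] (\<lambda>i j. i = 0 \<and> j = 2)
    [(path_pairs, [1, 2, 3, 4, 5, 0, 6]),
     (path_pairs, [0, 2, 1, 4, 5, 3, 6]),
     (path_pairs, [0, 1, 2, 4, 5, 3, 6])]"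
  by code_simp

text \<open>The deleted edge is the third of three disjoint missing pairs, next to one in A and one
  in B.\<close>

lemma not_linked_3211_cd: "placements_cover [3, 2, 1, 1] (\<lambda>i j. i = 2 \<and> j = 3)
    [(matching_pairs, [0, 1, 6, 2, 3, 4, 5])]"
  by code_simp

lemma not_linked_22111_ab: "placements_cover [2, 2, 1, 1, 1] (\<lambda>i j. i = 0 \<and> j = 1)
    [(path_pairs, [1, 0, 2, 3, 4, 5, 6]),
     (path_pairs, [1, 0, 3, 2, 4, 5, 6]),
     (path_pairs, [0, 1, 2, 3, 4, 5, 6]),
     (path_pairs, [0, 1, 3, 2, 4, 5, 6])]"
  by code_simp

lemma not_linked_22111_cd: "placements_cover [2, 2, 1, 1, 1] (\<lambda>i j. i = 2 \<and> j = 3)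
    [(matching_pairs, [0, 1, 2, 3, 4, 5, 6])]"
  by code_simp

lemma not_linked_31111_ab: "placements_cover [3, 1, 1, 1, 1] (\<lambda>i j. i = 0 \<and> j = 1)
    [(path_pairs, [1, 2, 3, 0, 4, 5, 6]),
     (path_pairs, [0, 2, 1, 3, 4, 5, 6]),
     (path_pairs, [0, 1, 2, 3, 4, 5, 6])]"
  by code_simp

text \<open>Place 2 stays empty, which leaves \<open>(0, 1)\<close> as the only missing pair, and
  the two vertices of A occupy it.\<close>

lemma not_linked_21111: "placements_cover [2, 1, 1, 1, 1] (\<lambda>_ _. True)
    [(path_pairs, [0, 1, 3, 4, 5, 6])]"
  by code_simp

text \<open>The empty place is chosen so that a single missing pair remains, and it carries the
  deleted edge; hence one entry for each of the fifteen edges.\<close>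

lemma not_linked_111111: "placements_cover [1, 1, 1, 1, 1, 1] (\<lambda>_ _. True)
    [(path_pairs, [0, 1, 3, 4, 5, 6]),
     (path_pairs, [0, 3, 1, 4, 5, 6]),
     (path_pairs, [0, 3, 4, 1, 5, 6]),
     (path_pairs, [0, 3, 4, 5, 1, 6]),
     (path_pairs, [0, 3, 4, 5, 6, 1]),
     (path_pairs, [0, 2, 3, 4, 5, 6]),
     (path_pairs, [0, 2, 4, 3, 5, 6]),
     (path_pairs, [0, 2, 4, 5, 3, 6]),
     (path_pairs, [0, 2, 4, 5, 6, 3]),
     (path_pairs, [0, 4, 2, 3, 5, 6]),
     (path_pairs, [0, 4, 2, 5, 3, 6]),
     (path_pairs, [0, 4, 2, 5, 6, 3]),
     (path_pairs, [0, 4, 5, 2, 3, 6]),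
     (path_pairs, [0, 4, 5, 2, 6, 3]),
     (path_pairs, [0, 4, 5, 6, 2, 3])]"
  by code_simp

lemma edge_between_parts:
  assumes "edge_between ns a b e" "a < b" "e = {x, y}" "fst x < fst y"
  shows "fst x = a \<and> fst y = b"
proof -
  obtain j j' where "{x, y} = {(a, j), (b, j')}" using assms(1,3) unfolding edge_between_def by blast
  then consider "x = (a, j)" "y = (b, j')" | "x = (b, j')" "y = (a, j)" by (metis doubleton_eq_iff)
  then show ?thesis using assms(2,4) by cases auto
qed

lemma placements_cover_not_linked_between:
  assumes "placements_cover ns (\<lambda>i j. i = a \<and> j = b) ws" "e \<in> edges (complete_partite ns)"
    "edge_between ns a b e" "a < b"
  shows "\<not> intrinsically_linked (delete_edge (complete_partite ns) e)"
  by (rule placements_cover_not_linked[OF assms(1,2)]) (rule edge_between_parts[OF assms(3,4)])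

lemma card_is_vertex_off_first:
  "card {x. is_vertex (n # ns) x \<and> fst x \<noteq> 0} = sum_list ns"
proof -
  have "{x. is_vertex (n # ns) x \<and> fst x \<noteq> 0} = (\<lambda>x. (Suc (fst x), snd x)) ` (SIGMA i:{..<length ns}. {..<ns ! i})"
  proof (intro equalityI subsetI)
    fix x assume "x \<in> {x. is_vertex (n # ns) x \<and> fst x \<noteq> 0}"
    moreover obtain k j where "x = (k, j)" by fastforce
    ultimately obtain i where "x = (Suc i, j)" "i < length ns" "j < ns ! i"
      by (cases k) (auto simp: is_vertex_def)
    then show "x \<in> (\<lambda>x. (Suc (fst x), snd x)) ` (SIGMA i:{..<length ns}. {..<ns ! i})"
      by (intro image_eqI[of _ _ "(i, j)"]) auto
  qed (auto simp: is_vertex_def)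
  moreover have "inj_on (\<lambda>x. (Suc (fst x), snd x)) A" for A :: "(nat \<times> nat) set"
    by (auto simp: inj_on_def)
  ultimately have "card {x. is_vertex (n # ns) x \<and> fst x \<noteq> 0} = card (SIGMA i:{..<length ns}. {..<ns ! i})"
    by (simp add: card_image)
  also have "\<dots> = (\<Sum>i<length ns. ns ! i)" by simp
  finally show ?thesis by (simp add: sum_list_sum_nth atLeast0LessThan)
qed

lemma not_linked_K6:
  assumes "e \<in> edges (complete_graph 6)"
  shows "\<not> intrinsically_linked (delete_edge (complete_graph 6) e)"
proof
  assume lk: "intrinsically_linked (delete_edge (complete_graph 6) e)"
  obtain u v where uv: "e = {u, v}" "u < 6" "v < 6" "u \<noteq> v"
    using assms unfolding edges_def complete_graph_def snd_conv by blast
  have verts: "verts (delete_edge (complete_graph 6) e) = {..<6}"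
    by (simp add: delete_edge_def verts_def complete_graph_def)
  have edge: "\<exists>a b. d = {a, b} \<and> a < 6 \<and> b < 6 \<and> a \<noteq> b" if "d \<in> edges (delete_edge (complete_graph 6) e)" for d
    using that unfolding delete_edge_def edges_def complete_graph_def snd_conv by blast
  define f where "f k = (k, 0 :: nat)" for k :: nat
  have vx: "is_vertex [1, 1, 1, 1, 1, 1] (f k)" if "k < 6" for k
  proof -
    have "[1, 1, 1, 1, 1, 1] = replicate 6 (1 :: nat)" by (simp add: eval_nat_numeral)
    then show ?thesis using that by (simp add: is_vertex_def f_def)
  qed
  have edge_f: "{f a, f b} \<in> edges (complete_partite [1, 1, 1, 1, 1, 1])" if "a < 6" "b < 6" "a \<noteq> b" for a b
    unfolding edges_complete_partite
    by (rule CollectI, rule exI[of _ "f a"], rule exI[of _ "f b"]) (use vx that in \<open>auto simp: f_def\<close>)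
  have "intrinsically_linked (delete_edge (complete_partite [1, 1, 1, 1, 1, 1]) {f u, f v})"
  proof (rule intrinsically_linked_mono[OF _ lk])
    show "simple_graph (delete_edge (complete_graph 6) e)"
      unfolding simple_graph_def verts using edge by fastforce
    show "inj_on f (verts (delete_edge (complete_graph 6) e))" by (simp add: inj_on_def f_def)
    have "verts (delete_edge (complete_partite [1, 1, 1, 1, 1, 1]) {f u, f v}) = {x. is_vertex [1, 1, 1, 1, 1, 1] x}"
      unfolding verts_complete_partite[symmetric] by (simp add: delete_edge_def verts_def)
    then show "f ` verts (delete_edge (complete_graph 6) e)
        \<subseteq> verts (delete_edge (complete_partite [1, 1, 1, 1, 1, 1]) {f u, f v})"
      unfolding verts using vx by blast
    fix d assume d: "d \<in> edges (delete_edge (complete_graph 6) e)"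
    then obtain a b where ab: "d = {a, b}" "a < 6" "b < 6" "a \<noteq> b" using edge by blast
    have "d \<noteq> e" using d by (simp add: delete_edge_def edges_def)
    then have "{f a, f b} \<noteq> {f u, f v}" unfolding ab(1) uv(1) by (auto simp: f_def doubleton_eq_iff)
    then show "f ` d \<in> edges (delete_edge (complete_partite [1, 1, 1, 1, 1, 1]) {f u, f v})"
      unfolding ab(1) image_insert image_empty by (intro edges_delete_edgeI edge_f ab)
  qed
  moreover have "\<not> intrinsically_linked (delete_edge (complete_partite [1, 1, 1, 1, 1, 1]) {f u, f v})"
    by (rule placements_cover_not_linked[OF not_linked_111111 edge_f[OF uv(2,3,4)]]) simp
  ultimately show False by simp
qed

theorem theorem9:
  shows "((\<forall>e\<in>edges (complete_graph 7). intrinsically_linked (delete_edge (complete_graph 7) e)) \<and>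
    (\<forall>e\<in>edges (complete_partite [4,4]). intrinsically_linked (delete_edge (complete_partite [4,4]) e)) \<and>
    (\<forall>e\<in>edges (complete_partite [4,3,1]). intrinsically_linked (delete_edge (complete_partite [4,3,1]) e)) \<and>
    (\<forall>e\<in>edges (complete_partite [3,3,2]). intrinsically_linked (delete_edge (complete_partite [3,3,2]) e)) \<and>
    (\<forall>e\<in>edges (complete_partite [4,2,2]). intrinsically_linked (delete_edge (complete_partite [4,2,2]) e)) \<and>
    (\<forall>e\<in>edges (complete_partite [2,2,2,2]). intrinsically_linked (delete_edge (complete_partite [2,2,2,2]) e)) \<and>
    (\<forall>e\<in>edges (complete_partite [3,2,1,1]). edge_between [3,2,1,1] 1 2 e \<longrightarrow> intrinsically_linked (delete_edge (complete_partite [3,2,1,1]) e)) \<and>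
    (\<forall>e\<in>edges (complete_partite [4,2,1,1]). intrinsically_linked (delete_edge (complete_partite [4,2,1,1]) e)) \<and>
    (\<forall>e\<in>edges (complete_partite [3,3,1,1]). intrinsically_linked (delete_edge (complete_partite [3,3,1,1]) e)) \<and>
    (\<forall>e\<in>edges (complete_partite [3,2,2,1]). intrinsically_linked (delete_edge (complete_partite [3,2,2,1]) e)) \<and>
    (\<forall>e\<in>edges (complete_partite [2,2,1,1,1]). edge_between [2,2,1,1,1] 1 2 e \<longrightarrow> intrinsically_linked (delete_edge (complete_partite [2,2,1,1,1]) e)) \<and>
    (\<forall>e\<in>edges (complete_partite [3,1,1,1,1]). edge_between [3,1,1,1,1] 1 2 e \<longrightarrow> intrinsically_linked (delete_edge (complete_partite [3,1,1,1,1]) e)) \<and>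
    (\<forall>e\<in>edges (complete_partite [4,1,1,1,1]). intrinsically_linked (delete_edge (complete_partite [4,1,1,1,1]) e)) \<and>
    (\<forall>e\<in>edges (complete_partite [3,2,1,1,1]). intrinsically_linked (delete_edge (complete_partite [3,2,1,1,1]) e)) \<and>
    (\<forall>e\<in>edges (complete_partite [2,2,2,1,1]). intrinsically_linked (delete_edge (complete_partite [2,2,2,1,1]) e)) \<and>
    (\<forall>e\<in>edges (complete_partite [2,1,1,1,1,1]). intrinsically_linked (delete_edge (complete_partite [2,1,1,1,1,1]) e)) \<and>
    (\<forall>ns. length ns \<ge> 7 \<and> (\<forall>m\<in>set ns. m \<ge> 1) \<longrightarrow> (\<forall>e\<in>edges (complete_partite ns). intrinsically_linked (delete_edge (complete_partite ns) e)))) \<and>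
   ((\<forall>e\<in>edges (complete_graph 6). \<not> intrinsically_linked (delete_edge (complete_graph 6) e)) \<and>
    (\<forall>n::nat. n \<ge> 1 \<longrightarrow> (\<forall>e\<in>edges (complete_partite [n,3]). \<not> intrinsically_linked (delete_edge (complete_partite [n,3]) e))) \<and>
    (\<forall>e\<in>edges (complete_partite [3,2,2]). \<not> intrinsically_linked (delete_edge (complete_partite [3,2,2]) e)) \<and>
    (\<forall>n::nat. n \<ge> 1 \<longrightarrow> (\<forall>e\<in>edges (complete_partite [n,2,1]). \<not> intrinsically_linked (delete_edge (complete_partite [n,2,1]) e))) \<and>
    (\<forall>e\<in>edges (complete_partite [3,3,1]). \<not> intrinsically_linked (delete_edge (complete_partite [3,3,1]) e)) \<and>
    (\<forall>e\<in>edges (complete_partite [2,2,2,1]). \<not> intrinsically_linked (delete_edge (complete_partite [2,2,2,1]) e)) \<and>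
    (\<forall>n::nat. n \<ge> 1 \<longrightarrow> (\<forall>e\<in>edges (complete_partite [n,1,1,1]). \<not> intrinsically_linked (delete_edge (complete_partite [n,1,1,1]) e))) \<and>
    (\<forall>e\<in>edges (complete_partite [3,2,1,1]). edge_between [3,2,1,1] 0 1 e \<longrightarrow> \<not> intrinsically_linked (delete_edge (complete_partite [3,2,1,1]) e)) \<and>
    (\<forall>e\<in>edges (complete_partite [3,2,1,1]). edge_between [3,2,1,1] 0 2 e \<longrightarrow> \<not> intrinsically_linked (delete_edge (complete_partite [3,2,1,1]) e)) \<and>
    (\<forall>e\<in>edges (complete_partite [3,2,1,1]). edge_between [3,2,1,1] 2 3 e \<longrightarrow> \<not> intrinsically_linked (delete_edge (complete_partite [3,2,1,1]) e)) \<and>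
    (\<forall>e\<in>edges (complete_partite [2,2,1,1,1]). edge_between [2,2,1,1,1] 0 1 e \<longrightarrow> \<not> intrinsically_linked (delete_edge (complete_partite [2,2,1,1,1]) e)) \<and>
    (\<forall>e\<in>edges (complete_partite [2,2,1,1,1]). edge_between [2,2,1,1,1] 2 3 e \<longrightarrow> \<not> intrinsically_linked (delete_edge (complete_partite [2,2,1,1,1]) e)) \<and>
    (\<forall>e\<in>edges (complete_partite [3,1,1,1,1]). edge_between [3,1,1,1,1] 0 1 e \<longrightarrow> \<not> intrinsically_linked (delete_edge (complete_partite [3,1,1,1,1]) e)) \<and>
    (\<forall>e\<in>edges (complete_partite [2,1,1,1,1]). \<not> intrinsically_linked (delete_edge (complete_partite [2,1,1,1,1]) e)) \<and>
    (\<forall>e\<in>edges (complete_partite [1,1,1,1,1,1]). \<not> intrinsically_linked (delete_edge (complete_partite [1,1,1,1,1,1]) e)))"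
proof (intro conjI)
  have lt: "(0::nat) < 1" "(0::nat) < 2" "(2::nat) < 3" by simp_all
  note linked = copies_cover_linked
  note linked_between = copies_cover_between_linked
  note not_linked = placements_cover_not_linked
  note not_linked_between = placements_cover_not_linked_between
  \<comment> \<open>The cardinality becomes the sum of the sizes after the first, which is 3 in all
    three families with parameter \<open>n\<close>.\<close>
  note three = not_linked_three_off_one_part[OF _ trans[OF card_is_vertex_off_first]]
  show "\<forall>e\<in>edges (complete_graph 7). intrinsically_linked (delete_edge (complete_graph 7) e)"
    using linked_K7 by blast
  show "\<forall>e\<in>edges (complete_partite [4,4]). intrinsically_linked (delete_edge (complete_partite [4,4]) e)"
    by (rule linked[OF linked_44])
  show "\<forall>e\<in>edges (complete_partite [4,3,1]). intrinsically_linked (delete_edge (complete_partite [4,3,1]) e)"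
    by (rule linked[OF linked_431])
  show "\<forall>e\<in>edges (complete_partite [3,3,2]). intrinsically_linked (delete_edge (complete_partite [3,3,2]) e)"
    by (rule linked[OF linked_332])
  show "\<forall>e\<in>edges (complete_partite [4,2,2]). intrinsically_linked (delete_edge (complete_partite [4,2,2]) e)"
    by (rule linked[OF linked_422])
  show "\<forall>e\<in>edges (complete_partite [2,2,2,2]). intrinsically_linked (delete_edge (complete_partite [2,2,2,2]) e)"
    by (rule linked[OF linked_2222])
  show "\<forall>e\<in>edges (complete_partite [3,2,1,1]). edge_between [3,2,1,1] 1 2 e \<longrightarrow> intrinsically_linked (delete_edge (complete_partite [3,2,1,1]) e)"
    by (intro ballI impI) (rule linked_between[OF linked_3211_bc])
  show "\<forall>e\<in>edges (complete_partite [4,2,1,1]). intrinsically_linked (delete_edge (complete_partite [4,2,1,1]) e)"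
    by (rule linked[OF linked_4211])
  show "\<forall>e\<in>edges (complete_partite [3,3,1,1]). intrinsically_linked (delete_edge (complete_partite [3,3,1,1]) e)"
    by (rule linked[OF linked_3311])
  show "\<forall>e\<in>edges (complete_partite [3,2,2,1]). intrinsically_linked (delete_edge (complete_partite [3,2,2,1]) e)"
    by (rule linked[OF linked_3221])
  show "\<forall>e\<in>edges (complete_partite [2,2,1,1,1]). edge_between [2,2,1,1,1] 1 2 e \<longrightarrow> intrinsically_linked (delete_edge (complete_partite [2,2,1,1,1]) e)"
    by (intro ballI impI) (rule linked_between[OF linked_22111_bc])
  show "\<forall>e\<in>edges (complete_partite [3,1,1,1,1]). edge_between [3,1,1,1,1] 1 2 e \<longrightarrow> intrinsically_linked (delete_edge (complete_partite [3,1,1,1,1]) e)"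
    by (intro ballI impI) (rule linked_between[OF linked_31111_bc])
  show "\<forall>e\<in>edges (complete_partite [4,1,1,1,1]). intrinsically_linked (delete_edge (complete_partite [4,1,1,1,1]) e)"
    by (rule linked[OF linked_41111])
  show "\<forall>e\<in>edges (complete_partite [3,2,1,1,1]). intrinsically_linked (delete_edge (complete_partite [3,2,1,1,1]) e)"
    by (rule linked[OF linked_32111])
  show "\<forall>e\<in>edges (complete_partite [2,2,2,1,1]). intrinsically_linked (delete_edge (complete_partite [2,2,2,1,1]) e)"
    by (rule linked[OF linked_22211])
  show "\<forall>e\<in>edges (complete_partite [2,1,1,1,1,1]). intrinsically_linked (delete_edge (complete_partite [2,1,1,1,1,1]) e)"
    by (rule linked[OF linked_211111])
  show "\<forall>ns. length ns \<ge> 7 \<and> (\<forall>m\<in>set ns. m \<ge> 1) \<longrightarrow> (\<forall>e\<in>edges (complete_partite ns). intrinsically_linked (delete_edge (complete_partite ns) e))"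
    using linked_seven_parts by blast
  show "\<forall>e\<in>edges (complete_graph 6). \<not> intrinsically_linked (delete_edge (complete_graph 6) e)"
    using not_linked_K6 by blast
  show "\<forall>n::nat. n \<ge> 1 \<longrightarrow> (\<forall>e\<in>edges (complete_partite [n,3]). \<not> intrinsically_linked (delete_edge (complete_partite [n,3]) e))"
    by (intro allI impI ballI) (erule three, simp)
  show "\<forall>e\<in>edges (complete_partite [3,2,2]). \<not> intrinsically_linked (delete_edge (complete_partite [3,2,2]) e)"
    by (intro ballI) (erule not_linked[OF not_linked_322], rule TrueI)
  show "\<forall>n::nat. n \<ge> 1 \<longrightarrow> (\<forall>e\<in>edges (complete_partite [n,2,1]). \<not> intrinsically_linked (delete_edge (complete_partite [n,2,1]) e))"
    by (intro allI impI ballI) (erule three, simp)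
  show "\<forall>e\<in>edges (complete_partite [3,3,1]). \<not> intrinsically_linked (delete_edge (complete_partite [3,3,1]) e)"
    by (intro ballI) (erule not_linked[OF not_linked_331], rule TrueI)
  show "\<forall>e\<in>edges (complete_partite [2,2,2,1]). \<not> intrinsically_linked (delete_edge (complete_partite [2,2,2,1]) e)"
    by (intro ballI) (erule not_linked[OF not_linked_2221], rule TrueI)
  show "\<forall>n::nat. n \<ge> 1 \<longrightarrow> (\<forall>e\<in>edges (complete_partite [n,1,1,1]). \<not> intrinsically_linked (delete_edge (complete_partite [n,1,1,1]) e))"
    by (intro allI impI ballI) (erule three, simp)
  show "\<forall>e\<in>edges (complete_partite [3,2,1,1]). edge_between [3,2,1,1] 0 1 e \<longrightarrow> \<not> intrinsically_linked (delete_edge (complete_partite [3,2,1,1]) e)"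
    by (intro ballI impI) (erule (1) not_linked_between[OF not_linked_3211_ab _ _ lt(1)])
  show "\<forall>e\<in>edges (complete_partite [3,2,1,1]). edge_between [3,2,1,1] 0 2 e \<longrightarrow> \<not> intrinsically_linked (delete_edge (complete_partite [3,2,1,1]) e)"
    by (intro ballI impI) (erule (1) not_linked_between[OF not_linked_3211_ac _ _ lt(2)])
  show "\<forall>e\<in>edges (complete_partite [3,2,1,1]). edge_between [3,2,1,1] 2 3 e \<longrightarrow> \<not> intrinsically_linked (delete_edge (complete_partite [3,2,1,1]) e)"
    by (intro ballI impI) (erule (1) not_linked_between[OF not_linked_3211_cd _ _ lt(3)])
  show "\<forall>e\<in>edges (complete_partite [2,2,1,1,1]). edge_between [2,2,1,1,1] 0 1 e \<longrightarrow> \<not> intrinsically_linked (delete_edge (complete_partite [2,2,1,1,1]) e)"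
    by (intro ballI impI) (erule (1) not_linked_between[OF not_linked_22111_ab _ _ lt(1)])
  show "\<forall>e\<in>edges (complete_partite [2,2,1,1,1]). edge_between [2,2,1,1,1] 2 3 e \<longrightarrow> \<not> intrinsically_linked (delete_edge (complete_partite [2,2,1,1,1]) e)"
    by (intro ballI impI) (erule (1) not_linked_between[OF not_linked_22111_cd _ _ lt(3)])
  show "\<forall>e\<in>edges (complete_partite [3,1,1,1,1]). edge_between [3,1,1,1,1] 0 1 e \<longrightarrow> \<not> intrinsically_linked (delete_edge (complete_partite [3,1,1,1,1]) e)"
    by (intro ballI impI) (erule (1) not_linked_between[OF not_linked_31111_ab _ _ lt(1)])
  show "\<forall>e\<in>edges (complete_partite [2,1,1,1,1]). \<not> intrinsically_linked (delete_edge (complete_partite [2,1,1,1,1]) e)"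
    by (intro ballI) (erule not_linked[OF not_linked_21111], rule TrueI)
  show "\<forall>e\<in>edges (complete_partite [1,1,1,1,1,1]). \<not> intrinsically_linked (delete_edge (complete_partite [1,1,1,1,1,1]) e)"
    by (intro ballI) (erule not_linked[OF not_linked_111111], rule TrueI)
qed

end
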